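(* Let $\mathfrak{A}$ be a unital AF algebra with unit $1_{\mathfrak{A}}$ such that $\mathcal{U}=(\mathfrak{A}_n)_{n\in\mathbb{N}}$ is an increasing sequence of unital finite-dimensional C*-subalgebras with $\mathfrak{A}=\overline{\bigcup_{n\in\mathbb{N}}\mathfrak{A}_n}^{\|\cdot\|_{\mathfrak{A}}}$ and $\mathfrak{A}_0=\mathbb{C}1_{\mathfrak{A}}$. Let $(I^n)_{n\in\overline{\mathbb{N}}}\subseteq\mathrm{Ideal}(\mathfrak{A})\setminus\{\mathfrak{A}\}$ be such that $\{\mu_k:\mathfrak{A}/I^k\to\mathbb{C}:k\in\overline{\mathbb{N}}\}$ is a family of faithful tracial states. Let $Q^k:\mathfrak{A}\to\mathfrak{A}/I^k$ denote the quotient map for all $k\in\overline{\mathbb{N}}$. Suppose: (1) $(I^n)_{n\in\mathbb{N}}$ converges to $I^\infty$ with respect to the metric $\mathsf{m}_{i(\mathcal{U})}$ or the Fell topology, with fusing sequence $(c_n)_{n\in\mathbb{N}}$ for the fusing family $\left\{I^n=\overline{\bigcup_{k\in\mathbb{N}}I^n\cap\mathfrak{A}_k}^{\|\cdot\|_{\mathfrak{A}}}:n\in\overline{\mathbb{N}}\right\}$; (2) for each $N\in\mathbb{N}$, $(\mu_k\circ Q^k)_{k\in\mathbb{N}_{\geq c_N}}$ converges to $\mu_\infty\circ Q^\infty$ in the weak-* topology on $\mathscr{S}(\mathfrak{A}_N)$ (after restriction to $\mathfrak{A}_N$); and (3) $\{\beta^k:\mathbb{N}\to(0,\infty)\}_{k\in\overline{\mathbb{N}}}$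 is a family of sequences such that for all $N\in\mathbb{N}$, if $k\in\mathbb{N}_{\geq c_N}$, then $\beta^k(n)=\beta^\infty(n)$ for all $n\in\{0,1,\dots,N\}$, and there exists $B:\mathbb{N}\to(0,\infty)$ with $\lim_{l\to\infty}B(l)=0$ and $\beta^m(l)\leq B(l)$ for all $m\in\overline{\mathbb{N}}$, $l\in\mathbb{N}$. Then $$\lim_{n\to\infty}\mathsf{\Lambda}\left(\left(\mathfrak{A}/I^n,\mathsf{L}^{\beta^n}_{\mathcal{U}/I^n,\mu_n}\right),\left(\mathfrak{A}/I^\infty,\mathsf{L}^{\beta^\infty}_{\mathcal{U}/I^\infty,\mu_\infty}\right)\right)=0.$$
   Context: $\mathbb{N}=\{0,1,2,\dots\}$, $\overline{\mathbb{N}}=\mathbb{N}\cup\{\infty\}$, $\mathbb{N}_{\geq N}=\{k\in\mathbb{N}:k\geq N\}$. $\mathscr{S}(\cdot)$ is the state space and $\mathfrak{sa}(\cdot)$ the self-adjoint part. $\mathrm{Ideal}(\mathfrak{A})$ is the set of norm-closed two-sided ideals, including $\{0\}$ and $\mathfrak{A}$. Metric on ideals: $\mathsf{m}_{i(\mathcal{U})}(I,J)=0$ if $I\cap\mathfrak{A}_n=J\cap\mathfrak{A}_n$ for all $n$, and $=2^{-\min\{m\in\mathbb{N}:I\cap\mathfrak{A}_m\neq J\cap\mathfrak{A}_m\}}$ otherwise. Fell topology: $\mathrm{Prim}(\mathfrak{A})$ is the set of kernels of non-zero irreducible *-representations, with the Jacobson topology (closed sets: $\{J\in\mathrm{Prim}(\mathfrak{A}):J\supseteq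 I\}$, $I\in\mathrm{Ideal}(\mathfrak{A})$). On the set $\mathcal{C}l(X)$ of closed subsets of a topological space $X$, the Fell topology has basis $U(K,F)=\{Y\in\mathcal{C}l(X):Y\cap K=\emptyset,\ Y\cap A\neq\emptyset\ \forall A\in F\}$ with $K\subseteq X$ compact, $F$ a finite family of non-empty open sets. The Fell topology on $\mathrm{Ideal}(\mathfrak{A})$ is the initial topology induced by the bijection $I\mapsto\{J\in\mathrm{Prim}(\mathfrak{A}):J\supseteq I\}\in\mathcal{C}l(\mathrm{Prim}(\mathfrak{A}))$. Fusing: $\{I^n:n\in\overline{\mathbb{N}}\}$ is a fusing family with fusing sequence $(c_n)_{n\in\mathbb{N}}\subseteq\mathbb{N}$ if $(c_n)$ is non-decreasing, $\lim_nc_n=\infty$, and for all $N\in\mathbb{N}$ and $k\in\mathbb{N}_{\geq c_N}$, $I^k\cap\mathfrak{A}_n=I^\infty\cap\mathfrak{A}_n$ for all $n\in\{0,\dots,N\}$. (Convergence of $(I^n)$ to $I^\infty$ in either sense of (1) guarantees that a fusing sequence exists.) Lip-norms: for a unital AF algebra $\mathfrak{B}$ with an increasing sequence $\mathcal{V}=(\mathfrak{B}_n)_{n}$ of unital finite-dimensional C*-subalgebras with dense union and $\mathfrak{B}_0=\mathbb{C}1_{\mathfrak{B}}$, a faithful tracial state $\mu$ on $\mathfrak{B}$ and $\beta:\mathbb{N}\to(0,\infty)$ with limit $0$, let $\mathbb{E}(\cdot|\mathfrak{B}_n):\mathfrak{B}\to\mathfrak{B}_n$ be the unique conditional expectation onto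 $\mathfrak{B}_n$ with $\mu\circ\mathbb{E}(\cdot|\mathfrak{B}_n)=\mu$, and for $a\in\mathfrak{sa}(\mathfrak{B})$ let $\mathsf{L}^\beta_{\mathcal{V},\mu}(a)=\sup\{\|a-\mathbb{E}(a|\mathfrak{B}_n)\|_{\mathfrak{B}}/\beta(n):n\in\mathbb{N}\}\in[0,\infty]$. Then $(\mathfrak{B},\mathsf{L}^\beta_{\mathcal{V},\mu})$ is a $(2,0)$-quasi-Leibniz quantum compact metric space. For a proper ideal $I$ of $\mathfrak{A}$, $\mathcal{U}/I=((\mathfrak{A}_n+I)/I)_{n\in\mathbb{N}}$, where $\mathfrak{A}_n+I=\{a+b:a\in\mathfrak{A}_n,b\in I\}$; this is such a sequence for $\mathfrak{A}/I$. Quantum compact metric spaces: a $(2,0)$-quasi-Leibniz quantum compact metric space is a pair $(\mathfrak{B},\mathsf{L})$ of a unital C*-algebra and a seminorm $\mathsf{L}$ on $\mathfrak{sa}(\mathfrak{B})$ (possibly with value $\infty$) whose domain $\{a:\mathsf{L}(a)<\infty\}$ is a dense Jordan–Lie subalgebra of $\mathfrak{sa}(\mathfrak{B})$, with: $\{a:\mathsf{L}(a)=0\}=\mathbb{R}1_{\mathfrak{B}}$; $\max\{\mathsf{L}(\frac{ab+ba}{2}),\mathsf{L}(\frac{ab-ba}{2i})\}\leq2(\|a\|\mathsf{L}(b)+\|b\|\mathsf{L}(a))$ on the domain; $\mathsf{mk}_{\mathsf{L}}(\varphi,\psi)=\sup\{|\varphi(a)-\psi(a)|:\mathsf{L}(a)\leq1\}$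 metrizes the weak-* topology of $\mathscr{S}(\mathfrak{B})$; $\mathsf{L}$ is lower semi-continuous for the norm. $\mathcal{QQCMS}_{2,0}$ is the class of these. Quantum propinquity $\mathsf{\Lambda}=\mathsf{\Lambda}_{2,0}$ (Latrémolière): a bridge $\gamma=(\mathfrak{D},\omega,\pi_1,\pi_2)$ from $\mathfrak{B}_1$ to $\mathfrak{B}_2$ consists of a unital C*-algebra $\mathfrak{D}$, unital *-monomorphisms $\pi_j:\mathfrak{B}_j\to\mathfrak{D}$ and $\omega\in\mathfrak{D}$ such that $\mathscr{S}_1(\mathfrak{D}|\omega)=\{\varphi\in\mathscr{S}(\mathfrak{D}):\varphi((1-\omega)^*(1-\omega))=\varphi((1-\omega)(1-\omega)^* )=0\}$ is non-empty. Its length $\lambda(\gamma|\mathsf{L}_1,\mathsf{L}_2)$ is the maximum of (i) the Hausdorff distance in $\|\cdot\|_{\mathfrak{D}}$ between $\{\pi_1(a)\omega:a\in\mathfrak{sa}(\mathfrak{B}_1),\mathsf{L}_1(a)\leq1\}$ and $\{\omega\pi_2(b):b\in\mathfrak{sa}(\mathfrak{B}_2),\mathsf{L}_2(b)\leq1\}$, and (ii) for $j=1,2$, the Hausdorff distance for $\mathsf{mk}_{\mathsf{L}_j}$ between $\mathscr{S}(\mathfrak{B}_j)$ and $\{\varphi\circ\pi_j:\varphi\in\mathscr{S}_1(\mathfrak{D}|\omega)\}$. $\mathsf{\Lambda}((\mathfrak{B},\mathsf{L}),(\mathfrak{B}',\mathsf{L}'))$ is the infimum, over finite chains of bridges passing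 through spaces of $\mathcal{QQCMS}_{2,0}$ from $(\mathfrak{B},\mathsf{L})$ to $(\mathfrak{B}',\mathsf{L}')$, of the sum of the lengths; equivalently it is the largest symmetric class function on $\mathcal{QQCMS}_{2,0}$ satisfying the triangle inequality and bounded above by the length of every bridge. *)

theory Defs
  imports
    "HOL-Analysis.Analysis"
    "HOL-Library.Extended_Nat"
    "HOL-Algebra.Module"
    "HOL-Algebra.Subrings"
    "HOL-Algebra.QuotRing"
begin

section \<open>Unital C*-algebras\<close>

text \<open>
  Quotients, subalgebras and the algebras occurring in bridges do not live on whole types, so
  C*-algebras are records with an explicit carrier, extending the module records of HOL-Algebra.
  A subalgebra \<open>S\<close> of \<open>A\<close>, viewed as an algebra, is \<open>A\<lparr>carrier := S\<rparr>\<close>.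
\<close>

definition complex_ring :: "complex ring" where
  "complex_ring = \<lparr>carrier = UNIV, mult = (*), one = 1, zero = 0, add = (+)\<rparr>"

record 'a cstar = "(complex, 'a) module" +
  adj :: "'a \<Rightarrow> 'a"
  cnorm :: "'a \<Rightarrow> real"

text \<open>The value off the carrier only serves the requirement of \<^locale>\<open>Metric_space\<close> that distances
  be nonnegative and symmetric everywhere.\<close>

definition cdist :: "('a, 'm) cstar_scheme \<Rightarrow> 'a \<Rightarrow> 'a \<Rightarrow> real" where
  "cdist A x y = (if x \<in> carrier A \<and> y \<in> carrier A then cnorm A (x \<ominus>\<^bsub>A\<^esub> y) else 0)"

definition cstar_topology :: "('a, 'm) cstar_scheme \<Rightarrow> 'a topology" where
  "cstar_topology A = Metric_space.mtopology (carrier A) (cdist A)"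

locale unital_cstar = ring A + Module.module complex_ring A for A :: "('a, 'm) cstar_scheme" (structure) +
  assumes smult_mult_left:
      "\<lbrakk>x \<in> carrier A; y \<in> carrier A\<rbrakk> \<Longrightarrow> (s \<odot>\<^bsub>A\<^esub> x) \<otimes>\<^bsub>A\<^esub> y = s \<odot>\<^bsub>A\<^esub> (x \<otimes>\<^bsub>A\<^esub> y)"
    and smult_mult_right:
      "\<lbrakk>x \<in> carrier A; y \<in> carrier A\<rbrakk> \<Longrightarrow> x \<otimes>\<^bsub>A\<^esub> (s \<odot>\<^bsub>A\<^esub> y) = s \<odot>\<^bsub>A\<^esub> (x \<otimes>\<^bsub>A\<^esub> y)"
    and adj_closed: "x \<in> carrier A \<Longrightarrow> adj A x \<in> carrier A"
    and adj_adj: "x \<in> carrier A \<Longrightarrow> adj A (adj A x) = x"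
    and adj_add:
      "\<lbrakk>x \<in> carrier A; y \<in> carrier A\<rbrakk> \<Longrightarrow> adj A (x \<oplus>\<^bsub>A\<^esub> y) = adj A x \<oplus>\<^bsub>A\<^esub> adj A y"
    and adj_smult: "x \<in> carrier A \<Longrightarrow> adj A (s \<odot>\<^bsub>A\<^esub> x) = cnj s \<odot>\<^bsub>A\<^esub> adj A x"
    and adj_mult:
      "\<lbrakk>x \<in> carrier A; y \<in> carrier A\<rbrakk> \<Longrightarrow> adj A (x \<otimes>\<^bsub>A\<^esub> y) = adj A y \<otimes>\<^bsub>A\<^esub> adj A x"
    and cnorm_eq_0: "x \<in> carrier A \<Longrightarrow> cnorm A x = 0 \<longleftrightarrow> x = \<zero>\<^bsub>A\<^esub>"
    and cnorm_triangle:
      "\<lbrakk>x \<in> carrier A; y \<in> carrier A\<rbrakk> \<Longrightarrow> cnorm A (x \<oplus>\<^bsub>A\<^esub> y) \<le> cnorm A x + cnorm A y"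
    and cnorm_smult: "x \<in> carrier A \<Longrightarrow> cnorm A (s \<odot>\<^bsub>A\<^esub> x) = cmod s * cnorm A x"
    and cnorm_mult:
      "\<lbrakk>x \<in> carrier A; y \<in> carrier A\<rbrakk> \<Longrightarrow> cnorm A (x \<otimes>\<^bsub>A\<^esub> y) \<le> cnorm A x * cnorm A y"
    and cstar_identity: "x \<in> carrier A \<Longrightarrow> cnorm A (adj A x \<otimes>\<^bsub>A\<^esub> x) = (cnorm A x)\<^sup>2"
    and complete: "Metric_space.mcomplete (carrier A) (cdist A)"

definition sa :: "('a, 'm) cstar_scheme \<Rightarrow> 'a set" where
  "sa A = {a \<in> carrier A. adj A a = a}"

definition unital_cstar_subalgebra :: "('a, 'm) cstar_scheme \<Rightarrow> 'a set \<Rightarrow> bool" where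
  "unital_cstar_subalgebra A S \<longleftrightarrow>
     subring S A \<and> (\<forall>s. \<forall>x\<in>S. s \<odot>\<^bsub>A\<^esub> x \<in> S) \<and> (\<forall>x\<in>S. adj A x \<in> S) \<and>
     closedin (cstar_topology A) S"

definition finite_dimensional :: "('a, 'm) cstar_scheme \<Rightarrow> 'a set \<Rightarrow> bool" where
  "finite_dimensional A S \<longleftrightarrow>
     (\<exists>F. finite F \<and> F \<subseteq> S \<and> (\<forall>x\<in>S. \<exists>s. x = (\<Oplus>\<^bsub>A\<^esub>v\<in>F. s v \<odot>\<^bsub>A\<^esub> v)))"

definition AF_sequence :: "('a, 'm) cstar_scheme \<Rightarrow> (nat \<Rightarrow> 'a set) \<Rightarrow> bool" where
  "AF_sequence A U \<longleftrightarrow>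
     (\<forall>n. unital_cstar_subalgebra A (U n) \<and> finite_dimensional A (U n)) \<and>
     (\<forall>n. U n \<subseteq> U (Suc n)) \<and>
     cstar_topology A closure_of (\<Union>n. U n) = carrier A \<and>
     U 0 = {s \<odot>\<^bsub>A\<^esub> \<one>\<^bsub>A\<^esub> | s. True}"

section \<open>Closed ideals and quotients\<close>

definition closed_ideals :: "('a, 'm) cstar_scheme \<Rightarrow> 'a set set" where
  "closed_ideals A = {I. ideal I A \<and> closedin (cstar_topology A) I}"

definition cstar_quotient :: "('a, 'm) cstar_scheme \<Rightarrow> 'a set \<Rightarrow> 'a set cstar" where
  "cstar_quotient A I =
     \<lparr>carrier = carrier (A Quot I), mult = mult (A Quot I), one = one (A Quot I),
      zero = zero (A Quot I), add = add (A Quot I),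
      smult = (\<lambda>s X. \<Union>x\<in>X. I +>\<^bsub>A\<^esub> (s \<odot>\<^bsub>A\<^esub> x)),
      adj = (\<lambda>X. \<Union>x\<in>X. I +>\<^bsub>A\<^esub> adj A x),
      cnorm = (\<lambda>X. INF x\<in>X. cnorm A x)\<rparr>"

definition quotient_proj :: "('a, 'm) cstar_scheme \<Rightarrow> 'a set \<Rightarrow> 'a \<Rightarrow> 'a set" where
  "quotient_proj A I a = I +>\<^bsub>A\<^esub> a"

definition quotient_sequence ::
    "('a, 'm) cstar_scheme \<Rightarrow> (nat \<Rightarrow> 'a set) \<Rightarrow> 'a set \<Rightarrow> nat \<Rightarrow> 'a set set" where
  "quotient_sequence A U I n = quotient_proj A I ` (U n <+>\<^bsub>A\<^esub> I)"

definition ideal_metric :: "(nat \<Rightarrow> 'a set) \<Rightarrow> 'a set \<Rightarrow> 'a set \<Rightarrow> real" where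
  "ideal_metric U I J =
     (if \<forall>n. I \<inter> U n = J \<inter> U n then 0 else 1 / 2 ^ (LEAST m. I \<inter> U m \<noteq> J \<inter> U m))"

definition fusing_sequence :: "(nat \<Rightarrow> 'a set) \<Rightarrow> (enat \<Rightarrow> 'a set) \<Rightarrow> (nat \<Rightarrow> nat) \<Rightarrow> bool" where
  "fusing_sequence U I c \<longleftrightarrow>
     mono c \<and> filterlim c at_top sequentially \<and>
     (\<forall>N. \<forall>k\<ge>c N. \<forall>n\<le>N. I (enat k) \<inter> U n = I \<infinity> \<inter> U n)"

section \<open>Representations, primitive ideals and the Fell topology\<close>

text \<open>The ring multiplication and unit of the underlying module record play no role here.\<close>

record 'h hilb = "(complex, 'h) module" +
  hinner :: "'h \<Rightarrow> 'h \<Rightarrow> complex"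

definition hnorm :: "('h, 'm) hilb_scheme \<Rightarrow> 'h \<Rightarrow> real" where
  "hnorm H x = sqrt (Re (hinner H x x))"

definition hdist :: "('h, 'm) hilb_scheme \<Rightarrow> 'h \<Rightarrow> 'h \<Rightarrow> real" where
  "hdist H x y = (if x \<in> carrier H \<and> y \<in> carrier H then hnorm H (x \<ominus>\<^bsub>H\<^esub> y) else 0)"

locale hilbert_space = Module.module complex_ring H for H :: "('h, 'm) hilb_scheme" (structure) +
  assumes hinner_add:
      "\<lbrakk>x \<in> carrier H; y \<in> carrier H; z \<in> carrier H\<rbrakk> \<Longrightarrow>
         hinner H (x \<oplus>\<^bsub>H\<^esub> y) z = hinner H x z + hinner H y z"
    and hinner_smult:
      "\<lbrakk>x \<in> carrier H; y \<in> carrier H\<rbrakk> \<Longrightarrow> hinner H (s \<odot>\<^bsub>H\<^esub> x) y = s * hinner H x y"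
    and hinner_cnj: "\<lbrakk>x \<in> carrier H; y \<in> carrier H\<rbrakk> \<Longrightarrow> hinner H y x = cnj (hinner H x y)"
    and hinner_nonneg: "x \<in> carrier H \<Longrightarrow> 0 \<le> Re (hinner H x x)"
    and hinner_definite: "\<lbrakk>x \<in> carrier H; hinner H x x = 0\<rbrakk> \<Longrightarrow> x = \<zero>\<^bsub>H\<^esub>"
    and complete: "Metric_space.mcomplete (carrier H) (hdist H)"

definition bounded_operator :: "('h, 'm) hilb_scheme \<Rightarrow> ('h \<Rightarrow> 'h) \<Rightarrow> bool" where
  "bounded_operator H T \<longleftrightarrow>
     T \<in> carrier H \<rightarrow> carrier H \<and>
     (\<forall>x\<in>carrier H. \<forall>y\<in>carrier H. T (x \<oplus>\<^bsub>H\<^esub> y) = T x \<oplus>\<^bsub>H\<^esub> T y) \<and>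
     (\<forall>s. \<forall>x\<in>carrier H. T (s \<odot>\<^bsub>H\<^esub> x) = s \<odot>\<^bsub>H\<^esub> T x) \<and>
     (\<exists>K. \<forall>x\<in>carrier H. hnorm H (T x) \<le> K * hnorm H x)"

definition star_representation ::
    "('a, 'm) cstar_scheme \<Rightarrow> ('h, 'n) hilb_scheme \<Rightarrow> ('a \<Rightarrow> 'h \<Rightarrow> 'h) \<Rightarrow> bool" where
  "star_representation A H \<pi> \<longleftrightarrow>
     hilbert_space H \<and> (\<forall>a\<in>carrier A. bounded_operator H (\<pi> a)) \<and>
     (\<forall>a\<in>carrier A. \<forall>b\<in>carrier A. \<forall>x\<in>carrier H. \<pi> (a \<oplus>\<^bsub>A\<^esub> b) x = \<pi> a x \<oplus>\<^bsub>H\<^esub> \<pi> b x) \<and>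
     (\<forall>s. \<forall>a\<in>carrier A. \<forall>x\<in>carrier H. \<pi> (s \<odot>\<^bsub>A\<^esub> a) x = s \<odot>\<^bsub>H\<^esub> \<pi> a x) \<and>
     (\<forall>a\<in>carrier A. \<forall>b\<in>carrier A. \<forall>x\<in>carrier H. \<pi> (a \<otimes>\<^bsub>A\<^esub> b) x = \<pi> a (\<pi> b x)) \<and>
     (\<forall>a\<in>carrier A. \<forall>x\<in>carrier H. \<forall>y\<in>carrier H.
        hinner H (\<pi> a x) y = hinner H x (\<pi> (adj A a) y))"

definition rep_kernel ::
    "('a, 'm) cstar_scheme \<Rightarrow> ('h, 'n) hilb_scheme \<Rightarrow> ('a \<Rightarrow> 'h \<Rightarrow> 'h) \<Rightarrow> 'a set" where
  "rep_kernel A H \<pi> = {a \<in> carrier A. \<forall>x\<in>carrier H. \<pi> a x = \<zero>\<^bsub>H\<^esub>}"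

definition irreducible_rep ::
    "('a, 'm) cstar_scheme \<Rightarrow> ('h, 'n) hilb_scheme \<Rightarrow> ('a \<Rightarrow> 'h \<Rightarrow> 'h) \<Rightarrow> bool" where
  "irreducible_rep A H \<pi> \<longleftrightarrow>
     (\<forall>K. submodule K complex_ring H \<and>
          closedin (Metric_space.mtopology (carrier H) (hdist H)) K \<and>
          (\<forall>a\<in>carrier A. \<forall>x\<in>K. \<pi> a x \<in> K)
        \<longrightarrow> K = {\<zero>\<^bsub>H\<^esub>} \<or> K = carrier H)"

text \<open>
  It is enough to let Hilbert spaces range over those with carrier in the type \<open>'a set\<close>: a non-zero
  irreducible representation is unitarily equivalent to the GNS representation of a pure
  state, and the GNS space of a pure state is the (already complete) quotient of \<open>A\<close> by the left
  kernel of that state, whose elements are subsets of \<open>A\<close>.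
\<close>

definition Prim :: "('a, 'm) cstar_scheme \<Rightarrow> 'a set set" where
  "Prim A = {rep_kernel A H \<pi> | (H :: 'a set hilb) \<pi>.
     star_representation A H \<pi> \<and> rep_kernel A H \<pi> \<noteq> carrier A \<and> irreducible_rep A H \<pi>}"

definition ideal_hull :: "('a, 'm) cstar_scheme \<Rightarrow> 'a set \<Rightarrow> 'a set set" where
  "ideal_hull A I = {J \<in> Prim A. I \<subseteq> J}"

definition jacobson_topology :: "('a, 'm) cstar_scheme \<Rightarrow> 'a set topology" where
  "jacobson_topology A = topology (\<lambda>V. \<exists>I\<in>closed_ideals A. V = Prim A - ideal_hull A I)"

text \<open>The generating sets are stable under finite intersections, hence form a basis.\<close>

definition fell_topology :: "'x topology \<Rightarrow> 'x set topology" where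
  "fell_topology X = topology_generated_by
     {{Y. closedin X Y \<and> Y \<inter> K = {} \<and> (\<forall>V\<in>F. Y \<inter> V \<noteq> {})} | K F.
        compactin X K \<and> finite F \<and> (\<forall>V\<in>F. openin X V \<and> V \<noteq> {})}"

definition fell_ideal_topology :: "('a, 'm) cstar_scheme \<Rightarrow> 'a set topology" where
  "fell_ideal_topology A =
     pullback_topology (closed_ideals A) (ideal_hull A) (fell_topology (jacobson_topology A))"

section \<open>States and conditional expectations\<close>

text \<open>States are extensional functions on the carrier, so that they are determined by their
  values on the algebra.\<close>

definition states :: "('a, 'm) cstar_scheme \<Rightarrow> ('a \<Rightarrow> complex) set" where
  "states A = {\<phi> \<in> extensional (carrier A).
     (\<forall>a\<in>carrier A. \<forall>b\<in>carrier A. \<phi> (a \<oplus>\<^bsub>A\<^esub> b) = \<phi> a + \<phi> b) \<and>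
     (\<forall>s. \<forall>a\<in>carrier A. \<phi> (s \<odot>\<^bsub>A\<^esub> a) = s * \<phi> a) \<and>
     (\<forall>a\<in>carrier A. \<phi> (adj A a \<otimes>\<^bsub>A\<^esub> a) \<in> \<real> \<and> 0 \<le> Re (\<phi> (adj A a \<otimes>\<^bsub>A\<^esub> a))) \<and>
     \<phi> \<one>\<^bsub>A\<^esub> = 1}"

definition weak_star_topology :: "('a, 'm) cstar_scheme \<Rightarrow> ('a \<Rightarrow> complex) topology" where
  "weak_star_topology A =
     subtopology (product_topology (\<lambda>_. euclidean) (carrier A)) (states A)"

definition faithful_tracial_state :: "('a, 'm) cstar_scheme \<Rightarrow> ('a \<Rightarrow> complex) \<Rightarrow> bool" where
  "faithful_tracial_state A \<mu> \<longleftrightarrow>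
     \<mu> \<in> states A \<and>
     (\<forall>a\<in>carrier A. \<forall>b\<in>carrier A. \<mu> (a \<otimes>\<^bsub>A\<^esub> b) = \<mu> (b \<otimes>\<^bsub>A\<^esub> a)) \<and>
     (\<forall>a\<in>carrier A. \<mu> (adj A a \<otimes>\<^bsub>A\<^esub> a) = 0 \<longrightarrow> a = \<zero>\<^bsub>A\<^esub>)"

definition conditional_expectation ::
    "('a, 'm) cstar_scheme \<Rightarrow> 'a set \<Rightarrow> ('a \<Rightarrow> 'a) \<Rightarrow> bool" where
  "conditional_expectation A S E \<longleftrightarrow>
     E \<in> carrier A \<rightarrow>\<^sub>E S \<and>
     (\<forall>a\<in>carrier A. \<forall>b\<in>carrier A. E (a \<oplus>\<^bsub>A\<^esub> b) = E a \<oplus>\<^bsub>A\<^esub> E b) \<and>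
     (\<forall>s. \<forall>a\<in>carrier A. E (s \<odot>\<^bsub>A\<^esub> a) = s \<odot>\<^bsub>A\<^esub> E a) \<and>
     (\<forall>b\<in>S. E b = b) \<and>
     (\<forall>a\<in>carrier A. \<exists>b\<in>S. E (adj A a \<otimes>\<^bsub>A\<^esub> a) = adj A b \<otimes>\<^bsub>A\<^esub> b) \<and>
     (\<forall>a\<in>carrier A. cnorm A (E a) \<le> cnorm A a) \<and>
     (\<forall>a\<in>carrier A. \<forall>b\<in>S. \<forall>d\<in>S. E (b \<otimes>\<^bsub>A\<^esub> a \<otimes>\<^bsub>A\<^esub> d) = b \<otimes>\<^bsub>A\<^esub> E a \<otimes>\<^bsub>A\<^esub> d)"

definition cond_exp ::
    "('a, 'm) cstar_scheme \<Rightarrow> ('a \<Rightarrow> complex) \<Rightarrow> 'a set \<Rightarrow> 'a \<Rightarrow> 'a" where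
  "cond_exp A \<mu> S =
     (THE E. conditional_expectation A S E \<and> (\<forall>a\<in>carrier A. \<mu> (E a) = \<mu> a))"

section \<open>Quantum compact metric spaces\<close>

text \<open>
  A seminorm on the self-adjoint part, possibly taking the value \<open>\<infinity>\<close>, is given by an
  \<^typ>\<open>ennreal\<close>-valued function; its values outside the self-adjoint part are irrelevant, and
  \<open>0 * \<infinity> = 0\<close> holds in \<^typ>\<open>ennreal\<close>.
\<close>

definition AF_lip ::
    "('b, 'm) cstar_scheme \<Rightarrow> (nat \<Rightarrow> 'b set) \<Rightarrow> ('b \<Rightarrow> complex) \<Rightarrow> (nat \<Rightarrow> real) \<Rightarrow> 'b \<Rightarrow> ennreal" where
  "AF_lip B V \<mu> \<beta> a = (SUP n. ennreal (cnorm B (a \<ominus>\<^bsub>B\<^esub> cond_exp B \<mu> (V n) a) / \<beta> n))"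

definition seminorm_on_sa :: "('b, 'm) cstar_scheme \<Rightarrow> ('b \<Rightarrow> ennreal) \<Rightarrow> bool" where
  "seminorm_on_sa B L \<longleftrightarrow>
     (\<forall>a\<in>sa B. \<forall>b\<in>sa B. L (a \<oplus>\<^bsub>B\<^esub> b) \<le> L a + L b) \<and>
     (\<forall>t::real. \<forall>a\<in>sa B. L (complex_of_real t \<odot>\<^bsub>B\<^esub> a) = ennreal \<bar>t\<bar> * L a)"

definition jordan_prod :: "('b, 'm) cstar_scheme \<Rightarrow> 'b \<Rightarrow> 'b \<Rightarrow> 'b" where
  "jordan_prod B a b = (1 / 2) \<odot>\<^bsub>B\<^esub> (a \<otimes>\<^bsub>B\<^esub> b \<oplus>\<^bsub>B\<^esub> b \<otimes>\<^bsub>B\<^esub> a)"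

definition lie_prod :: "('b, 'm) cstar_scheme \<Rightarrow> 'b \<Rightarrow> 'b \<Rightarrow> 'b" where
  "lie_prod B a b = (1 / (2 * \<i>)) \<odot>\<^bsub>B\<^esub> (a \<otimes>\<^bsub>B\<^esub> b \<ominus>\<^bsub>B\<^esub> b \<otimes>\<^bsub>B\<^esub> a)"

definition jordan_lie_subalgebra :: "('b, 'm) cstar_scheme \<Rightarrow> 'b set \<Rightarrow> bool" where
  "jordan_lie_subalgebra B S \<longleftrightarrow>
     S \<subseteq> sa B \<and> \<zero>\<^bsub>B\<^esub> \<in> S \<and>
     (\<forall>a\<in>S. \<forall>b\<in>S. a \<oplus>\<^bsub>B\<^esub> b \<in> S) \<and>
     (\<forall>t::real. \<forall>a\<in>S. complex_of_real t \<odot>\<^bsub>B\<^esub> a \<in> S) \<and>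
     (\<forall>a\<in>S. \<forall>b\<in>S. jordan_prod B a b \<in> S \<and> lie_prod B a b \<in> S)"

definition lip_domain :: "('b, 'm) cstar_scheme \<Rightarrow> ('b \<Rightarrow> ennreal) \<Rightarrow> 'b set" where
  "lip_domain B L = {a \<in> sa B. L a < \<infinity>}"

definition lip_ball :: "('b, 'm) cstar_scheme \<Rightarrow> ('b \<Rightarrow> ennreal) \<Rightarrow> 'b set" where
  "lip_ball B L = {a \<in> sa B. L a \<le> 1}"

definition mk ::
    "('b, 'm) cstar_scheme \<Rightarrow> ('b \<Rightarrow> ennreal) \<Rightarrow> ('b \<Rightarrow> complex) \<Rightarrow> ('b \<Rightarrow> complex) \<Rightarrow> ennreal" where
  "mk B L \<phi> \<psi> = (SUP a\<in>lip_ball B L. ennreal (cmod (\<phi> a - \<psi> a)))"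

definition metrizes_by :: "'x topology \<Rightarrow> ('x \<Rightarrow> 'x \<Rightarrow> ennreal) \<Rightarrow> bool" where
  "metrizes_by X d \<longleftrightarrow>
     (\<forall>x\<in>topspace X. \<forall>y\<in>topspace X. d x y < \<infinity>) \<and>
     Metric_space (topspace X) (\<lambda>x y. enn2real (d x y)) \<and>
     Metric_space.mtopology (topspace X) (\<lambda>x y. enn2real (d x y)) = X"

text \<open>The (2,0)-quasi-Leibniz quantum compact metric spaces; the last conjunct says that \<open>L\<close> is lower
  semicontinuous.\<close>

definition QQCMS :: "('b cstar \<times> ('b \<Rightarrow> ennreal)) set" where
  "QQCMS = {(B, L).
     unital_cstar B \<and> seminorm_on_sa B L \<and>
     jordan_lie_subalgebra B (lip_domain B L) \<and>
     subtopology (cstar_topology B) (sa B) closure_of lip_domain B L = sa B \<and>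
     {a \<in> sa B. L a = 0} = {complex_of_real t \<odot>\<^bsub>B\<^esub> \<one>\<^bsub>B\<^esub> | t. True} \<and>
     (\<forall>a\<in>lip_domain B L. \<forall>b\<in>lip_domain B L.
        max (L (jordan_prod B a b)) (L (lie_prod B a b))
          \<le> 2 * (ennreal (cnorm B a) * L b + ennreal (cnorm B b) * L a)) \<and>
     metrizes_by (weak_star_topology B) (mk B L) \<and>
     (\<forall>r. closedin (subtopology (cstar_topology B) (sa B)) {a \<in> sa B. L a \<le> r})}"

section \<open>The quantum propinquity\<close>

definition hausdorff_distance :: "('x \<Rightarrow> 'x \<Rightarrow> ennreal) \<Rightarrow> 'x set \<Rightarrow> 'x set \<Rightarrow> ennreal" where
  "hausdorff_distance d X Y = max (SUP x\<in>X. INF y\<in>Y. d x y) (SUP y\<in>Y. INF x\<in>X. d x y)"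

definition unital_star_mono ::
    "('b, 'm) cstar_scheme \<Rightarrow> ('d, 'n) cstar_scheme \<Rightarrow> ('b \<Rightarrow> 'd) \<Rightarrow> bool" where
  "unital_star_mono B D f \<longleftrightarrow>
     f \<in> ring_hom B D \<and> inj_on f (carrier B) \<and>
     (\<forall>s. \<forall>a\<in>carrier B. f (s \<odot>\<^bsub>B\<^esub> a) = s \<odot>\<^bsub>D\<^esub> f a) \<and>
     (\<forall>a\<in>carrier B. f (adj B a) = adj D (f a))"

definition level_states :: "('d, 'm) cstar_scheme \<Rightarrow> 'd \<Rightarrow> ('d \<Rightarrow> complex) set" where
  "level_states D \<omega> = {\<phi> \<in> states D.
     let e = \<one>\<^bsub>D\<^esub> \<ominus>\<^bsub>D\<^esub> \<omega> in \<phi> (adj D e \<otimes>\<^bsub>D\<^esub> e) = 0 \<and> \<phi> (e \<otimes>\<^bsub>D\<^esub> adj D e) = 0}"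

record ('d, 'b, 'c) bridge =
  bridge_alg :: "'d cstar"
  pivot :: 'd
  left_emb :: "'b \<Rightarrow> 'd"
  right_emb :: "'c \<Rightarrow> 'd"

definition is_bridge :: "'b cstar \<Rightarrow> 'c cstar \<Rightarrow> ('d, 'b, 'c) bridge \<Rightarrow> bool" where
  "is_bridge B C \<gamma> \<longleftrightarrow>
     unital_cstar (bridge_alg \<gamma>) \<and> pivot \<gamma> \<in> carrier (bridge_alg \<gamma>) \<and>
     unital_star_mono B (bridge_alg \<gamma>) (left_emb \<gamma>) \<and>
     unital_star_mono C (bridge_alg \<gamma>) (right_emb \<gamma>) \<and>
     level_states (bridge_alg \<gamma>) (pivot \<gamma>) \<noteq> {}"

definition bridge_reach ::
    "('d, 'b, 'c) bridge \<Rightarrow> 'b cstar \<times> ('b \<Rightarrow> ennreal) \<Rightarrow> 'c cstar \<times> ('c \<Rightarrow> ennreal) \<Rightarrow> ennreal" where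
  "bridge_reach \<gamma> = (\<lambda>(B, LB) (C, LC).
     hausdorff_distance (\<lambda>x y. ennreal (cdist (bridge_alg \<gamma>) x y))
       ((\<lambda>a. left_emb \<gamma> a \<otimes>\<^bsub>bridge_alg \<gamma>\<^esub> pivot \<gamma>) ` lip_ball B LB)
       ((\<lambda>b. pivot \<gamma> \<otimes>\<^bsub>bridge_alg \<gamma>\<^esub> right_emb \<gamma> b) ` lip_ball C LC))"

definition embedding_height ::
    "'d cstar \<Rightarrow> 'd \<Rightarrow> ('b \<Rightarrow> 'd) \<Rightarrow> 'b cstar \<times> ('b \<Rightarrow> ennreal) \<Rightarrow> ennreal" where
  "embedding_height D \<omega> f = (\<lambda>(B, L).
     hausdorff_distance (mk B L) (states B)
       ((\<lambda>\<phi>. restrict (\<phi> \<circ> f) (carrier B)) ` level_states D \<omega>))"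

definition bridge_length ::
    "('d, 'b, 'c) bridge \<Rightarrow> 'b cstar \<times> ('b \<Rightarrow> ennreal) \<Rightarrow> 'c cstar \<times> ('c \<Rightarrow> ennreal) \<Rightarrow> ennreal" where
  "bridge_length \<gamma> X Y =
     max (bridge_reach \<gamma> X Y)
       (max (embedding_height (bridge_alg \<gamma>) (pivot \<gamma>) (left_emb \<gamma>) X)
            (embedding_height (bridge_alg \<gamma>) (pivot \<gamma>) (right_emb \<gamma>) Y))"

text \<open>
  All spaces and all bridge algebras of a chain are taken with carrier in one type \<open>'u\<close>.
  This does not change the infimum over the class of all chains. A quantum compact metric
  space is norm-separable, since its state space is weak-* compact and metrizable. A bridge algebra
  may be replaced by the C*-subalgebra generated by the pivot and the two embedded algebras: states
  restrict and extend, so the length stays the same. Thus only algebras of cardinality at most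
  the continuum matter, and these can be copied into \<open>'u\<close>, which has at least that
  cardinality because it contains the carrier of a non-zero C*-algebra.
\<close>

definition quantum_propinquity ::
    "'u cstar \<times> ('u \<Rightarrow> ennreal) \<Rightarrow> 'u cstar \<times> ('u \<Rightarrow> ennreal) \<Rightarrow> ennreal" where
  "quantum_propinquity X Y = Inf {\<Sum>i<n. bridge_length (\<gamma> i) (Z i) (Z (Suc i)) |
     n Z (\<gamma> :: nat \<Rightarrow> ('u, 'u, 'u) bridge).
       1 \<le> n \<and> Z 0 = X \<and> Z n = Y \<and> (\<forall>i\<le>n. Z i \<in> QQCMS) \<and>
       (\<forall>i<n. is_bridge (fst (Z i)) (fst (Z (Suc i))) (\<gamma> i))}"

end

theory Submission
  imports Defs
begin

text \<open>
  The quotients \<open>A/I\<^sup>n\<close> are compared with \<open>A/I\<^sup>\<infinity>\<close> through their finite-dimensional levels.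
  Fix \<open>N\<close> and let \<open>B\<^sub>N\<^sup>n\<close> be the image of \<open>U N\<close> in \<open>A/I\<^sup>n\<close>, with the Lip-norm of \<open>A/I\<^sup>n\<close>. Three bridges,
  all with the unit as pivot, form a chain
  \<open>A/I\<^sup>n \<longrightarrow> B\<^sub>N\<^sup>n \<longrightarrow> B\<^sub>N\<^sup>\<infinity> \<longrightarrow> A/I\<^sup>\<infinity>\<close>.
  With unit pivot every state of the bridge algebra counts, so the heights vanish as soon as states
  restrict onto states, and the length is the distance between the Lip balls
  (\<open>unit_bridge_length\<close>).

  The outer bridges live in \<open>A/I\<^sup>n\<close> and \<open>A/I\<^sup>\<infinity>\<close>. The conditional expectation onto level \<open>N\<close> commutes with
  the other ones and is a contraction, hence maps the Lip ball into itself; it moves the elements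
  of the Lip ball by at most \<open>\<beta> N\<close>, and composing with it extends states. So both lengths are at most
  \<open>\<beta> N\<close>, which is small uniformly in \<open>n\<close> (\<open>level_bridge\<close>).

  For the middle bridge, as soon as \<open>c N \<le> n\<close> the ideals \<open>I\<^sup>n\<close> and \<open>I\<^sup>\<infinity>\<close> have the same intersection with
  \<open>U N\<close>, so \<open>B\<^sub>N\<^sup>n\<close> and \<open>B\<^sub>N\<^sup>\<infinity>\<close> are the same C*-algebra, carrying two traces \<open>\<nu>\<close> and \<open>\<mu>\<close>. For the
  difference \<open>d\<close> of the two expectations of \<open>a\<close> onto a subalgebra, orthogonality gives
  \<open>\<mu> (d\<^sup>* d) = (\<nu> - \<mu>) (d\<^sup>* a) - (\<nu> - \<mu>) (d\<^sup>* E\<^sub>\<nu> a)\<close>, and in finite dimension the left-hand side dominates a multiple of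
  \<open>\<parallel>d\<parallel>\<^sup>2\<close> (\<open>expect_perturb\<close>). Convergence of the traces on \<open>U N\<close> therefore makes the two Lip balls close
  (\<open>lip_ball_perturb\<close>, \<open>eventually_level_bridge\<close>).

  All spaces in the chain have to be quantum compact metric spaces. That the quotient of an AF
  algebra by a closed ideal is a C*-algebra rests on \<open>quot_norm_finite_dim\<close>: on \<open>U n\<close> the quotient norm is
  \<open>\<parallel>x - x p\<parallel>\<close> with \<open>p\<close> the unit of the ideal \<open>I \<inter> U n\<close>. The expectations are orthogonal projections for the trace;
  their contractivity and positivity are \<open>norm_expect_le\<close> and \<open>expect_square\<close>. These three facts use one
  device instead of spectral theory: \<open>\<parallel>h\<parallel>\<close> is determined by the growth of \<open>h\<^bsup>2^n\<^esup>\<close> for self-adjoint \<open>h\<close>, and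
  in finite dimension any other norm changes this growth only by a constant factor. The
  Monge-Kantorovich metric induces the weak-* topology because the Lip ball is totally bounded modulo
  scalars (\<open>lip_ball_net\<close>, \<open>metrizes\<close>).

  C*-algebras are given as records with carriers. To compute in them with the type
  classes of analysis, all records over a type are embedded as corners of their product, which is
  one normed algebra.
\<close>


section \<open>Records of C*-algebras inside one normed algebra\<close>

text \<open>There is no unit in this class: a unital record will become a corner of a product, and the unit of a
  corner is only a projection of the product.\<close>

class cstar_algebra = real_normed_algebra +
  fixes scaleC :: "complex \<Rightarrow> 'a \<Rightarrow> 'a" (infixr "*\<^sub>C" 75)
    and star :: "'a \<Rightarrow> 'a"
  assumes scaleC_add_right: "s *\<^sub>C (x + y) = s *\<^sub>C x + s *\<^sub>C y"
    and scaleC_add_left: "(s + t) *\<^sub>C x = s *\<^sub>C x + t *\<^sub>C x"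
    and scaleC_scaleC [simp]: "s *\<^sub>C t *\<^sub>C x = (s * t) *\<^sub>C x"
    and scaleC_of_real: "complex_of_real r *\<^sub>C x = r *\<^sub>R x"
    and mult_scaleC_left [simp]: "(s *\<^sub>C x) * y = s *\<^sub>C (x * y)"
    and mult_scaleC_right [simp]: "x * (s *\<^sub>C y) = s *\<^sub>C (x * y)"
    and star_add [simp]: "star (x + y) = star x + star y"
    and star_scaleC [simp]: "star (s *\<^sub>C x) = cnj s *\<^sub>C star x"
    and star_mult [simp]: "star (x * y) = star y * star x"
    and star_star [simp]: "star (star x) = x"
    and norm_scaleC [simp]: "norm (s *\<^sub>C x) = cmod s * norm x"
    and norm_star_mult: "norm (star x * x) = (norm x)\<^sup>2"

lemma scaleC_one [simp]: "1 *\<^sub>C x = (x::'a::cstar_algebra)"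
  using scaleC_of_real[of 1 x] by simp

lemma scaleC_zero [simp]: "0 *\<^sub>C x = (0::'a::cstar_algebra)"
  using scaleC_of_real[of 0 x] by simp

lemma star_scaleR [simp]: "star (r *\<^sub>R (x::'a::cstar_algebra)) = r *\<^sub>R star x"
  using star_scaleC[of "complex_of_real r" x] by (simp add: scaleC_of_real)

lemma star_zero [simp]: "star 0 = (0::'a::cstar_algebra)"
  using star_scaleR[of 0 0] by simp

lemma star_uminus [simp]: "star (- (x::'a::cstar_algebra)) = - star x"
  using star_scaleR[of "-1" x] by simp

lemma star_diff [simp]: "star (x - (y::'a::cstar_algebra)) = star x - star y"
  using star_add[of x "- y"] by simp

lemma norm_le_norm_star: "norm (x::'a::cstar_algebra) \<le> norm (star x)"
proof (cases "norm x = 0")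
  case False
  have "norm x * norm x \<le> norm (star x) * norm x"
    using norm_mult_ineq[of "star x" x] by (simp add: norm_star_mult power2_eq_square)
  then show ?thesis using False by (simp add: mult_le_cancel_right)
qed (metis norm_ge_zero)

lemma norm_star [simp]: "norm (star x) = norm (x::'a::cstar_algebra)"
  using norm_le_norm_star[of x] norm_le_norm_star[of "star x"] by simp

lemma star_mult_eq_0: "star x * x = 0 \<Longrightarrow> x = (0::'a::cstar_algebra)"
  using norm_star_mult[of x] by simp

lemma scaleC_minus_right [simp]: "s *\<^sub>C (- x) = - (s *\<^sub>C (x::'a::cstar_algebra))"
  by (metis add.inverse_inverse add_eq_0_iff scaleC_add_right add.right_inverse mult_zero_right
      scaleC_scaleC scaleC_zero)

lemma scaleC_minus_left [simp]: "(- s) *\<^sub>C x = - (s *\<^sub>C (x::'a::cstar_algebra))"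
  by (metis add_eq_0_iff scaleC_add_left add.right_inverse scaleC_zero)

lemma scaleC_diff_right: "s *\<^sub>C (x - y) = s *\<^sub>C x - s *\<^sub>C (y::'a::cstar_algebra)"
  using scaleC_add_right[of s x "- y"] by simp

lemma scaleC_diff_left: "(s - t) *\<^sub>C x = s *\<^sub>C x - t *\<^sub>C (x::'a::cstar_algebra)"
  using scaleC_add_left[of s "- t" x] by simp

lemma scaleC_zero_right [simp]: "s *\<^sub>C (0::'a::cstar_algebra) = 0"
  by (metis mult_zero_right scaleC_scaleC scaleC_zero)

lemma scaleC_sum_left: "(\<Sum>i\<in>F. s i) *\<^sub>C x = (\<Sum>i\<in>F. s i *\<^sub>C (x :: 'a::cstar_algebra))"
  by (induction F rule: infinite_finite_induct) (auto simp: scaleC_add_left)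

lemma bounded_linear_star: "bounded_linear (star :: 'a::cstar_algebra \<Rightarrow> 'a)"
  by (rule bounded_linear_intro[where K = 1]) auto

lemmas tendsto_star = bounded_linear.tendsto[OF bounded_linear_star]

lemmas continuous_on_star [continuous_intros] =
  bounded_linear.continuous_on[OF bounded_linear_star]

lemma complex_ring_simps [simp]:
  "carrier complex_ring = UNIV" "\<one>\<^bsub>complex_ring\<^esub> = 1" "\<zero>\<^bsub>complex_ring\<^esub> = 0"
  "s \<oplus>\<^bsub>complex_ring\<^esub> t = s + t" "s \<otimes>\<^bsub>complex_ring\<^esub> t = s * t"
  by (auto simp: complex_ring_def)

lemma cring_complex_ring: "cring complex_ring"
proof -
  have "\<exists>y. y + x = 0 \<and> x + y = 0" for x :: complex
    by (rule exI[of _ "- x"]) simp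
  then show ?thesis
    by unfold_locales (auto simp: Units_def algebra_simps)
qed

context unital_cstar
begin

lemma abelian_group_carrier: "abelian_group A"
  using unital_cstar_axioms by (simp add: unital_cstar_def ring_def)

lemma smult_mem [simp, intro]: "x \<in> carrier A \<Longrightarrow> s \<odot> x \<in> carrier A"
  by (rule smult_closed) auto

lemma adj_mem [simp, intro]: "x \<in> carrier A \<Longrightarrow> adj A x \<in> carrier A"
  by (rule adj_closed)

lemma zero_smult [simp]: "x \<in> carrier A \<Longrightarrow> 0 \<odot> x = \<zero>"
  using smult_l_null[of x] by simp

lemma minus_one_smult: assumes "x \<in> carrier A" shows "(-1) \<odot> x = \<ominus> x"
proof -
  have "(-1) \<odot> x \<oplus> x = \<zero>"
    using smult_l_distr[of "-1" 1 x] assms smult_one[of x] by simp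
  then show ?thesis using assms by (metis abelian_group.minus_equality[OF abelian_group_carrier] smult_mem)
qed

lemma smult_zero_right: "s \<odot> \<zero> = \<zero>"
  using smult_r_null[of s] by simp

lemma adj_zero [simp]: "adj A \<zero> = \<zero>"
  using adj_smult[of \<zero> 0] by simp

lemma cnorm_zero [simp]: "cnorm A \<zero> = 0"
  using cnorm_eq_0 by simp

lemma cnorm_uminus: "x \<in> carrier A \<Longrightarrow> cnorm A (\<ominus> x) = cnorm A x"
  using cnorm_smult[of x "-1"] by (simp add: minus_one_smult)

lemma cnorm_nonneg: "x \<in> carrier A \<Longrightarrow> 0 \<le> cnorm A x"
  using cnorm_triangle[of x "\<ominus> x"] by (simp add: cnorm_uminus abelian_group.r_neg[OF abelian_group_carrier])

lemma cnorm_adj_le: assumes "x \<in> carrier A" shows "cnorm A x \<le> cnorm A (adj A x)"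
proof (cases "cnorm A x = 0")
  case False
  have "cnorm A x * cnorm A x \<le> cnorm A (adj A x) * cnorm A x"
    using cnorm_mult[of "adj A x" x] cstar_identity[of x] assms by (simp add: power2_eq_square)
  then show ?thesis using False cnorm_nonneg[OF assms] by (simp add: mult_le_cancel_right)
qed (use assms cnorm_nonneg in auto)

lemma smult_add_left: "x \<in> carrier A \<Longrightarrow> (s + t) \<odot> x = s \<odot> x \<oplus> t \<odot> x"
  using smult_l_distr[of s t x] by simp

lemma smult_add_right: "x \<in> carrier A \<Longrightarrow> y \<in> carrier A \<Longrightarrow> s \<odot> (x \<oplus> y) = s \<odot> x \<oplus> s \<odot> y"
  using smult_r_distr[of s x y] by simp

lemma smult_smult: "x \<in> carrier A \<Longrightarrow> s \<odot> (t \<odot> x) = (s * t) \<odot> x"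
  using smult_assoc1[of s t x] by simp

lemma one_smult [simp]: "x \<in> carrier A \<Longrightarrow> 1 \<odot> x = x"
  using smult_one[of x] by simp

end

text \<open>Value \<open>0\<close> for records that are not C*-algebras lets suprema range over all records of the type.\<close>

definition comp_norm :: "'a cstar \<Rightarrow> 'a \<Rightarrow> real" where
  "comp_norm A x = (if unital_cstar A then cnorm A x else 0)"

definition cstar_family :: "('a cstar \<Rightarrow> 'a) set" where
  "cstar_family = {f. (\<forall>A. if unital_cstar A then f A \<in> carrier A else f A = undefined) \<and>
     bdd_above (range (\<lambda>A. comp_norm A (f A)))}"

lemma cstar_familyI:
  assumes "\<And>A. unital_cstar A \<Longrightarrow> f A \<in> carrier A" "\<And>A. \<not> unital_cstar A \<Longrightarrow> f A = undefined"
    "\<And>A. unital_cstar A \<Longrightarrow> cnorm A (f A) \<le> K"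
  shows "f \<in> cstar_family"
proof -
  have "comp_norm A (f A) \<le> max K 0" for A
    using assms(3)[of A] by (auto simp: comp_norm_def)
  then show ?thesis using assms by (auto simp: cstar_family_def intro!: bdd_aboveI2)
qed

text \<open>The bounded families with one member in each C*-algebra record over a type form the
  \<open>\<ell>\<^sup>\<infinity>\<close>-product of all these C*-algebras. The factors embed isometrically, so
  arithmetic, limits and compactness in a record can be taken in this one type.\<close>

typedef 'a cstar_product = "cstar_family :: ('a cstar \<Rightarrow> 'a) set"
  morphisms component Abs_cstar_product
proof
  show "(\<lambda>A. if unital_cstar A then \<zero>\<^bsub>A\<^esub> else undefined) \<in> (cstar_family :: ('a cstar \<Rightarrow> 'a) set)"
    by (rule cstar_familyI[where K = 0])
      (auto simp: unital_cstar.cnorm_zero unital_cstar_def intro: ring.ring_simprules)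
qed

lemma component_mem: "unital_cstar A \<Longrightarrow> component f A \<in> carrier A"
  using component[of f] by (auto simp: cstar_family_def split: if_splits)

lemma component_outside: "\<not> unital_cstar A \<Longrightarrow> component f A = undefined"
  using component[of f] by (auto simp: cstar_family_def split: if_splits)

lemma component_bdd: "bdd_above (range (\<lambda>A. comp_norm A (component f A)))"
  using component[of f] by (auto simp: cstar_family_def)

lemma cstar_product_eqI:
  assumes "\<And>A. unital_cstar A \<Longrightarrow> component f A = component g A"
  shows "f = g"
  by (metis assms component_inject component_outside ext)

definition pointwise :: "('a cstar \<Rightarrow> 'a) \<Rightarrow> 'a cstar_product" where
  "pointwise f = Abs_cstar_product (\<lambda>A. if unital_cstar A then f A else undefined)"

lemma component_pointwise:
  assumes "\<And>A. unital_cstar A \<Longrightarrow> f A \<in> carrier A" "\<And>A. unital_cstar A \<Longrightarrow> cnorm A (f A) \<le> K"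
    "unital_cstar B"
  shows "component (pointwise f) B = f B"
proof -
  have "(\<lambda>A. if unital_cstar A then f A else undefined) \<in> cstar_family"
    by (rule cstar_familyI[where K = K]) (use assms in auto)
  then show ?thesis using assms(3) by (simp add: pointwise_def Abs_cstar_product_inverse)
qed

instantiation cstar_product :: (type) cstar_algebra
begin

definition "norm f = (SUP A. comp_norm A (component f A))"
definition "0 = pointwise (\<lambda>A. \<zero>\<^bsub>A\<^esub>)"
definition "f + g = pointwise (\<lambda>A. component f A \<oplus>\<^bsub>A\<^esub> component g A)"
definition "- f = pointwise (\<lambda>A. \<ominus>\<^bsub>A\<^esub> component f A)"
definition "f - g = f + (- g)" for f g :: "'a cstar_product"
definition "f * g = pointwise (\<lambda>A. component f A \<otimes>\<^bsub>A\<^esub> component g A)"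
definition "s *\<^sub>C f = pointwise (\<lambda>A. s \<odot>\<^bsub>A\<^esub> component f A)"
definition "star f = pointwise (\<lambda>A. adj A (component f A))"
definition "r *\<^sub>R f = complex_of_real r *\<^sub>C f" for f :: "'a cstar_product"
definition "dist f g = norm (f - g)" for f g :: "'a cstar_product"
definition "sgn f = inverse (norm f) *\<^sub>R f" for f :: "'a cstar_product"
definition "uniformity = (INF e\<in>{0<..}. principal {(x, y :: 'a cstar_product). dist x y < e})"
definition "open V = (\<forall>x\<in>V. \<forall>\<^sub>F (x', y) in uniformity. x' = x \<longrightarrow> y \<in> V)" for V :: "'a cstar_product set"

lemma comp_norm_le: "comp_norm A (component f A) \<le> norm f"
  unfolding norm_cstar_product_def by (rule cSUP_upper[OF UNIV_I component_bdd])

lemma cnorm_component_le: "unital_cstar A \<Longrightarrow> cnorm A (component f A) \<le> norm f"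
  using comp_norm_le[of A f] by (simp add: comp_norm_def)

lemma norm_cstar_product_nonneg: "0 \<le> norm (f :: 'a cstar_product)"
proof -
  have "0 \<le> comp_norm undefined (component f undefined)"
    by (simp add: comp_norm_def unital_cstar.cnorm_nonneg component_mem)
  then show ?thesis using comp_norm_le[of undefined f] by linarith
qed

lemma norm_cstar_product_leI:
  assumes "\<And>A. unital_cstar A \<Longrightarrow> cnorm A (component f A) \<le> K" "0 \<le> K"
  shows "norm f \<le> K"
  unfolding norm_cstar_product_def
  by (rule cSUP_least) (use assms in \<open>auto simp: comp_norm_def\<close>)

lemma component_zero: assumes "unital_cstar A" shows "component 0 A = \<zero>\<^bsub>A\<^esub>"
  unfolding zero_cstar_product_def using assms
  by (intro component_pointwise[where K = 0])
    (auto simp: unital_cstar.cnorm_zero unital_cstar_def intro: ring.ring_simprules)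

lemma component_add:
  assumes "unital_cstar A" shows "component (f + g) A = component f A \<oplus>\<^bsub>A\<^esub> component g A"
  unfolding plus_cstar_product_def
proof (rule component_pointwise[where K = "norm f + norm g", OF _ _ assms])
  fix B :: "'a cstar" assume B: "unital_cstar B"
  then interpret unital_cstar B .
  show "component f B \<oplus>\<^bsub>B\<^esub> component g B \<in> carrier B" by (simp add: B component_mem)
  show "cnorm B (component f B \<oplus>\<^bsub>B\<^esub> component g B) \<le> norm f + norm g"
    using cnorm_triangle[of "component f B" "component g B"] cnorm_component_le[OF B, of f]
      cnorm_component_le[OF B, of g] by (simp add: component_mem[OF B])
qed

lemma component_uminus:
  assumes "unital_cstar A" shows "component (- f) A = \<ominus>\<^bsub>A\<^esub> component f A"
  unfolding uminus_cstar_product_def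
proof (rule component_pointwise[where K = "norm f", OF _ _ assms])
  fix B :: "'a cstar" assume B: "unital_cstar B"
  then interpret unital_cstar B .
  show "\<ominus>\<^bsub>B\<^esub> component f B \<in> carrier B" by (simp add: B component_mem)
  show "cnorm B (\<ominus>\<^bsub>B\<^esub> component f B) \<le> norm f"
    using cnorm_component_le[OF B, of f] by (simp add: component_mem[OF B] cnorm_uminus)
qed

lemma component_mult:
  assumes "unital_cstar A" shows "component (f * g) A = component f A \<otimes>\<^bsub>A\<^esub> component g A"
  unfolding times_cstar_product_def
proof (rule component_pointwise[where K = "norm f * norm g", OF _ _ assms])
  fix B :: "'a cstar" assume B: "unital_cstar B"
  then interpret unital_cstar B .
  show "component f B \<otimes>\<^bsub>B\<^esub> component g B \<in> carrier B" by (simp add: B component_mem)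
  show "cnorm B (component f B \<otimes>\<^bsub>B\<^esub> component g B) \<le> norm f * norm g"
    by (rule order_trans[OF cnorm_mult mult_mono])
      (auto simp: component_mem[OF B] cnorm_component_le[OF B] cnorm_nonneg norm_cstar_product_nonneg)
qed

lemma component_scaleC:
  assumes "unital_cstar A" shows "component (s *\<^sub>C f) A = s \<odot>\<^bsub>A\<^esub> component f A"
  unfolding scaleC_cstar_product_def
proof (rule component_pointwise[where K = "cmod s * norm f", OF _ _ assms])
  fix B :: "'a cstar" assume B: "unital_cstar B"
  then interpret unital_cstar B .
  show "s \<odot>\<^bsub>B\<^esub> component f B \<in> carrier B" by (simp add: B component_mem)
  show "cnorm B (s \<odot>\<^bsub>B\<^esub> component f B) \<le> cmod s * norm f"
    by (simp add: cnorm_smult component_mem[OF B] cnorm_component_le[OF B] mult_left_mono)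
qed

lemma component_star:
  assumes "unital_cstar A" shows "component (star f) A = adj A (component f A)"
  unfolding star_cstar_product_def
proof (rule component_pointwise[where K = "norm f", OF _ _ assms])
  fix B :: "'a cstar" assume B: "unital_cstar B"
  then interpret unital_cstar B .
  show "adj B (component f B) \<in> carrier B" by (simp add: B component_mem)
  show "cnorm B (adj B (component f B)) \<le> norm f"
    using cnorm_adj_le[of "adj B (component f B)"] cnorm_component_le[OF B, of f]
    by (simp add: component_mem[OF B] adj_adj)
qed

lemmas component_ops = component_zero component_add component_uminus component_mult
  component_scaleC component_star

instance
proof
  fix f g h :: "'a cstar_product" and s t :: complex and r r' :: real
  show "f - g = f + (- g)" by (rule minus_cstar_product_def)
  show "dist f g = norm (f - g)" by (rule dist_cstar_product_def)
  show "sgn f = inverse (norm f) *\<^sub>R f" by (rule sgn_cstar_product_def)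
  show "uniformity = (INF e\<in>{0<..}. principal {(x, y :: 'a cstar_product). dist x y < e})"
    by (rule uniformity_cstar_product_def)
  show "open V = (\<forall>x\<in>V. \<forall>\<^sub>F (x', y) in uniformity. x' = x \<longrightarrow> y \<in> V)" for V :: "'a cstar_product set"
    by (rule open_cstar_product_def)
  show "complex_of_real r *\<^sub>C f = r *\<^sub>R f" by (simp add: scaleR_cstar_product_def)
  show "norm f = 0 \<longleftrightarrow> f = 0"
  proof
    assume "norm f = 0"
    show "f = 0"
    proof (rule cstar_product_eqI)
      fix A :: "'a cstar" assume A: "unital_cstar A"
      then interpret unital_cstar A .
      have "cnorm A (component f A) = 0"
        using cnorm_component_le[OF A, of f] cnorm_nonneg[OF component_mem[OF A]] \<open>norm f = 0\<close>
        by (metis order_antisym)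
      then show "component f A = component 0 A"
        by (simp add: cnorm_eq_0 component_mem[OF A] component_zero[OF A])
    qed
  next
    assume "f = 0"
    have "norm f \<le> 0" unfolding \<open>f = 0\<close>
      by (rule norm_cstar_product_leI) (auto simp: component_zero unital_cstar.cnorm_zero)
    then show "norm f = 0" using norm_cstar_product_nonneg[of f] by simp
  qed
  show "norm (f + g) \<le> norm f + norm g"
  proof (rule norm_cstar_product_leI)
    fix A :: "'a cstar" assume A: "unital_cstar A"
    then interpret unital_cstar A .
    show "cnorm A (component (f + g) A) \<le> norm f + norm g"
      using cnorm_triangle[of "component f A" "component g A"] cnorm_component_le[OF A, of f]
        cnorm_component_le[OF A, of g] by (simp add: component_mem[OF A] component_add[OF A])
  qed (simp add: norm_cstar_product_nonneg)
  show "norm (f * g) \<le> norm f * norm g"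
  proof (rule norm_cstar_product_leI)
    fix A :: "'a cstar" assume A: "unital_cstar A"
    then interpret unital_cstar A .
    show "cnorm A (component (f * g) A) \<le> norm f * norm g"
      unfolding component_mult[OF A] by (rule order_trans[OF cnorm_mult mult_mono])
        (auto simp: component_mem[OF A] cnorm_component_le[OF A] cnorm_nonneg norm_cstar_product_nonneg)
  qed (simp add: norm_cstar_product_nonneg)
  have scaleC_le: "norm (s *\<^sub>C f) \<le> cmod s * norm f" for s and f :: "'a cstar_product"
  proof (rule norm_cstar_product_leI)
    fix A :: "'a cstar" assume A: "unital_cstar A"
    then interpret unital_cstar A .
    show "cnorm A (component (s *\<^sub>C f) A) \<le> cmod s * norm f"
      by (simp add: component_scaleC[OF A] cnorm_smult component_mem[OF A] cnorm_component_le[OF A] mult_left_mono)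
  qed (simp add: norm_cstar_product_nonneg)
  show scaleC_scaleC: "s *\<^sub>C t *\<^sub>C f = (s * t) *\<^sub>C f" for s t and f :: "'a cstar_product"
    by (rule cstar_product_eqI) (simp add: component_ops unital_cstar.smult_smult component_mem)
  have one: "1 *\<^sub>C f = f" for f :: "'a cstar_product"
    by (rule cstar_product_eqI) (simp add: component_ops unital_cstar.one_smult component_mem)
  show norm_scaleC: "norm (s *\<^sub>C f) = cmod s * norm f" for s and f :: "'a cstar_product"
  proof (cases "s = 0")
    case True
    then show ?thesis using scaleC_le[of s f] norm_cstar_product_nonneg[of "s *\<^sub>C f"] by auto
  next
    case False
    have "norm f \<le> cmod (inverse s) * norm (s *\<^sub>C f)"
      using scaleC_le[of "inverse s" "s *\<^sub>C f"] False by (simp add: scaleC_scaleC one)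
    then have "cmod s * norm f \<le> norm (s *\<^sub>C f)"
      using False by (simp add: norm_inverse norm_divide field_simps)
    then show ?thesis using scaleC_le[of s f] by simp
  qed
  show "norm (r *\<^sub>R f) = \<bar>r\<bar> * norm f" by (simp add: scaleR_cstar_product_def norm_scaleC)
  show "norm (star f * f) = (norm f)\<^sup>2"
  proof (rule antisym)
    show "norm (star f * f) \<le> (norm f)\<^sup>2"
    proof (rule norm_cstar_product_leI)
      fix A :: "'a cstar" assume A: "unital_cstar A"
      then interpret unital_cstar A .
      show "cnorm A (component (star f * f) A) \<le> (norm f)\<^sup>2"
        using cnorm_component_le[OF A, of f] cnorm_nonneg[OF component_mem[OF A]]
        by (simp add: component_ops[OF A] cstar_identity component_mem[OF A] power_mono)
    qed simp
    have "norm f \<le> sqrt (norm (star f * f))"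
    proof (rule norm_cstar_product_leI)
      fix A :: "'a cstar" assume A: "unital_cstar A"
      then interpret unital_cstar A .
      show "cnorm A (component f A) \<le> sqrt (norm (star f * f))"
        using cnorm_component_le[OF A, of "star f * f"]
        by (intro real_le_rsqrt) (simp add: component_ops[OF A] cstar_identity component_mem[OF A])
    qed (simp add: norm_cstar_product_nonneg)
    then have "(norm f)\<^sup>2 \<le> (sqrt (norm (star f * f)))\<^sup>2"
      by (intro power_mono) (auto simp: norm_cstar_product_nonneg)
    then show "(norm f)\<^sup>2 \<le> norm (star f * f)"
      by (simp add: norm_cstar_product_nonneg)
  qed
  have ring: "unital_cstar A \<Longrightarrow> ring A" for A :: "'a cstar" by (simp add: unital_cstar_def)
  show "f + g + h = f + (g + h)" "f + g = g + f" "0 + f = f" "- f + f = 0"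
    "f * g * h = f * (g * h)" "(f + g) * h = f * h + g * h" "f * (g + h) = f * g + f * h"
    by (rule cstar_product_eqI; simp add: component_ops ring.ring_simprules[OF ring] component_mem)+
  show scaleC_add_right: "s *\<^sub>C (f + g) = s *\<^sub>C f + s *\<^sub>C g" for s and f g :: "'a cstar_product"
    by (rule cstar_product_eqI) (simp add: component_ops unital_cstar.smult_add_right component_mem)
  show scaleC_add_left: "(s + t) *\<^sub>C f = s *\<^sub>C f + t *\<^sub>C f" for s t and f :: "'a cstar_product"
    by (rule cstar_product_eqI) (simp add: component_ops unital_cstar.smult_add_left component_mem)
  show scaleC_mult_left: "(s *\<^sub>C f) * g = s *\<^sub>C (f * g)" for s and f g :: "'a cstar_product"
    by (rule cstar_product_eqI) (simp add: component_ops unital_cstar.smult_mult_left component_mem)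
  show scaleC_mult_right: "f * (s *\<^sub>C g) = s *\<^sub>C (f * g)" for s and f g :: "'a cstar_product"
    by (rule cstar_product_eqI) (simp add: component_ops unital_cstar.smult_mult_right component_mem)
  show "star (f + g) = star f + star g" "star (s *\<^sub>C f) = cnj s *\<^sub>C star f"
    "star (f * g) = star g * star f" "star (star f) = f"
    by (rule cstar_product_eqI; simp add: component_ops unital_cstar.adj_add unital_cstar.adj_smult
        unital_cstar.adj_mult unital_cstar.adj_adj component_mem)+
  show "r *\<^sub>R (f + g) = r *\<^sub>R f + r *\<^sub>R g" "(r + r') *\<^sub>R f = r *\<^sub>R f + r' *\<^sub>R f"
    "r *\<^sub>R r' *\<^sub>R f = (r * r') *\<^sub>R f" "1 *\<^sub>R f = f"
    "(r *\<^sub>R f) * g = r *\<^sub>R (f * g)" "f * (r *\<^sub>R g) = r *\<^sub>R (f * g)"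
    by (simp_all add: scaleR_cstar_product_def scaleC_add_left scaleC_add_right
        scaleC_scaleC one scaleC_mult_left scaleC_mult_right)
qed

end

definition emb :: "'a cstar \<Rightarrow> 'a \<Rightarrow> 'a cstar_product" where
  "emb A x = pointwise (\<lambda>B. if B = A then x else \<zero>\<^bsub>B\<^esub>)"

lemma component_emb:
  assumes "unital_cstar A" "x \<in> carrier A" "unital_cstar B"
  shows "component (emb A x) B = (if B = A then x else \<zero>\<^bsub>B\<^esub>)"
  unfolding emb_def
proof (rule component_pointwise[where K = "cnorm A x"])
  fix B :: "'a cstar" assume B: "unital_cstar B"
  then interpret unital_cstar B .
  show "(if B = A then x else \<zero>\<^bsub>B\<^esub>) \<in> carrier B" using assms by auto
  show "cnorm B (if B = A then x else \<zero>\<^bsub>B\<^esub>) \<le> cnorm A x"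
    using unital_cstar.cnorm_nonneg[OF assms(1,2)] by auto
qed (rule assms)

context
  fixes A :: "'a cstar"
  assumes A: "unital_cstar A"
begin

interpretation unital_cstar A by (rule A)

lemma norm_emb: assumes "x \<in> carrier A" shows "norm (emb A x) = cnorm A x"
proof (rule antisym)
  show "norm (emb A x) \<le> cnorm A x"
    by (rule norm_cstar_product_leI)
      (use assms cnorm_nonneg in \<open>auto simp: component_emb[OF A] unital_cstar.cnorm_zero\<close>)
  show "cnorm A x \<le> norm (emb A x)"
    using cnorm_component_le[OF A, of "emb A x"] by (simp add: component_emb[OF A assms A])
qed

lemma emb_add: "x \<in> carrier A \<Longrightarrow> y \<in> carrier A \<Longrightarrow> emb A (x \<oplus>\<^bsub>A\<^esub> y) = emb A x + emb A y"
  by (rule cstar_product_eqI)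
    (simp add: component_ops component_emb[OF A] unital_cstar_def ring.ring_simprules)

lemma emb_mult: "x \<in> carrier A \<Longrightarrow> y \<in> carrier A \<Longrightarrow> emb A (x \<otimes>\<^bsub>A\<^esub> y) = emb A x * emb A y"
  by (rule cstar_product_eqI)
    (simp add: component_ops component_emb[OF A] unital_cstar_def ring.ring_simprules)

lemma emb_uminus: "x \<in> carrier A \<Longrightarrow> emb A (\<ominus>\<^bsub>A\<^esub> x) = - emb A x"
  by (rule cstar_product_eqI)
    (simp add: component_ops component_emb[OF A] unital_cstar_def ring.ring_simprules)

lemma emb_minus: "x \<in> carrier A \<Longrightarrow> y \<in> carrier A \<Longrightarrow> emb A (x \<ominus>\<^bsub>A\<^esub> y) = emb A x - emb A y"
  by (simp add: a_minus_def emb_add emb_uminus)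

lemma emb_zero: "emb A \<zero>\<^bsub>A\<^esub> = 0"
  by (rule cstar_product_eqI) (simp add: component_ops component_emb[OF A])

lemma emb_smult: "x \<in> carrier A \<Longrightarrow> emb A (s \<odot>\<^bsub>A\<^esub> x) = s *\<^sub>C emb A x"
  by (rule cstar_product_eqI) (simp add: component_ops component_emb[OF A] unital_cstar.smult_zero_right)

lemma emb_adj: "x \<in> carrier A \<Longrightarrow> emb A (adj A x) = star (emb A x)"
  by (rule cstar_product_eqI) (simp add: component_ops component_emb[OF A] unital_cstar.adj_zero)

lemma emb_eq_iff: "x \<in> carrier A \<Longrightarrow> y \<in> carrier A \<Longrightarrow> emb A x = emb A y \<longleftrightarrow> x = y"
  using component_emb[OF A _ A] by metis

lemmas emb_simps = emb_add emb_mult emb_uminus emb_minus emb_zero emb_smult emb_adj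

end

section \<open>Finite-dimensional subspaces of a normed space\<close>

lemma closed_of_bounded_subseq:
  fixes S :: "'a::real_normed_vector set"
  assumes "\<And>x r. (\<And>n. x n \<in> S) \<Longrightarrow> (\<And>n. norm (x n) \<le> r) \<Longrightarrow>
    \<exists>l\<in>S. \<exists>g :: nat \<Rightarrow> nat. strict_mono g \<and> (x \<circ> g) \<longlonglongrightarrow> l"
  shows "closed S"
  unfolding closed_sequential_limits
proof (intro allI impI, elim conjE)
  fix y l assume y: "\<forall>n. y n \<in> S" and lim: "y \<longlonglongrightarrow> l"
  then obtain K where K: "\<And>n. norm (y n) \<le> K"
    using convergent_imp_Bseq[of y] by (auto simp: convergent_def Bseq_def)
  from y have "\<And>n. y n \<in> S" by blast
  from assms[of y, OF this K] obtain m and g :: "nat \<Rightarrow> nat"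
    where "m \<in> S" "strict_mono g" "(y \<circ> g) \<longlonglongrightarrow> m" by (elim bexE exE conjE)
  moreover have "(y \<circ> g) \<longlonglongrightarrow> l" using lim \<open>strict_mono g\<close> by (rule LIMSEQ_subseq_LIMSEQ)
  ultimately show "l \<in> S" using LIMSEQ_unique by blast
qed

text \<open>A vector \<open>v\<close> outside the closed subspace \<open>span F\<close> has distance \<open>d > 0\<close> from it, which bounds the coefficient
  of \<open>v\<close> in an element of norm at most \<open>r\<close> by \<open>r / d\<close>. So coefficients and remainders can be treated one after the other.\<close>

lemma span_bounded_seq_convergent_subseq:
  fixes x :: "nat \<Rightarrow> 'a::real_normed_vector"
  assumes "finite F" "\<And>n. x n \<in> span F" "\<And>n. norm (x n) \<le> r"
  shows "\<exists>l\<in>span F. \<exists>g. strict_mono g \<and> (x \<circ> g) \<longlonglongrightarrow> l"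
  using assms
proof (induction F arbitrary: x r rule: finite_induct)
  case empty
  then have "x = (\<lambda>n. 0)" by auto
  then have "(x \<circ> id) \<longlonglongrightarrow> 0" by (simp add: o_def)
  then show ?case using strict_mono_id by (metis span_zero)
next
  case (insert v F)
  show ?case
  proof (cases "v \<in> span F")
    case True
    then have "span (insert v F) = span F" by (rule span_redundant)
    then have "\<And>n. x n \<in> span F" using insert.prems(1) by simp
    from insert.IH[of x, OF this insert.prems(2)] show ?thesis using \<open>span (insert v F) = span F\<close> by simp
  next
    case False
    have closed: "closed (span F)" by (rule closed_of_bounded_subseq[OF insert.IH])
    define d where "d = infdist v (span F)"
    have d: "d > 0" unfolding d_def
      using infdist_pos_not_in_closed[OF closed] span_zero False by blast
    have "\<forall>n. \<exists>k. x n - k *\<^sub>R v \<in> span F" using insert.prems(1) by (simp add: span_breakdown_eq)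
    then obtain t where t: "\<And>n. x n - t n *\<^sub>R v \<in> span F" by metis
    have t_le: "\<bar>t n\<bar> \<le> r / d" for n
    proof (cases "t n = 0")
      case True
      have "0 \<le> r" using insert.prems(2)[of n] norm_ge_zero[of "x n"] by linarith
      then show ?thesis using True d by simp
    next
      case False
      let ?y = "(- 1 / t n) *\<^sub>R (x n - t n *\<^sub>R v)"
      have "d \<le> dist v ?y"
        unfolding d_def by (intro infdist_le span_scale t)
      also have "v - ?y = (1 / t n) *\<^sub>R x n" using False by (simp add: algebra_simps)
      then have "dist v ?y = norm (x n) / \<bar>t n\<bar>" by (simp add: dist_norm)
      finally have "d * \<bar>t n\<bar> \<le> r" using False insert.prems(2)[of n] by (simp add: field_simps)
      then show ?thesis using d by (simp add: field_simps)
    qed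
    have "bounded (range t)" unfolding bounded_iff using t_le by auto
    then obtain s g where g: "strict_mono g" and ts: "(t \<circ> g) \<longlonglongrightarrow> s"
      using bounded_imp_convergent_subsequence[of t] by auto
    define y where "y n = x (g n) - t (g n) *\<^sub>R v" for n
    have y_span: "y n \<in> span F" for n unfolding y_def by (rule t)
    have "norm (y n) \<le> r + r / d * norm v" for n
    proof -
      have "norm (y n) \<le> norm (x (g n)) + norm (t (g n) *\<^sub>R v)" unfolding y_def by (rule norm_triangle_ineq4)
      also have "\<dots> \<le> r + r / d * norm v"
        using insert.prems(2)[of "g n"] mult_right_mono[OF t_le[of "g n"], of "norm v"] by auto
      finally show ?thesis .
    qed
    note y_mem = y_span this
    obtain m and h :: "nat \<Rightarrow> nat" where mh: "m \<in> span F" "strict_mono h" "(y \<circ> h) \<longlonglongrightarrow> m"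
      using insert.IH[of y, OF y_mem] by (elim bexE exE conjE)
    have "(\<lambda>n. (y \<circ> h) n + (t \<circ> g) (h n) *\<^sub>R v) \<longlonglongrightarrow> m + s *\<^sub>R v"
      using LIMSEQ_subseq_LIMSEQ[OF ts mh(2)] by (intro tendsto_intros mh(3)) (simp add: o_def)
    then have "(x \<circ> (g \<circ> h)) \<longlonglongrightarrow> m + s *\<^sub>R v" by (simp add: y_def o_def)
    moreover have "m + s *\<^sub>R v \<in> span (insert v F)"
      using mh(1) span_mono[of F "insert v F"] span_base[of v "insert v F"] by (auto intro!: span_add span_scale)
    moreover have "strict_mono (g \<circ> h)" using g mh(2) by (rule strict_mono_o)
    ultimately show ?thesis by blast
  qed
qed

lemma closed_span_finite: "finite F \<Longrightarrow> closed (span F)" for F :: "'a::real_normed_vector set"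
  by (rule closed_of_bounded_subseq[OF span_bounded_seq_convergent_subseq])

lemma compact_bounded_span_finite:
  fixes F :: "'a::real_normed_vector set"
  assumes "finite F"
  shows "compact {x \<in> span F. norm x \<le> r}"
  unfolding compact_eq_seq_compact_metric seq_compact_def
proof (intro allI impI)
  fix x :: "nat \<Rightarrow> 'a" assume x: "\<forall>n. x n \<in> {x \<in> span F. norm x \<le> r}"
  then have x': "\<And>n. x n \<in> span F" "\<And>n. norm (x n) \<le> r" by auto
  from span_bounded_seq_convergent_subseq[of F x, OF assms x'] obtain l and g :: "nat \<Rightarrow> nat"
    where lg: "l \<in> span F" "strict_mono g" "(x \<circ> g) \<longlonglongrightarrow> l" by (elim bexE exE conjE)
  have "norm l \<le> r"
    by (rule LIMSEQ_le_const2[OF tendsto_norm[OF lg(3)]]) (use x in auto)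
  then show "\<exists>l\<in>{x \<in> span F. norm x \<le> r}. \<exists>g. strict_mono g \<and> (x \<circ> g) \<longlonglongrightarrow> l"
    using lg(1) by (intro bexI[where x = l] exI[where x = g] conjI lg(2,3)) auto
qed

text \<open>Equivalence of norms in finite dimension, in the form in which it is used below: a continuous
  function that is homogeneous of some degree and positive away from \<open>0\<close> dominates a multiple of
  the corresponding power of the norm.\<close>

lemma finite_dim_coercive:
  fixes F :: "'a::real_normed_vector set" and q :: "'a \<Rightarrow> real"
  assumes "finite F" "continuous_on (span F) q"
    and pos: "\<And>x. x \<in> span F \<Longrightarrow> x \<noteq> 0 \<Longrightarrow> 0 < q x"
    and hom: "\<And>t x. x \<in> span F \<Longrightarrow> 0 < t \<Longrightarrow> q (t *\<^sub>R x) = t ^ k * q x"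
    and zero: "0 \<le> q 0" "0 < k"
  shows "\<exists>\<kappa>>0. \<forall>x\<in>span F. \<kappa> * norm x ^ k \<le> q x"
proof -
  let ?S = "{x \<in> span F. norm x \<le> 1} \<inter> {x. norm x = 1}"
  have compact: "compact ?S"
    by (intro compact_Int_closed compact_bounded_span_finite assms closed_Collect_eq continuous_intros)
  have cont: "continuous_on ?S q" using assms(2) by (rule continuous_on_subset) auto
  obtain \<kappa> where \<kappa>: "\<kappa> > 0" "\<And>x. x \<in> ?S \<Longrightarrow> \<kappa> \<le> q x"
  proof (cases "?S = {}")
    case True
    then show ?thesis using that[of 1] by auto
  next
    case False
    then obtain z where z: "z \<in> ?S" "\<And>x. x \<in> ?S \<Longrightarrow> q z \<le> q x"
      using continuous_attains_inf[OF compact _ cont] by auto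
    then have "z \<in> span F" "z \<noteq> 0" by auto
    then have "q z > 0" by (rule pos)
    then show ?thesis using that[of "q z"] z by auto
  qed
  have "\<kappa> * norm x ^ k \<le> q x" if x: "x \<in> span F" for x
  proof (cases "x = 0")
    case False
    let ?u = "inverse (norm x) *\<^sub>R x"
    have "?u \<in> ?S" using x False by (auto intro: span_scale)
    then have "\<kappa> \<le> q ?u" by (rule \<kappa>)
    also have "q ?u = inverse (norm x) ^ k * q x" using False x by (intro hom) auto
    finally show ?thesis using False by (simp add: field_simps)
  qed (use zero in \<open>auto simp: zero_power\<close>)
  then show ?thesis using \<kappa>(1) by blast
qed

lemma finite_dim_injective_imp_surjective:
  fixes f :: "'a::real_vector \<Rightarrow> 'a"
  assumes "linear f" "finite F" "subspace V" "V \<subseteq> span F" "f ` V \<subseteq> V"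
    and inj: "\<And>x. x \<in> V \<Longrightarrow> f x = 0 \<Longrightarrow> x = 0"
  shows "f ` V = V"
proof (rule ccontr)
  assume "f ` V \<noteq> V"
  then obtain w where w: "w \<in> V" "w \<notin> f ` V" using assms(5) by auto
  obtain B where B: "B \<subseteq> V" "independent B" "V \<subseteq> span B" by (metis basis_exists)
  have "span B = V" using B assms(3) by (metis span_minimal subset_antisym)
  have finB: "finite B" using independent_span_bound[OF assms(2) B(2)] B(1) assms(4) by auto
  have "inj_on f (span B)"
    using linear_inj_on_iff_eq_0[OF assms(1) subspace_span, of B] inj \<open>span B = V\<close> by auto
  then have ind: "independent (f ` B)" "inj_on f B"
    using linear_independent_injective_image[OF assms(1) B(2)] inj_on_subset[OF _ span_superset] by auto
  have "span (f ` B) = f ` V" using linear_span_image[OF assms(1)] \<open>span B = V\<close> by metis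
  then have "independent (insert w (f ` B))" "w \<notin> f ` B"
    using w(2) independent_insertI[OF _ ind(1), of w] span_base[of w "f ` B"] by auto
  moreover have "insert w (f ` B) \<subseteq> span B"
    using w(1) B assms(5) by auto
  ultimately have "card (insert w (f ` B)) \<le> card B"
    using independent_span_bound[OF finB] by auto
  then show False using \<open>w \<notin> f ` B\<close> finB ind(2) by (simp add: card_image)
qed

lemma dim_strict_mono:
  fixes S T :: "'a::real_vector set"
  assumes "finite F" "subspace S" "S \<subset> T" "T \<subseteq> span F"
  shows "dim S < dim T"
proof -
  obtain B where B: "B \<subseteq> S" "independent B" "S \<subseteq> span B" "card B = dim S" by (rule basis_exists)
  obtain C where C: "C \<subseteq> T" "independent C" "T \<subseteq> span C" "card C = dim T" by (rule basis_exists)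
  have finC: "finite C" using independent_span_bound[OF assms(1) C(2)] C(1) assms(4) by auto
  obtain t where t: "t \<in> T" "t \<notin> S" using assms(3) by auto
  have "span B = S" using B assms(2) by (metis span_minimal subset_antisym)
  then have "independent (insert t B)" using t B(2) by (intro independent_insertI) auto
  then have "finite (insert t B) \<and> card (insert t B) \<le> card C"
    by (rule independent_span_bound[OF finC]) (use t B(1) C(3) assms(3) in auto)
  moreover have "t \<notin> B" using t B(1) by auto
  ultimately show ?thesis using B(4) C(4) by auto
qed

section \<open>Square roots and positive functionals\<close>

text \<open>The norm of \<open>h\<close> can be read off the growth of its iterated squares, and this survives the
  passage to any bound that is only known up to a constant factor.\<close>

definition iter_square :: "nat \<Rightarrow> 'a::times \<Rightarrow> 'a" where
  "iter_square n x = ((\<lambda>y. y * y) ^^ n) x"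

lemma iter_square_0 [simp]: "iter_square 0 x = x"
  and iter_square_Suc [simp]: "iter_square (Suc n) x = iter_square n x * iter_square n x"
  by (simp_all add: iter_square_def)

lemma star_iter_square:
  "star h = h \<Longrightarrow> star (iter_square n h) = iter_square n (h :: 'a::cstar_algebra)"
  by (induction n) auto

lemma norm_iter_square:
  assumes "star h = (h :: 'a::cstar_algebra)"
  shows "norm (iter_square n h) = norm h ^ 2 ^ n"
proof (induction n)
  case (Suc n)
  have "norm (iter_square (Suc n) h) = (norm (iter_square n h))\<^sup>2"
    using norm_star_mult[of "iter_square n h"] by (simp add: star_iter_square[OF assms])
  then show ?case using Suc by (simp add: power_mult[symmetric] mult.commute)
qed simp

lemma submult_iter_square:
  assumes "\<And>x. x \<in> W \<Longrightarrow> x * x \<in> W" "\<And>x. x \<in> W \<Longrightarrow> q (x * x) \<le> q x * q x"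
    "\<And>x. (0::real) \<le> q x" "h \<in> W"
  shows "iter_square n h \<in> W" "q (iter_square n h) \<le> q h ^ 2 ^ n"
proof (induction n)
  case (Suc n)
  { case 1 then show ?case using Suc assms(1) by simp }
  { case 2
    have "q (iter_square (Suc n) h) \<le> q (iter_square n h) * q (iter_square n h)"
      using assms(2) Suc by simp
    also have "\<dots> \<le> q h ^ 2 ^ n * q h ^ 2 ^ n"
      by (intro mult_mono Suc assms(3) zero_le_power)
    finally show ?case by (simp add: power_add[symmetric] mult_2) }
qed (use assms in auto)

lemma le_of_power_growth:
  fixes x M C :: real
  assumes "0 \<le> M" "\<And>n::nat. x ^ 2 ^ n \<le> C * M ^ 2 ^ n"
  shows "x \<le> M"
proof (rule ccontr)
  assume "\<not> x \<le> M"
  show False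
  proof (cases "M = 0")
    case True
    then show False using assms(2)[of 0] \<open>\<not> x \<le> M\<close> by auto
  next
    case False
    then have M: "M > 0" "x / M > 1" using assms(1) \<open>\<not> x \<le> M\<close> by auto
    then obtain n where "C < (x / M) ^ n" using real_arch_pow by blast
    also have "\<dots> \<le> (x / M) ^ 2 ^ n"
      using M(2) by (intro power_increasing) (auto intro: less_imp_le less_exp)
    also have "\<dots> \<le> C" using assms(2)[of n] M by (simp add: power_divide field_simps)
    finally show False by simp
  qed
qed

locale cstar_subalgebra =
  fixes B :: "'c::cstar_algebra set" and e :: 'c
  assumes add_mem: "x \<in> B \<Longrightarrow> y \<in> B \<Longrightarrow> x + y \<in> B"
    and scaleC_mem: "x \<in> B \<Longrightarrow> s *\<^sub>C x \<in> B"
    and mult_mem: "x \<in> B \<Longrightarrow> y \<in> B \<Longrightarrow> x * y \<in> B"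
    and star_mem: "x \<in> B \<Longrightarrow> star x \<in> B"
    and unit_mem: "e \<in> B"
    and left_unit: "x \<in> B \<Longrightarrow> e * x = x"
    and right_unit: "x \<in> B \<Longrightarrow> x * e = x"
    and complete: "complete B"
begin

lemma scaleR_mem: "x \<in> B \<Longrightarrow> r *\<^sub>R x \<in> B"
  using scaleC_mem[of x "complex_of_real r"] by (simp add: scaleC_of_real)

lemma zero_mem: "0 \<in> B" using scaleR_mem[OF unit_mem, of 0] by simp

lemma uminus_mem: "x \<in> B \<Longrightarrow> - x \<in> B" using scaleR_mem[of x "-1"] by simp

lemma diff_mem: "x \<in> B \<Longrightarrow> y \<in> B \<Longrightarrow> x - y \<in> B" using add_mem[of x "- y"] uminus_mem by simp

lemmas mems = add_mem scaleC_mem mult_mem star_mem unit_mem scaleR_mem zero_mem uminus_mem diff_mem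

lemma subspace: "subspace B"
  by (simp add: subspace_def mems)

lemma closed: "closed B" using complete by (rule complete_imp_closed)

lemma star_unit: "star e = e"
  using left_unit[of "star e"] right_unit[of "star e"] star_mult[of "star e" e] mems by simp

lemma norm_unit_le: "norm e \<le> 1"
proof -
  have "norm e = norm e * norm e"
    using norm_star_mult[of e] by (simp add: star_unit left_unit unit_mem power2_eq_square)
  then show ?thesis by (cases "norm e = 0") auto
qed

text \<open>The square root of \<open>e - x\<close> is \<open>e - y\<close> for the fixed point \<open>y\<close> of \<open>y \<mapsto> (x + y\<^sup>2)/2\<close>,
  a contraction of the ball of radius \<open>1 - sqrt (1 - norm x)\<close>.\<close>

lemma square_root:
  assumes x: "x \<in> B" "star x = x" "norm x < 1"
  shows "\<exists>b\<in>B. star b = b \<and> b * b = e - x"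
proof -
  define r where "r = 1 - sqrt (1 - norm x)"
  have r: "0 \<le> r" "r < 1" "(norm x + r * r) / 2 = r"
    using x(3) by (auto simp: r_def field_simps)
  let ?S = "B \<inter> ({y. star y = y} \<inter> cball 0 r)"
  let ?f = "\<lambda>y. (1/2) *\<^sub>R (x + y * y)"
  have "closed {y::'c. star y = y}"
    by (intro closed_Collect_eq continuous_intros)
  then have "complete ?S" by (intro complete_Int_closed complete closed_Int) auto
  moreover have "?S \<noteq> {}" using zero_mem r by auto
  moreover have "?f ` ?S \<subseteq> ?S"
  proof (intro image_subsetI)
    fix y assume y: "y \<in> ?S"
    have "norm (x + y * y) \<le> norm x + norm y * norm y"
      by (rule order_trans[OF norm_triangle_ineq]) (simp add: norm_mult_ineq)
    also have "\<dots> \<le> norm x + r * r" using y r by (intro add_left_mono mult_mono) auto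
    finally have "norm (?f y) \<le> r" using r(3) by simp
    then show "?f y \<in> ?S" using y x by (auto intro: mems)
  qed
  moreover have "dist (?f y) (?f z) \<le> r * dist y z" if "y \<in> ?S" "z \<in> ?S" for y z
  proof -
    have "?f y - ?f z = (1/2) *\<^sub>R (y * (y - z) + (y - z) * z)"
      by (simp add: algebra_simps)
    then have "dist (?f y) (?f z) = norm (y * (y - z) + (y - z) * z) / 2" by (simp add: dist_norm)
    also have "\<dots> \<le> (norm y * norm (y - z) + norm (y - z) * norm z) / 2"
      by (intro divide_right_mono order_trans[OF norm_triangle_ineq] add_mono norm_mult_ineq) auto
    also have "\<dots> \<le> (r * norm (y - z) + norm (y - z) * r) / 2"
      using that by (intro divide_right_mono add_mono mult_right_mono mult_left_mono) auto
    finally show ?thesis by (simp add: dist_norm)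
  qed
  ultimately obtain y where y: "y \<in> ?S" "?f y = y"
    using Banach_fix[of ?S r ?f] r by blast
  have "2 *\<^sub>R ?f y = x + y * y" by simp
  then have "x + y * y = 2 *\<^sub>R y" unfolding y(2) by (rule sym)
  then have "(e - y) * (e - y) = e - x"
    using y(1) by (simp add: algebra_simps left_unit right_unit mems scaleR_2)
  moreover have "e - y \<in> B" "star (e - y) = e - y"
    using y(1) by (auto intro: mems simp: star_unit)
  ultimately show ?thesis by blast
qed

end

locale positive_functional = cstar_subalgebra B e for B :: "'c::cstar_algebra set" and e +
  fixes \<phi> :: "'c \<Rightarrow> complex"
  assumes functional_add: "x \<in> B \<Longrightarrow> y \<in> B \<Longrightarrow> \<phi> (x + y) = \<phi> x + \<phi> y"
    and functional_scaleC: "x \<in> B \<Longrightarrow> \<phi> (s *\<^sub>C x) = s * \<phi> x"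
    and functional_real: "x \<in> B \<Longrightarrow> \<phi> (star x * x) \<in> \<real>"
    and functional_nonneg: "x \<in> B \<Longrightarrow> 0 \<le> Re (\<phi> (star x * x))"
begin

lemma functional_scaleR: "x \<in> B \<Longrightarrow> \<phi> (r *\<^sub>R x) = of_real r * \<phi> x"
  using functional_scaleC[of x "complex_of_real r"] by (simp add: scaleC_of_real)

lemma functional_uminus: "x \<in> B \<Longrightarrow> \<phi> (- x) = - \<phi> x"
  using functional_scaleR[of x "-1"] by simp

lemma functional_diff: "x \<in> B \<Longrightarrow> y \<in> B \<Longrightarrow> \<phi> (x - y) = \<phi> x - \<phi> y"
  using functional_add[of x "- y"] by (simp add: functional_uminus mems)

lemma functional_zero: "\<phi> 0 = 0"
  using functional_scaleR[OF unit_mem, of 0] by simp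

lemmas functional_simps = functional_add functional_scaleC functional_uminus functional_diff
  functional_zero functional_scaleR

text \<open>Polarisation: \<open>4 h\<close> is the difference of the squares of \<open>h + e\<close> and \<open>h - e\<close>.\<close>

lemma functional_sa_real: assumes "h \<in> B" "star h = h" shows "Im (\<phi> h) = 0"
proof -
  have "Im (\<phi> (star (h + e) * (h + e))) = 0" "Im (\<phi> (star (h - e) * (h - e))) = 0"
    using functional_real[of "h + e"] functional_real[of "h - e"] assms
    by (auto simp: mems complex_is_Real_iff)
  moreover have "(4::real) *\<^sub>R h = star (h + e) * (h + e) - star (h - e) * (h - e)"
  proof -
    have "(4::real) *\<^sub>R h = (1 + 1 + 1 + 1) *\<^sub>R h" by simp
    also have "\<dots> = h + h + h + h" by (simp only: scaleR_left_distrib scaleR_one)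
    finally show ?thesis
      using assms by (simp add: star_unit left_unit right_unit mems algebra_simps)
  qed
  then have "\<phi> ((4::real) *\<^sub>R h) = \<phi> (star (h + e) * (h + e)) - \<phi> (star (h - e) * (h - e))"
    using assms by (simp add: functional_diff mems)
  then have "complex_of_real 4 * \<phi> h = \<phi> (star (h + e) * (h + e)) - \<phi> (star (h - e) * (h - e))"
    using functional_scaleR[OF assms(1), of 4] by simp
  ultimately have "Im (complex_of_real 4 * \<phi> h) = 0" by simp
  then show ?thesis by simp
qed

lemma functional_star: assumes "x \<in> B" shows "\<phi> (star x) = cnj (\<phi> x)"
proof -
  have "Im (\<phi> (x + star x)) = 0" "Im (\<phi> (\<i> *\<^sub>C (x - star x))) = 0"
    by (rule functional_sa_real; use assms in \<open>simp add: mems scaleC_diff_right add.commute\<close>)+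
  then show ?thesis using assms by (simp add: functional_simps mems complex_eq_iff)
qed

text \<open>For \<open>t > \<parallel>h\<parallel>\<close> the element \<open>t e - h\<close> is a positive multiple of a square. This is where positivity, a purely
  algebraic condition, yields continuity.\<close>

lemma functional_sa_le:
  assumes "h \<in> B" "star h = h" shows "Re (\<phi> h) \<le> norm h * Re (\<phi> e)"
proof (rule field_le_epsilon)
  have e0: "0 \<le> Re (\<phi> e)" using functional_nonneg[OF unit_mem] by (simp add: star_unit left_unit mems)
  fix \<epsilon> :: real assume "\<epsilon> > 0"
  define t where "t = norm h + \<epsilon> / (Re (\<phi> e) + 1)"
  have t: "t > norm h" "t > 0" using \<open>\<epsilon> > 0\<close> e0 by (auto simp: t_def intro!: add_nonneg_pos)
  then have "norm (inverse t *\<^sub>R h) < 1" by (simp add: field_simps)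
  then obtain b where b: "b \<in> B" "star b = b" "b * b = e - inverse t *\<^sub>R h"
    using square_root[of "inverse t *\<^sub>R h"] assms by (auto intro: mems)
  have "0 \<le> Re (\<phi> (e - inverse t *\<^sub>R h))" using functional_nonneg[OF b(1)] b by simp
  then have "inverse t * Re (\<phi> h) \<le> Re (\<phi> e)"
    using assms by (simp add: functional_simps mems del: of_real_inverse)
  then have "Re (\<phi> h) \<le> t * Re (\<phi> e)" using t by (simp add: field_simps)
  also have "\<dots> = norm h * Re (\<phi> e) + \<epsilon> * (Re (\<phi> e) / (Re (\<phi> e) + 1))"
    by (simp add: t_def algebra_simps)
  also have "\<dots> \<le> norm h * Re (\<phi> e) + \<epsilon>"
    using \<open>\<epsilon> > 0\<close> e0 by (intro add_left_mono mult_left_le) auto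
  finally show "Re (\<phi> h) \<le> norm h * Re (\<phi> e) + \<epsilon>" .
qed

lemma functional_square_le:
  assumes "x \<in> B" shows "Re (\<phi> (star x * x)) \<le> (norm x)\<^sup>2 * Re (\<phi> e)"
  using functional_sa_le[of "star x * x"] assms by (simp add: mems norm_star_mult)

lemma Cauchy_Schwarz:
  assumes "x \<in> B" "y \<in> B"
  shows "(cmod (\<phi> (star x * y)))\<^sup>2 \<le> Re (\<phi> (star x * x)) * Re (\<phi> (star y * y))"
proof -
  define a b p where "a = Re (\<phi> (star x * x))" and "b = Re (\<phi> (star y * y))" and "p = \<phi> (star x * y)"
  have ab: "0 \<le> a" "0 \<le> b" using functional_nonneg assms by (auto simp: a_def b_def)
  have p': "\<phi> (star y * x) = cnj p"
    using functional_star[of "star x * y"] assms by (simp add: p_def mems)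
  have key: "0 \<le> a - 2 * t * (cmod p)\<^sup>2 + t\<^sup>2 * (cmod p)\<^sup>2 * b" for t :: real
  proof -
    \<comment> \<open>the phase of \<open>s\<close> makes the mixed terms equal to \<open>- t \<bar>p\<bar>\<^sup>2\<close>\<close>
    define s where "s = - complex_of_real t * cnj p"
    have "0 \<le> Re (\<phi> (star (x + s *\<^sub>C y) * (x + s *\<^sub>C y)))"
      using assms by (intro functional_nonneg) (auto intro: mems)
    also have "star (x + s *\<^sub>C y) * (x + s *\<^sub>C y) =
        star x * x + s *\<^sub>C (star x * y) + cnj s *\<^sub>C (star y * x) + (cnj s * s) *\<^sub>C (star y * y)"
      by (simp add: algebra_simps scaleC_add_right)
    also have "\<phi> \<dots> = \<phi> (star x * x) + s * p + cnj s * cnj p + (cnj s * s) * \<phi> (star y * y)"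
      using assms by (simp add: functional_simps mems p' p_def[symmetric])
    also have "s * p = - of_real (t * (cmod p)\<^sup>2)"
      using complex_norm_square[of p] by (simp add: s_def)
    also have "cnj s * cnj p = - of_real (t * (cmod p)\<^sup>2)"
      using complex_norm_square[of p] by (simp add: s_def mult.commute)
    also have "cnj s * s = of_real (t\<^sup>2 * (cmod p)\<^sup>2)"
      using complex_norm_square[of p] by (simp add: s_def power2_eq_square)
    finally show ?thesis by (simp add: a_def b_def)
  qed
  show ?thesis
  proof (cases "b = 0")
    case True
    have "cmod p = 0"
    proof (rule ccontr)
      assume "cmod p \<noteq> 0"
      then have "(a + 1) / (cmod p)\<^sup>2 * (cmod p)\<^sup>2 = a + 1" by simp
      then have "0 \<le> a - 2 * (a + 1)"
        using key[of "(a + 1) / (cmod p)\<^sup>2"] True by (metis mult.assoc mult_zero_right add_0_right)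
      then show False using ab by simp
    qed
    then show ?thesis using ab by (simp add: p_def a_def b_def True)
  next
    case False
    then have "b > 0" using ab by simp
    then have "0 \<le> a - (cmod p)\<^sup>2 / b"
      using key[of "1 / b"] by (simp add: field_simps power2_eq_square)
    then show ?thesis using \<open>b > 0\<close> by (simp add: field_simps p_def a_def b_def)
  qed
qed

lemma functional_bounded: assumes "x \<in> B" shows "cmod (\<phi> x) \<le> norm x * Re (\<phi> e)"
proof -
  have e0: "0 \<le> Re (\<phi> e)" using functional_nonneg[OF unit_mem] by (simp add: star_unit left_unit mems)
  have "(cmod (\<phi> (star e * x)))\<^sup>2 \<le> Re (\<phi> (star e * e)) * Re (\<phi> (star x * x))"
    using assms by (intro Cauchy_Schwarz mems)
  also have "\<dots> \<le> Re (\<phi> e) * ((norm x)\<^sup>2 * Re (\<phi> e))"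
    using functional_square_le[OF assms] e0 by (simp add: star_unit left_unit mems mult_left_mono)
  finally have "(cmod (\<phi> x))\<^sup>2 \<le> (norm x * Re (\<phi> e))\<^sup>2"
    using assms by (simp add: star_unit left_unit power2_eq_square algebra_simps)
  then show ?thesis using e0 by (simp add: abs_le_square_iff[symmetric])
qed

lemma continuous_on_functional: "continuous_on B \<phi>"
proof (rule lipschitz_on_continuous_on[OF lipschitz_onI])
  fix x y assume "x \<in> B" "y \<in> B"
  then show "dist (\<phi> x) (\<phi> y) \<le> Re (\<phi> e) * dist x y"
    using functional_bounded[of "x - y"] by (simp add: mems functional_diff dist_norm mult.commute)
qed (use functional_nonneg[OF unit_mem] in \<open>simp add: star_unit left_unit mems\<close>)

lemma compressed: assumes "y \<in> B" shows "positive_functional B e (\<lambda>z. \<phi> (star y * z * y))"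
proof unfold_locales
  fix x assume x: "x \<in> B"
  have "star y * (star x * x) * y = star (x * y) * (x * y)" by (simp add: mult.assoc)
  then show "\<phi> (star y * (star x * x) * y) \<in> \<real>" "0 \<le> Re (\<phi> (star y * (star x * x) * y))"
    using functional_real[of "x * y"] functional_nonneg[of "x * y"] x assms by (auto simp: mems)
qed (use assms in \<open>auto simp: algebra_simps functional_simps mems\<close>)

lemma functional_compressed_le:
  assumes "x \<in> B" "y \<in> B"
  shows "Re (\<phi> (star (x * y) * (x * y))) \<le> (norm x)\<^sup>2 * Re (\<phi> (star y * y))"
  using positive_functional.functional_square_le[OF compressed[OF assms(2)] assms(1)] assms
  by (simp add: mult.assoc left_unit mems)

end

section \<open>Ideals of AF algebras\<close>

lemma finite_basis_of_subspace:
  fixes V :: "'a::real_vector set"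
  assumes "finite F" "subspace V" "V \<subseteq> span F"
  obtains G where "finite G" "G \<subseteq> V" "span G = V"
proof -
  obtain G where G: "G \<subseteq> V" "independent G" "V \<subseteq> span G" by (metis basis_exists)
  then have "finite G" using independent_span_bound[OF assms(1) G(2)] assms(3) by auto
  moreover have "span G = V" using G assms(2) by (metis span_minimal subset_antisym)
  ultimately show ?thesis using that G by blast
qed

context cstar_subalgebra
begin

text \<open>Multiplication by a self-adjoint \<open>h\<close> is injective on the right ideal \<open>h B\<close>, since
  \<open>h h x = 0\<close> gives \<open>(h x)\<^sup>* h x = 0\<close>; in finite dimension it is onto, so that \<open>h\<close> itself
  is of the form \<open>h (h z)\<close>, and \<open>h z\<close> turns out to be a projection.\<close>

lemma support_projection:
  assumes "finite G" "B \<subseteq> span G" and h: "h \<in> B" "star h = h"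
  shows "\<exists>z\<in>B. star (h * z) = h * z \<and> (h * z) * (h * z) = h * z \<and> (h * z) * h = h"
proof -
  let ?V = "(\<lambda>x. h * x) ` B"
  have lin: "linear (\<lambda>x. h * x)" by (simp add: linearI distrib_left)
  have "subspace ?V" by (rule linear_subspace_image[OF lin subspace])
  moreover have "?V \<subseteq> span G" using assms by (auto intro: mems)
  moreover have "(\<lambda>x. h * x) ` ?V \<subseteq> ?V" using h by (auto intro: mems)
  moreover have "x = 0" if "x \<in> ?V" "h * x = 0" for x
  proof -
    from that(1) obtain y where y: "x = h * y" by (rule imageE)
    have "star x * x = star y * (h * x)" by (simp add: y h mult.assoc)
    then show ?thesis using that(2) star_mult_eq_0[of x] by simp
  qed
  ultimately have "(\<lambda>x. h * x) ` ?V = ?V"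
    using finite_dim_injective_imp_surjective[OF lin assms(1)] by blast
  moreover have "h \<in> ?V" using right_unit[OF h(1)] unit_mem by (metis image_eqI)
  ultimately have "h \<in> (\<lambda>x. h * x) ` ?V" by (rule ssubst)
  then have "h \<in> (\<lambda>z. h * (h * z)) ` B" by (simp add: image_image)
  then obtain z where "h = h * (h * z)" and zB: "z \<in> B" by (rule imageE)
  then have z: "z \<in> B" "h * (h * z) = h" by simp_all
  let ?p = "h * z"
  have "star ?p * ?p = star ?p" using z(2) h(2) by (simp add: mult.assoc)
  then have sa: "star ?p = ?p" by (metis star_mult star_star)
  then have "?p * ?p = ?p" using \<open>star ?p * ?p = star ?p\<close> by simp
  moreover have "?p * h = h" using arg_cong[OF z(2), of star] sa h(2) by (metis star_mult)
  ultimately show ?thesis using z(1) sa by blast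
qed

definition two_sided_ideal :: "'c set \<Rightarrow> bool" where
  "two_sided_ideal J \<longleftrightarrow> J \<subseteq> B \<and> 0 \<in> J \<and> (\<forall>x\<in>J. \<forall>y\<in>J. x + y \<in> J) \<and>
     (\<forall>x\<in>J. \<forall>y\<in>B. x * y \<in> J \<and> y * x \<in> J)"

lemma two_sided_ideal_scaleC: assumes "two_sided_ideal J" "x \<in> J" shows "s *\<^sub>C x \<in> J"
proof -
  have "x \<in> B" using assms by (auto simp: two_sided_ideal_def)
  moreover have "(s *\<^sub>C e) * x \<in> J"
    using assms scaleC_mem[OF unit_mem, of s] unfolding two_sided_ideal_def by blast
  ultimately show ?thesis by (simp add: left_unit)
qed

lemma two_sided_ideal_scaleR: "two_sided_ideal J \<Longrightarrow> x \<in> J \<Longrightarrow> r *\<^sub>R x \<in> J"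
  using two_sided_ideal_scaleC[of J x "complex_of_real r"] by (simp add: scaleC_of_real)

lemma two_sided_ideal_diff: "two_sided_ideal J \<Longrightarrow> x \<in> J \<Longrightarrow> y \<in> J \<Longrightarrow> x - y \<in> J"
  using two_sided_ideal_scaleR[of J y "-1"] unfolding two_sided_ideal_def
  by (metis add_uminus_conv_diff scaleR_minus1_left)

text \<open>The unit is a projection \<open>p\<close> in \<open>J\<close> whose right annihilator in \<open>J\<close> has minimal dimension:
  if \<open>y = x - p x\<close> were non-zero, adding the support projection of \<open>y y\<^sup>*\<close> to \<open>p\<close> would
  shrink the annihilator.\<close>

lemma two_sided_ideal_unit:
  assumes "finite G" "B \<subseteq> span G" and J: "two_sided_ideal J"
  obtains p where "p \<in> J" "star p = p" "p * p = p" "\<And>x. x \<in> J \<Longrightarrow> p * x = x" "\<And>x. x \<in> J \<Longrightarrow> x * p = x"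
proof -
  have JB: "J \<subseteq> B" "0 \<in> J" "\<And>x y. x \<in> J \<Longrightarrow> y \<in> J \<Longrightarrow> x + y \<in> J"
    "\<And>x y. x \<in> J \<Longrightarrow> y \<in> B \<Longrightarrow> x * y \<in> J" "\<And>x y. x \<in> J \<Longrightarrow> y \<in> B \<Longrightarrow> y * x \<in> J"
    using J by (auto simp: two_sided_ideal_def)
  define P where "P p \<longleftrightarrow> p \<in> J \<and> star p = p \<and> p * p = p" for p
  define K where "K p = {x \<in> J. p * x = 0}" for p
  have "P 0" by (simp add: P_def JB)
  then obtain p where p: "P p" and min: "\<And>q. P q \<Longrightarrow> dim (K p) \<le> dim (K q)"
    using ex_has_least_nat[of P 0 "\<lambda>p. dim (K p)"] by auto
  have left: "p * x = x" if x: "x \<in> J" for x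
  proof (rule ccontr)
    assume ne: "p * x \<noteq> x"
    define y where "y = x - p * x"
    have y: "y \<in> J" "p * y = 0" "y \<noteq> 0"
      using x ne p two_sided_ideal_diff[OF J] JB by (auto simp: y_def P_def right_diff_distrib mult.assoc[symmetric])
    have yB: "y \<in> B" using y JB by auto
    define h where "h = y * star y"
    have "h \<in> B" "star h = h" using yB by (auto simp: h_def mems)
    then obtain z where z: "z \<in> B" "star (h * z) = h * z" "(h * z) * (h * z) = h * z" "(h * z) * h = h"
      using support_projection[OF assms(1,2)] by blast
    define q where "q = h * z"
    have "h \<in> J" using y(1) yB JB(4) by (auto simp: h_def mems)
    then have q: "q \<in> J" "star q = q" "q * q = q" "q * h = h"
      using z JB(4) by (auto simp: q_def)
    have pq: "p * q = 0" using y(2) by (simp add: q_def h_def mult.assoc[symmetric])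
    then have qp: "q * p = 0" using p q by (metis P_def star_mult star_zero)
    have "P (p + q)" using p q pq qp JB by (auto simp: P_def algebra_simps)
    moreover have "dim (K (p + q)) < dim (K p)"
    proof (rule dim_strict_mono[OF assms(1)])
      show "subspace (K (p + q))"
        using JB two_sided_ideal_scaleR[OF J] by (auto simp: K_def subspace_def distrib_left)
      have "K (p + q) \<subseteq> K p"
      proof
        fix w assume w: "w \<in> K (p + q)"
        then have "p * ((p + q) * w) = 0" by (simp add: K_def)
        also have "p * ((p + q) * w) = (p * p + p * q) * w" by (simp add: algebra_simps)
        finally show "w \<in> K p" using w p pq by (simp add: K_def P_def)
      qed
      moreover have "y \<notin> K (p + q)"
      proof
        assume "y \<in> K (p + q)"
        then have "q * y = 0" using y by (simp add: K_def distrib_right)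
        then have "h = 0" using q(4) by (simp add: h_def mult.assoc[symmetric])
        then show False using star_mult_eq_0[of "star y"] y(3) by (auto simp: h_def dest: arg_cong[of _ _ star])
      qed
      ultimately show "K (p + q) \<subset> K p" using y by (auto simp: K_def)
      show "K p \<subseteq> span G" using JB assms(2) by (auto simp: K_def)
    qed
    ultimately show False using min[of "p + q"] by simp
  qed
  \<comment> \<open>\<open>J\<close> is not known to be self-adjoint, but it contains \<open>y\<^sup>* y\<close>, to which the left unit applies\<close>
  have right: "x * p = x" if x: "x \<in> J" for x
  proof -
    define y where "y = x - x * p"
    have xB: "x \<in> B" "p \<in> B" using x p JB by (auto simp: P_def)
    have y: "y \<in> J" "y * p = 0"
      using x p two_sided_ideal_diff[OF J] JB xB by (auto simp: y_def P_def left_diff_distrib mult.assoc)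
    have "p * (star y * y) = star y * y" using y(1) JB by (intro left JB mems) auto
    then have "star y * y * p = star y * y" using p by (metis P_def mult.assoc star_mult star_star)
    then have "star y * y = 0" using y(2) by (simp add: mult.assoc)
    then have "y = 0" by (rule star_mult_eq_0)
    then show ?thesis by (simp add: y_def)
  qed
  show ?thesis using that[of p] left right p by (auto simp: P_def)
qed

end

locale closed_ideal = cstar_subalgebra B e for B :: "'c::cstar_algebra set" and e +
  fixes I :: "'c set"
  assumes ideal: "two_sided_ideal I" and closed_I: "closed I"
begin

lemma ideal_mem:
  "x \<in> I \<Longrightarrow> x \<in> B" "0 \<in> I" "x \<in> I \<Longrightarrow> y \<in> I \<Longrightarrow> x + y \<in> I"
  "x \<in> I \<Longrightarrow> y \<in> B \<Longrightarrow> x * y \<in> I" "x \<in> I \<Longrightarrow> y \<in> B \<Longrightarrow> y * x \<in> I"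
  "x \<in> I \<Longrightarrow> y \<in> I \<Longrightarrow> x - y \<in> I" "x \<in> I \<Longrightarrow> s *\<^sub>C x \<in> I" "x \<in> I \<Longrightarrow> r *\<^sub>R x \<in> I"
  using ideal two_sided_ideal_diff two_sided_ideal_scaleC two_sided_ideal_scaleR
  by (auto simp: two_sided_ideal_def)

abbreviation quot_norm :: "'c \<Rightarrow> real" where "quot_norm x \<equiv> infdist x I"

lemma quot_norm_le: "i \<in> I \<Longrightarrow> quot_norm x \<le> norm (x - i)"
  using infdist_le[of i I x] by (simp add: dist_norm)

lemma quot_norm_le_norm: "quot_norm x \<le> norm x"
  using quot_norm_le[of 0 x] by (simp add: ideal_mem)

lemma quot_norm_approx: assumes "0 < \<epsilon>" shows "\<exists>i\<in>I. norm (x - i) < quot_norm x + \<epsilon>"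
proof -
  have "I \<noteq> {}" using ideal_mem(2) by auto
  then have "(INF i\<in>I. dist x i) < quot_norm x + \<epsilon>" using assms by (simp add: infdist_def)
  then show ?thesis using cInf_lessD[of "dist x ` I"] \<open>I \<noteq> {}\<close> by (auto simp: dist_norm)
qed

lemma quot_norm_leI: assumes "\<And>i. i \<in> I \<Longrightarrow> K \<le> norm (x - i)" shows "K \<le> quot_norm x"
  by (rule field_le_epsilon) (metis assms quot_norm_approx less_imp_le order_trans)

lemma quot_norm_eq_0: "quot_norm x = 0 \<longleftrightarrow> x \<in> I"
  using in_closed_iff_infdist_zero[OF closed_I] ideal_mem(2) by blast

lemma quot_norm_diff: assumes "i \<in> I" shows "quot_norm (x - i) = quot_norm x"
proof (rule antisym; rule quot_norm_leI)
  fix j assume "j \<in> I"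
  then show "quot_norm (x - i) \<le> norm (x - j)" "quot_norm x \<le> norm (x - i - j)"
    using quot_norm_le[of "j - i" "x - i"] quot_norm_le[of "i + j" x] assms ideal_mem
    by (auto simp: algebra_simps)
qed

lemma quot_norm_triangle: "quot_norm (x + y) \<le> quot_norm x + quot_norm y"
proof (rule field_le_epsilon)
  fix \<epsilon> :: real assume "\<epsilon> > 0"
  then obtain i j where ij: "i \<in> I" "norm (x - i) < quot_norm x + \<epsilon> / 2" "j \<in> I" "norm (y - j) < quot_norm y + \<epsilon> / 2"
    using quot_norm_approx[of "\<epsilon> / 2"] half_gt_zero by meson
  have "quot_norm (x + y) \<le> norm ((x - i) + (y - j))"
    using quot_norm_le[of "i + j" "x + y"] ij ideal_mem by (simp add: algebra_simps)
  also have "\<dots> \<le> norm (x - i) + norm (y - j)" by (rule norm_triangle_ineq)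
  finally show "quot_norm (x + y) \<le> quot_norm x + quot_norm y + \<epsilon>" using ij by simp
qed

lemma quot_norm_scaleC_le: "quot_norm (s *\<^sub>C x) \<le> cmod s * quot_norm x"
proof (cases "s = 0")
  case True
  then show ?thesis using quot_norm_eq_0[of 0] ideal_mem(2) by simp
next
  case False
  have "quot_norm (s *\<^sub>C x) / cmod s \<le> quot_norm x"
  proof (rule quot_norm_leI)
    fix i assume "i \<in> I"
    then have "quot_norm (s *\<^sub>C x) \<le> norm (s *\<^sub>C (x - i))"
      using quot_norm_le[of "s *\<^sub>C i" "s *\<^sub>C x"] by (simp add: scaleC_diff_right ideal_mem)
    then show "quot_norm (s *\<^sub>C x) / cmod s \<le> norm (x - i)" using False by (simp add: field_simps)
  qed
  then show ?thesis using False by (simp add: field_simps)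
qed

lemma quot_norm_scaleC: "quot_norm (s *\<^sub>C x) = cmod s * quot_norm x"
proof (cases "s = 0")
  case True
  then show ?thesis using quot_norm_eq_0[of 0] ideal_mem(2) by simp
next
  case False
  have "quot_norm x \<le> cmod (inverse s) * quot_norm (s *\<^sub>C x)"
    using quot_norm_scaleC_le[of "inverse s" "s *\<^sub>C x"] False by simp
  then have "cmod s * quot_norm x \<le> quot_norm (s *\<^sub>C x)"
    using False by (simp add: norm_inverse norm_divide field_simps)
  then show ?thesis using quot_norm_scaleC_le[of s x] by simp
qed

lemma quot_norm_mult: assumes "x \<in> B" "y \<in> B" shows "quot_norm (x * y) \<le> quot_norm x * quot_norm y"
proof -
  have *: "quot_norm (x * y) \<le> norm (x - i) * norm (y - j)" if "i \<in> I" "j \<in> I" for i j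
  proof -
    have "i * y + (x - i) * j \<in> I"
      by (rule ideal_mem(3)[OF ideal_mem(4)[OF that(1) assms(2)]
            ideal_mem(5)[OF that(2) diff_mem[OF assms(1) ideal_mem(1)[OF that(1)]]]])
    from quot_norm_le[OF this, of "x * y"] have "quot_norm (x * y) \<le> norm ((x - i) * (y - j))"
      by (simp add: algebra_simps)
    then show ?thesis using norm_mult_ineq order_trans by blast
  qed
  have "quot_norm (x * y) \<le> quot_norm x * norm (y - j)" if "j \<in> I" for j
  proof (cases "norm (y - j) = 0")
    case True
    then show ?thesis using *[of 0 j] that by (simp add: ideal_mem)
  next
    case False
    have "quot_norm (x * y) / norm (y - j) \<le> quot_norm x"
      by (rule quot_norm_leI) (use * that False in \<open>simp add: field_simps\<close>)
    then show ?thesis using False by (simp add: field_simps)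
  qed
  note ** = this
  show ?thesis
  proof (cases "quot_norm x = 0")
    case True
    then show ?thesis using **[of 0] by (simp add: ideal_mem)
  next
    case False
    then have pos: "quot_norm x > 0" using infdist_nonneg[of x I] by linarith
    have "quot_norm (x * y) / quot_norm x \<le> quot_norm y"
      by (rule quot_norm_leI) (use ** pos in \<open>simp add: field_simps\<close>)
    then show ?thesis using pos by (simp add: field_simps)
  qed
qed

lemma continuous_on_quot_norm: "continuous_on T quot_norm"
  by (intro continuous_intros)

text \<open>On a finite-dimensional subalgebra \<open>F\<close> the quotient norm is attained explicitly. Let \<open>p\<close> be
  the unit of \<open>F \<inter> I\<close>, a central projection of \<open>F\<close>. On the complementary corner
  \<open>W = {x \<in> F. x p = 0}\<close> the quotient norm is a norm, hence dominates a multiple of the given one; as it is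
  submultiplicative, iterated squaring of \<open>y\<^sup>* y\<close> removes the constant.\<close>

lemma quot_norm_finite_dim:
  assumes F: "cstar_subalgebra F e" "F \<subseteq> B" "finite G" "F \<subseteq> span G"
    and p: "p \<in> F \<inter> I" "star p = p" "p * p = p"
      "\<And>x. x \<in> F \<inter> I \<Longrightarrow> p * x = x" "\<And>x. x \<in> F \<inter> I \<Longrightarrow> x * p = x"
    and x: "x \<in> F"
  shows "p * x = x * p" "quot_norm x = norm (x - x * p)"
proof -
  interpret F: cstar_subalgebra F e by (rule F)
  have central: "p * y = y * p" if "y \<in> F" for y
  proof -
    have "p * y \<in> F \<inter> I" "y * p \<in> F \<inter> I" using p(1) that F(2) by (auto intro: F.mems ideal_mem)
    then show ?thesis using p(4)[of "y * p"] p(5)[of "p * y"] by (simp add: mult.assoc)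
  qed
  then show "p * x = x * p" using x by simp
  define W where "W = {y \<in> F. y * p = 0}"
  have W: "subspace W" by (auto simp: W_def subspace_def F.mems distrib_right)
  have W_mult: "y * z \<in> W" if "y \<in> W" "z \<in> W" for y z
    using that by (auto simp: W_def F.mems mult.assoc)
  have W_star: "star y \<in> W" if "y \<in> W" for y
    using that central[of y] p(2) by (auto simp: W_def F.mems) (metis star_mult star_zero)
  have "W \<subseteq> span G" using F(4) by (auto simp: W_def)
  then obtain G' where "finite G'" "G' \<subseteq> W" "span G' = W"
    by (rule finite_basis_of_subspace[OF F(3) W])
  then have G': "finite G'" "span G' = W" by simp_all
  have "\<exists>\<kappa>>0. \<forall>y\<in>span G'. \<kappa> * norm y ^ 1 \<le> quot_norm y"
  proof (rule finite_dim_coercive[OF G'(1) continuous_on_quot_norm])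
    fix y assume y: "y \<in> span G'" "y \<noteq> 0"
    then have yW: "y \<in> F" "y * p = 0" using G' by (auto simp: W_def)
    have "quot_norm y \<noteq> 0"
    proof
      assume "quot_norm y = 0"
      then have "y \<in> F \<inter> I" using yW by (simp add: quot_norm_eq_0)
      then show False using p(5)[of y] yW y by simp
    qed
    then show "0 < quot_norm y" using infdist_nonneg[of y I] by linarith
  next
    fix t :: real and y assume "0 < t"
    then show "quot_norm (t *\<^sub>R y) = t ^ 1 * quot_norm y"
      using quot_norm_scaleC[of "of_real t" y] by (simp add: scaleC_of_real)
  qed (auto simp: infdist_nonneg)
  then obtain \<kappa> where \<kappa>: "\<kappa> > 0" "\<And>y. y \<in> W \<Longrightarrow> \<kappa> * norm y \<le> quot_norm y" using G' by auto
  have "norm y \<le> quot_norm y" if y: "y \<in> W" for y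
  proof -
    define h where "h = star y * y"
    have h: "h \<in> W" "star h = h" using W_mult W_star y by (auto simp: h_def)
    have "norm h ^ 2 ^ n \<le> (1 / \<kappa>) * quot_norm h ^ 2 ^ n" for n
    proof -
      have "iter_square n h \<in> W" "quot_norm (iter_square n h) \<le> quot_norm h ^ 2 ^ n"
        by (rule submult_iter_square[of W quot_norm, OF W_mult quot_norm_mult infdist_nonneg h(1)];
            use F(2) in \<open>simp add: W_def subset_iff\<close>)+
      then have "\<kappa> * norm (iter_square n h) \<le> quot_norm h ^ 2 ^ n" using \<kappa>(2) order_trans by blast
      then show ?thesis using \<kappa>(1) by (simp add: norm_iter_square[OF h(2)] field_simps)
    qed
    then have "norm h \<le> quot_norm h" by (rule le_of_power_growth[OF infdist_nonneg])
    also have "\<dots> \<le> quot_norm (star y) * quot_norm y"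
      unfolding h_def by (rule quot_norm_mult) (use y W_star[OF y] F(2) in \<open>auto simp: W_def\<close>)
    also have "\<dots> \<le> norm y * quot_norm y"
      using quot_norm_le_norm[of "star y"] by (intro mult_right_mono) (auto simp: infdist_nonneg)
    finally have "norm y * norm y \<le> norm y * quot_norm y"
      by (simp add: h_def norm_star_mult power2_eq_square)
    then show ?thesis using infdist_nonneg[of y I] by (cases "norm y = 0") auto
  qed
  moreover have "x - x * p \<in> W"
    using x p by (auto simp: W_def left_diff_distrib mult.assoc intro: F.mems)
  ultimately have "norm (x - x * p) \<le> quot_norm (x - x * p)" by blast
  moreover have "x * p \<in> I" using x p(1) F(2) by (auto intro: ideal_mem)
  ultimately show "quot_norm x = norm (x - x * p)"
    using quot_norm_diff[of "x * p" x] quot_norm_le_norm[of "x - x * p"] by simp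
qed

lemma two_sided_ideal_Int:
  assumes "cstar_subalgebra F e" "F \<subseteq> B"
  shows "cstar_subalgebra.two_sided_ideal F (F \<inter> I)"
proof -
  interpret F: cstar_subalgebra F e by fact
  show ?thesis unfolding F.two_sided_ideal_def using assms(2) by (auto intro: ideal_mem F.mems)
qed

lemma quot_norm_Int_unit:
  assumes F: "cstar_subalgebra F e" "F \<subseteq> B" "finite G" "F \<subseteq> span G"
  obtains p where "star p = p" "p * p = p" "\<And>x. x \<in> F \<Longrightarrow> p * x = x * p"
    "\<And>x. x \<in> F \<Longrightarrow> quot_norm x = norm (x - x * p)"
    "p \<in> F \<inter> I" "\<And>x. x \<in> F \<inter> I \<Longrightarrow> p * x = x" "\<And>x. x \<in> F \<inter> I \<Longrightarrow> x * p = x"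
proof -
  from cstar_subalgebra.two_sided_ideal_unit[OF F(1,3,4) two_sided_ideal_Int[OF F(1,2)]]
  obtain p where "p \<in> F \<inter> I" "star p = p" "p * p = p"
    "\<And>x. x \<in> F \<inter> I \<Longrightarrow> p * x = x" "\<And>x. x \<in> F \<inter> I \<Longrightarrow> x * p = x" by blast
  note p = this
  show ?thesis
    by (rule that[of p]) (use p quot_norm_finite_dim[OF F p] in auto)
qed

lemma quot_norm_star_finite_dim:
  assumes F: "cstar_subalgebra F e" "F \<subseteq> B" "finite G" "F \<subseteq> span G" and x: "x \<in> F"
  shows "quot_norm (star x) = quot_norm x" "quot_norm (star x * x) = (quot_norm x)\<^sup>2"
proof -
  interpret F: cstar_subalgebra F e by (rule F)
  obtain p where p: "star p = p" "p * p = p" "\<And>x. x \<in> F \<Longrightarrow> p * x = x * p"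
    "\<And>x. x \<in> F \<Longrightarrow> quot_norm x = norm (x - x * p)"
    using quot_norm_Int_unit[OF F] by metis
  have "star (x - x * p) = star x - star x * p" using p(1) p(3)[of "star x"] x by (simp add: F.mems)
  then show "quot_norm (star x) = quot_norm x"
    using p(4) x norm_star[of "x - x * p"] by (simp add: F.mems)
  have "star (x - x * p) * (x - x * p) = star x * x - star x * x * p"
  proof -
    have "star (x - x * p) * (x - x * p) =
        star x * x - star x * (x * p) - p * (star x * x) + p * (star x * (x * p))"
      using p(1) by (simp add: algebra_simps)
    also have "p * (star x * (x * p)) = (p * (star x * x)) * p" by (simp add: mult.assoc)
    also have "\<dots> = (star x * x) * (p * p)" using p(3)[of "star x * x"] x by (simp add: F.mems mult.assoc)
    also have "\<dots> = p * (star x * x)" using p(2) p(3)[of "star x * x"] x by (simp add: F.mems)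
    finally show ?thesis by (simp add: mult.assoc)
  qed
  then show "quot_norm (star x * x) = (quot_norm x)\<^sup>2"
    using p(4) x norm_star_mult[of "x - x * p"] by (simp add: F.mems)
qed

text \<open>Both identities pass to the closure of an increasing union, which makes \<open>I\<close> self-adjoint and the
  quotient norm a C*-norm.\<close>

lemma quot_norm_star_AF:
  assumes "\<And>n. cstar_subalgebra (U n) e" "\<And>n. U n \<subseteq> B" "\<And>n. \<exists>G. finite G \<and> U n \<subseteq> span G"
    and "B \<subseteq> closure (\<Union>n. U n)" and x: "x \<in> B"
  shows "quot_norm (star x) = quot_norm x" "quot_norm (star x * x) = (quot_norm x)\<^sup>2"
proof -
  let ?S = "{x. quot_norm (star x) = quot_norm x \<and> quot_norm (star x * x) = (quot_norm x)\<^sup>2}"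
  have "closed ?S"
    by (intro closed_Collect_conj closed_Collect_eq continuous_on_infdist continuous_on_star
        continuous_on_mult continuous_on_power continuous_on_id)
  moreover have "(\<Union>n. U n) \<subseteq> ?S"
    using assms(1-3) quot_norm_star_finite_dim by fastforce
  ultimately have "closure (\<Union>n. U n) \<subseteq> ?S" by (rule closure_minimal[rotated])
  then show "quot_norm (star x) = quot_norm x" "quot_norm (star x * x) = (quot_norm x)\<^sup>2"
    using assms(4) x by auto
qed

end

text \<open>The unit of \<open>F \<inter> I\<close> determines the quotient norm on \<open>F\<close>. This makes the finite-dimensional levels of
  two quotients isometric.\<close>

lemma quot_norm_eq_of_Int_eq:
  assumes "closed_ideal B e I" "closed_ideal B e J"
    and F: "cstar_subalgebra F e" "F \<subseteq> B" "finite G" "F \<subseteq> span G"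
    and "F \<inter> I = F \<inter> J" "x \<in> F"
  shows "infdist x I = infdist x J"
proof -
  interpret I: closed_ideal B e I by fact
  interpret J: closed_ideal B e J by fact
  obtain p where p: "star p = p" "p * p = p" "infdist x I = norm (x - x * p)"
    "p \<in> F \<inter> I" "\<And>x. x \<in> F \<inter> I \<Longrightarrow> p * x = x" "\<And>x. x \<in> F \<inter> I \<Longrightarrow> x * p = x"
    using I.quot_norm_Int_unit[OF F] assms(8) by metis
  have "infdist x J = norm (x - x * p)"
    by (rule J.quot_norm_finite_dim[OF F]) (use p assms(7,8) in auto)
  then show ?thesis using p(3) by simp
qed

section \<open>Trace-preserving conditional expectations\<close>

locale faithful_trace = positive_functional B e \<mu> for B :: "'c::cstar_algebra set" and e \<mu> +
  assumes trace_commute: "x \<in> B \<Longrightarrow> y \<in> B \<Longrightarrow> \<mu> (x * y) = \<mu> (y * x)"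
    and faithful: "x \<in> B \<Longrightarrow> \<mu> (star x * x) = 0 \<Longrightarrow> x = 0"
    and trace_unit: "\<mu> e = 1"
begin

text \<open>The squared norm of the \<open>L\<^sup>2\<close>-space of the trace.\<close>

definition sqnorm :: "'c \<Rightarrow> real" where "sqnorm x = Re (\<mu> (star x * x))"

lemma sqnorm_nonneg: "x \<in> B \<Longrightarrow> 0 \<le> sqnorm x"
  using functional_nonneg by (simp add: sqnorm_def)

lemma of_real_sqnorm: "x \<in> B \<Longrightarrow> \<mu> (star x * x) = of_real (sqnorm x)"
  using functional_real[of x] by (simp add: sqnorm_def complex_is_Real_iff complex_eq_iff)

lemma sqnorm_pos: "x \<in> B \<Longrightarrow> x \<noteq> 0 \<Longrightarrow> 0 < sqnorm x"
  using faithful[of x] of_real_sqnorm[of x] sqnorm_nonneg[of x] by fastforce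

lemma sqnorm_mult_le: "x \<in> B \<Longrightarrow> y \<in> B \<Longrightarrow> sqnorm (x * y) \<le> (norm x)\<^sup>2 * sqnorm y"
  using functional_compressed_le by (simp add: sqnorm_def)

lemma sqnorm_unit: "sqnorm e = 1"
  by (simp add: sqnorm_def star_unit left_unit unit_mem trace_unit)

lemma sqnorm_coercive:
  assumes "finite G" "span G \<subseteq> B"
  shows "\<exists>\<kappa>>0. \<forall>x\<in>span G. \<kappa> * (norm x)\<^sup>2 \<le> sqnorm x"
proof (rule finite_dim_coercive[OF assms(1)])
  show "continuous_on (span G) sqnorm" unfolding sqnorm_def
  proof (intro continuous_on_Re continuous_on_compose2[OF continuous_on_functional])
    show "continuous_on (span G) (\<lambda>x. star x * x)" by (intro continuous_intros)
    show "(\<lambda>x. star x * x) ` span G \<subseteq> B" using assms(2) by (auto intro!: mems)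
  qed
next
  fix t :: real and x assume "x \<in> span G" "0 < t"
  then have "x \<in> B" using assms(2) by auto
  then show "sqnorm (t *\<^sub>R x) = t\<^sup>2 * sqnorm x"
    by (simp add: sqnorm_def functional_simps mems power2_eq_square)
qed (use assms(2) sqnorm_pos sqnorm_nonneg[OF zero_mem] in auto)

end

locale finite_dim_expectation = faithful_trace B e \<mu> for B :: "'c::cstar_algebra set" and e \<mu> +
  fixes S :: "'c set"
  assumes sub: "cstar_subalgebra S e" and sub_le: "S \<subseteq> B"
    and sub_finite_dim: "\<exists>G. finite G \<and> S \<subseteq> span G"
begin

sublocale S: cstar_subalgebra S e by (rule sub)

lemma S_le: "x \<in> S \<Longrightarrow> x \<in> B" using sub_le by auto

lemma finite_basis: obtains G where "finite G" "G \<subseteq> S" "span G = S"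
  using sub_finite_dim finite_basis_of_subspace[OF _ S.subspace] by metis

text \<open>Gram-Schmidt. The last clause is the dual form of \<open>p \<in> span G\<close> and spares the explicit coefficients.\<close>

lemma orthogonal_projection_aux:
  assumes "finite G" "G \<subseteq> S"
  shows "\<forall>a\<in>B. \<exists>p\<in>S. (\<forall>f\<in>G. \<mu> (star f * (a - p)) = 0) \<and>
    (\<forall>x\<in>B. (\<forall>f\<in>G. \<mu> (star f * x) = 0) \<longrightarrow> \<mu> (star p * x) = 0)"
  using assms
proof (induction G rule: finite_induct)
  case empty
  show ?case using S.zero_mem by (intro ballI bexI[of _ 0]) (auto simp: functional_zero)
next
  case (insert v G)
  have v: "v \<in> S" "v \<in> B" using insert.prems sub_le by auto
  have G: "\<And>f. f \<in> G \<Longrightarrow> f \<in> B" using insert.prems sub_le by auto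
  have IH: "\<forall>a\<in>B. \<exists>p\<in>S. (\<forall>f\<in>G. \<mu> (star f * (a - p)) = 0) \<and>
    (\<forall>x\<in>B. (\<forall>f\<in>G. \<mu> (star f * x) = 0) \<longrightarrow> \<mu> (star p * x) = 0)"
    using insert by auto
  obtain w where w: "w \<in> S" "\<And>f. f \<in> G \<Longrightarrow> \<mu> (star f * (v - w)) = 0"
    "\<And>x. x \<in> B \<Longrightarrow> (\<And>f. f \<in> G \<Longrightarrow> \<mu> (star f * x) = 0) \<Longrightarrow> \<mu> (star w * x) = 0"
    using IH v(2) by metis
  define u where "u = v - w"
  have u: "u \<in> S" "u \<in> B" "w \<in> B" using v w(1) sub_le by (auto simp: u_def intro: S.mems)
  show ?case
  proof
    fix a assume a: "a \<in> B"
    obtain p where p: "p \<in> S" "\<And>f. f \<in> G \<Longrightarrow> \<mu> (star f * (a - p)) = 0"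
      "\<And>x. x \<in> B \<Longrightarrow> (\<And>f. f \<in> G \<Longrightarrow> \<mu> (star f * x) = 0) \<Longrightarrow> \<mu> (star p * x) = 0"
      using IH a by metis
    have pB: "p \<in> B" using p(1) sub_le by auto
    have pu: "\<mu> (star u * p) = 0"
      using p(3)[OF u(2)] w(2) functional_star[of "star p * u"] pB u(2) by (simp add: u_def[symmetric] mems)
    define c where "c = \<mu> (star u * a) / \<mu> (star u * u)"
    define p' where "p' = p + c *\<^sub>C u"
    have p': "p' \<in> S" "p' \<in> B" using p(1) u pB by (auto simp: p'_def intro: S.mems mems)
    have G_orth: "\<mu> (star f * (a - p')) = 0" if "f \<in> G" for f
    proof -
      have "star f * (a - p') = star f * (a - p) - c *\<^sub>C (star f * u)"
        by (simp add: p'_def algebra_simps)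
      then show ?thesis using p(2)[OF that] w(2)[OF that] G[OF that] a pB u
        by (simp add: functional_simps mems u_def[symmetric])
    qed
    have "\<mu> (star u * (a - p')) = 0"
    proof (cases "\<mu> (star u * u) = 0")
      case True
      then have "u = 0" using faithful u(2) by blast
      then show ?thesis by (simp add: functional_zero)
    next
      case False
      have "star u * (a - p') = star u * a - star u * p - c *\<^sub>C (star u * u)"
        by (simp add: p'_def algebra_simps)
      then show ?thesis using a pB u pu False
        by (simp add: functional_simps mems) (simp add: c_def)
    qed
    moreover have "\<mu> (star w * (a - p')) = 0"
      using G_orth a p'(2) by (intro w(3)) (auto intro: mems)
    moreover have "star v * (a - p') = star u * (a - p') + star w * (a - p')"
      by (simp add: u_def algebra_simps)
    ultimately have "\<mu> (star v * (a - p')) = 0" using a p' u by (simp add: functional_simps mems)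
    moreover have "\<mu> (star p' * x) = 0"
      if x: "x \<in> B" and orth: "\<And>f. f \<in> insert v G \<Longrightarrow> \<mu> (star f * x) = 0" for x
    proof -
      have "\<mu> (star w * x) = 0" "\<mu> (star p * x) = 0"
        using x orth by (auto intro!: w(3) p(3))
      moreover have "star p' * x = star p * x + cnj c *\<^sub>C (star v * x - star w * x)"
        by (simp add: p'_def u_def algebra_simps)
      ultimately show ?thesis using orth[of v] x pB v u by (simp add: functional_simps mems)
    qed
    ultimately show "\<exists>p\<in>S. (\<forall>f\<in>insert v G. \<mu> (star f * (a - p)) = 0) \<and>
      (\<forall>x\<in>B. (\<forall>f\<in>insert v G. \<mu> (star f * x) = 0) \<longrightarrow> \<mu> (star p * x) = 0)"
      using G_orth p'(1) by (intro bexI[of _ p']) auto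
  qed
qed

lemma orthogonal_projection_exists:
  assumes a: "a \<in> B" shows "\<exists>p\<in>S. \<forall>s\<in>S. \<mu> (s * a) = \<mu> (s * p)"
proof -
  obtain G where G: "finite G" "G \<subseteq> S" "span G = S" by (rule finite_basis)
  obtain p where p: "p \<in> S" "\<And>f. f \<in> G \<Longrightarrow> \<mu> (star f * (a - p)) = 0"
    using orthogonal_projection_aux[OF G(1,2)] a by metis
  have pB: "p \<in> B" using p sub_le by auto
  have "\<mu> (star s * (a - p)) = 0" if "s \<in> S" for s
  proof -
    have "subspace {s \<in> S. \<mu> (star s * (a - p)) = 0}"
      using S_le a pB by (auto simp: subspace_def S.mems distrib_right functional_simps mems)
    moreover have "G \<subseteq> {s \<in> S. \<mu> (star s * (a - p)) = 0}" using G(2) p(2) by auto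
    ultimately have "span G \<subseteq> {s \<in> S. \<mu> (star s * (a - p)) = 0}" by (rule span_minimal[rotated])
    then show ?thesis using that G(3) by auto
  qed
  then have "\<mu> (s * (a - p)) = 0" if "s \<in> S" for s
    using S.star_mem[OF that] by (metis star_star)
  then have "\<mu> (s * a) = \<mu> (s * p)" if "s \<in> S" for s
    using that a pB S_le by (auto simp: right_diff_distrib functional_simps mems)
  then show ?thesis using p(1) by blast
qed

definition expect :: "'c \<Rightarrow> 'c" where
  "expect a = (SOME p. p \<in> S \<and> (\<forall>s\<in>S. \<mu> (s * a) = \<mu> (s * p)))"

lemma expect:
  assumes "a \<in> B"
  shows expect_mem: "expect a \<in> S" and expect_orth: "\<And>s. s \<in> S \<Longrightarrow> \<mu> (s * expect a) = \<mu> (s * a)"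
proof -
  have "\<exists>p. p \<in> S \<and> (\<forall>s\<in>S. \<mu> (s * a) = \<mu> (s * p))"
    using orthogonal_projection_exists[OF assms] by blast
  from someI_ex[OF this] show "expect a \<in> S" "\<And>s. s \<in> S \<Longrightarrow> \<mu> (s * expect a) = \<mu> (s * a)"
    by (auto simp: expect_def)
qed

lemma expect_B: "a \<in> B \<Longrightarrow> expect a \<in> B" using expect_mem sub_le by auto

lemma eq_of_trace_eq:
  assumes "p \<in> S" "q \<in> S" "\<And>s. s \<in> S \<Longrightarrow> \<mu> (s * p) = \<mu> (s * q)" shows "p = q"
proof -
  have "\<mu> (star (p - q) * (p - q)) = \<mu> (star (p - q) * p) - \<mu> (star (p - q) * q)"
    using assms(1,2) S_le by (simp add: right_diff_distrib functional_diff mems)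
  also have "\<dots> = 0" using assms(3)[of "star (p - q)"] assms(1,2) by (simp add: S.mems)
  finally have "p - q = 0" using assms(1,2) S_le by (intro faithful mems) auto
  then show ?thesis by simp
qed

lemma expect_eqI:
  assumes "a \<in> B" "p \<in> S" "\<And>s. s \<in> S \<Longrightarrow> \<mu> (s * a) = \<mu> (s * p)" shows "expect a = p"
  using assms expect by (intro eq_of_trace_eq) auto

lemma expect_fix: "a \<in> S \<Longrightarrow> expect a = a"
  using S_le by (intro expect_eqI) auto

lemma expect_add: assumes "a \<in> B" "b \<in> B" shows "expect (a + b) = expect a + expect b"
  using assms S_le by (intro expect_eqI) (auto simp: distrib_left functional_add mems S.mems expect expect_B)

lemma expect_scaleC: assumes "a \<in> B" shows "expect (s *\<^sub>C a) = s *\<^sub>C expect a"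
  using assms S_le by (intro expect_eqI) (auto simp: functional_scaleC mems S.mems expect expect_B)

lemma expect_diff: assumes "a \<in> B" "b \<in> B" shows "expect (a - b) = expect a - expect b"
  using assms S_le by (intro expect_eqI) (auto simp: right_diff_distrib functional_diff mems S.mems expect expect_B)

lemma expect_bimodule:
  assumes "a \<in> B" "b \<in> S" "d \<in> S" shows "expect (b * a * d) = b * expect a * d"
proof (rule expect_eqI)
  fix s assume s: "s \<in> S"
  have in_B: "b \<in> B" "d \<in> B" "s \<in> B" using assms s S_le by auto
  have "\<mu> (s * (b * x * d)) = \<mu> (d * s * b * x)" if "x \<in> B" for x
    using trace_commute[of "s * b * x" d] in_B that by (simp add: mult.assoc mems)
  moreover have "\<mu> (d * s * b * a) = \<mu> (d * s * b * expect a)"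
    using expect_orth[OF assms(1), of "d * s * b"] assms s by (simp add: S.mems)
  ultimately show "\<mu> (s * (b * a * d)) = \<mu> (s * (b * expect a * d))"
    using assms(1) expect_B by simp
qed (use assms S_le in \<open>auto intro: mems S.mems expect_mem\<close>)

lemma expect_mult_left: "a \<in> B \<Longrightarrow> b \<in> S \<Longrightarrow> expect (b * a) = b * expect a"
  using expect_bimodule[of a b e] S_le by (simp add: right_unit mems S.mems expect_B)

lemma expect_mult_right: "a \<in> B \<Longrightarrow> d \<in> S \<Longrightarrow> expect (a * d) = expect a * d"
  using expect_bimodule[of a e d] S_le by (simp add: left_unit mems S.mems expect_B)

lemma trace_expect: "a \<in> B \<Longrightarrow> \<mu> (expect a) = \<mu> a"
  using expect_orth[of a e] by (simp add: left_unit S.mems expect_B)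

lemma expect_star: assumes "a \<in> B" shows "expect (star a) = star (expect a)"
proof (rule expect_eqI)
  fix s assume s: "s \<in> S"
  then have sB: "s \<in> B" "star s \<in> S" using S_le S.mems by auto
  have "\<mu> (s * star a) = cnj (\<mu> (a * star s))"
    using functional_star[of "a * star s"] assms sB by (simp add: mems)
  also have "\<mu> (a * star s) = \<mu> (star s * expect a)"
    using trace_commute[of a "star s"] assms sB by (simp add: expect_orth mems)
  also have "cnj \<dots> = \<mu> (star (expect a) * s)"
    using functional_star[of "star s * expect a"] assms sB by (simp add: mems expect_B)
  also have "\<dots> = \<mu> (s * star (expect a))"
    using trace_commute assms sB by (simp add: mems expect_B)
  finally show "\<mu> (s * star a) = \<mu> (s * star (expect a))" .
qed (use assms in \<open>auto intro: mems S.mems expect_mem\<close>)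

lemma sqnorm_expect_le: assumes "x \<in> B" shows "sqnorm (expect x) \<le> sqnorm x"
proof -
  let ?p = "expect x"
  have p: "?p \<in> S" "?p \<in> B" using assms expect_mem expect_B by auto
  have "\<mu> (star ?p * x) = \<mu> (star ?p * ?p)" using expect_orth[OF assms, of "star ?p"] p by (simp add: S.mems)
  moreover have "\<mu> (star x * ?p) = cnj (\<mu> (star ?p * x))"
    using functional_star[of "star ?p * x"] assms p by (simp add: mems)
  moreover have "star (x - ?p) * (x - ?p) = star x * x - star x * ?p - star ?p * x + star ?p * ?p"
    by (simp add: algebra_simps)
  ultimately have "sqnorm (x - ?p) = sqnorm x - sqnorm ?p"
    using assms p by (simp add: sqnorm_def functional_simps mems)
  then show ?thesis using sqnorm_nonneg[of "x - ?p"] assms p by (simp add: mems)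
qed

text \<open>The C*-norm of a self-adjoint element of a finite-dimensional algebra is at most its operator
  norm on the \<open>L\<^sup>2\<close>-space of the trace: the two norms are comparable, repeated squaring is
  multiplicative for the former and submultiplicative for the latter.\<close>

lemma norm_le_of_sqnorm_bound:
  assumes k: "k \<in> S" "star k = k" and "0 \<le> M"
    and bound: "\<And>v. v \<in> S \<Longrightarrow> sqnorm (k * v) \<le> M * sqnorm v"
  shows "(norm k)\<^sup>2 \<le> M"
proof -
  obtain G where G: "finite G" "G \<subseteq> S" "span G = S" by (rule finite_basis)
  obtain \<kappa> where \<kappa>: "\<kappa> > 0" "\<And>x. x \<in> S \<Longrightarrow> \<kappa> * (norm x)\<^sup>2 \<le> sqnorm x"
    using sqnorm_coercive[OF G(1)] G(3) sub_le by auto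
  have it: "iter_square n k \<in> S \<and> (\<forall>v\<in>S. sqnorm (iter_square n k * v) \<le> M ^ 2 ^ n * sqnorm v)" for n
  proof (induction n)
    case (Suc n)
    let ?y = "iter_square n k"
    have "sqnorm (?y * ?y * v) \<le> M ^ 2 ^ Suc n * sqnorm v" if "v \<in> S" for v
    proof -
      have "sqnorm (?y * (?y * v)) \<le> M ^ 2 ^ n * sqnorm (?y * v)" using Suc that by (simp add: S.mems)
      also have "\<dots> \<le> M ^ 2 ^ n * (M ^ 2 ^ n * sqnorm v)"
        using Suc that \<open>0 \<le> M\<close> by (intro mult_left_mono) auto
      finally show ?thesis by (simp add: mult.assoc power_add mult_2)
    qed
    then show ?case using Suc by (simp add: S.mems)
  qed (use k bound in auto)
  show ?thesis
  proof (rule le_of_power_growth[OF \<open>0 \<le> M\<close>])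
    fix n
    have "\<kappa> * (norm (iter_square n k))\<^sup>2 \<le> sqnorm (iter_square n k)" using \<kappa>(2) it by blast
    also have "\<dots> = sqnorm (iter_square n k * e)" using it S.right_unit by simp
    also have "\<dots> \<le> M ^ 2 ^ n" using it[of n] S.unit_mem sqnorm_unit by auto
    finally have "\<kappa> * ((norm k)\<^sup>2) ^ 2 ^ n \<le> M ^ 2 ^ n"
      by (simp add: norm_iter_square[OF k(2)] power_mult[symmetric] mult.commute)
    then show "((norm k)\<^sup>2) ^ 2 ^ n \<le> (1 / \<kappa>) * M ^ 2 ^ n" using \<kappa>(1) by (simp add: field_simps)
  qed
qed

text \<open>Since \<open>expect a * v = expect (a * v)\<close> for \<open>v \<in> S\<close> and orthogonal projections contract \<open>sqnorm\<close>, left multiplication by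
  \<open>expect a\<close>, and likewise by its adjoint, has operator norm at most \<open>\<parallel>a\<parallel>\<close> for the \<open>L\<^sup>2\<close>-norm on \<open>S\<close>.\<close>

lemma norm_expect_le: assumes a: "a \<in> B" shows "norm (expect a) \<le> norm a"
proof -
  let ?b = "expect a" and ?k = "star (expect a) * expect a"
  have step: "sqnorm (expect x * v) \<le> (norm x)\<^sup>2 * sqnorm v" if "x \<in> B" "v \<in> S" for x v
  proof -
    have "sqnorm (expect x * v) = sqnorm (expect (x * v))" using that by (simp add: expect_mult_right)
    also have "\<dots> \<le> sqnorm (x * v)" using that S_le by (intro sqnorm_expect_le mems) auto
    also have "\<dots> \<le> (norm x)\<^sup>2 * sqnorm v" using that S_le by (intro sqnorm_mult_le) auto
    finally show ?thesis .
  qed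
  have "(norm ?k)\<^sup>2 \<le> (norm a) ^ 4"
  proof (rule norm_le_of_sqnorm_bound)
    fix v assume v: "v \<in> S"
    have "sqnorm (?k * v) = sqnorm (expect (star a) * (?b * v))" using a by (simp add: expect_star mult.assoc)
    also have "\<dots> \<le> (norm (star a))\<^sup>2 * sqnorm (?b * v)"
      using a v by (intro step) (auto intro: mems S.mems expect_mem)
    also have "\<dots> \<le> (norm a)\<^sup>2 * ((norm a)\<^sup>2 * sqnorm v)"
      unfolding norm_star by (intro mult_left_mono step[OF a v]) simp
    finally show "sqnorm (?k * v) \<le> (norm a) ^ 4 * sqnorm v" by (simp add: power_numeral_reduce mult.assoc)
  qed (use a in \<open>auto intro: S.mems expect_mem\<close>)
  then have "norm ?b ^ 4 \<le> norm a ^ 4" by (simp add: norm_star_mult power_mult[symmetric])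
  then show ?thesis by (simp add: power_mono_iff)
qed

text \<open>For \<open>norm h = 1\<close> positivity on the \<open>L\<^sup>2\<close>-space of the trace gives \<open>norm (e - h) \<le> 1\<close>. Hence
  \<open>e - t (e - h)\<close> has a square root for \<open>t < 1\<close>, and the square roots accumulate as \<open>t\<close> tends
  to \<open>1\<close> because \<open>S\<close> is finite-dimensional.\<close>

lemma positive_imp_square:
  assumes h: "h \<in> S" "star h = h" and pos: "\<And>s. s \<in> S \<Longrightarrow> 0 \<le> Re (\<mu> (star s * h * s))"
  shows "\<exists>b\<in>S. star b = b \<and> b * b = h"
proof (cases "h = 0")
  case True
  then show ?thesis using S.zero_mem by (intro bexI[of _ 0]) auto
next
  case False
  define g where "g = inverse (norm h) *\<^sub>R h"
  have g: "g \<in> S" "g \<in> B" "star g = g" "norm g = 1" using h False S_le by (auto simp: g_def S.mems)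
  have g_pos: "0 \<le> Re (\<mu> (star s * g * s))" if "s \<in> S" for s
    using pos[OF that] that h S_le by (simp add: g_def functional_scaleR mems)
  have "(norm (e - g))\<^sup>2 \<le> 1"
  proof (rule norm_le_of_sqnorm_bound)
    fix v assume v: "v \<in> S"
    then have vB: "v \<in> B" using S_le by auto
    let ?w = "g * v"
    have wB: "?w \<in> B" using g v vB by (auto intro: mems)
    define c where "c = Re (\<mu> (star v * g * v))"
    \<comment> \<open>positivity of \<open>g\<close> at \<open>v - g v\<close> gives \<open>\<parallel>g v\<parallel>\<^sup>2 \<le> c\<close>, once \<open>(g v)\<^sup>* g (g v)\<close> is bounded\<close>
    have "Re (\<mu> (star ?w * g * ?w)) \<le> norm g * Re (\<mu> (star ?w * e * ?w))"
      using g by (intro positive_functional.functional_sa_le[OF compressed[OF wB]])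
    then have cube: "Re (\<mu> (star ?w * g * ?w)) \<le> sqnorm ?w"
      using wB g(4) by (simp add: sqnorm_def mult.assoc left_unit)
    have "0 \<le> Re (\<mu> (star (v - ?w) * g * (v - ?w)))" using g v by (intro g_pos S.mems)
    also have "star (v - ?w) * g * (v - ?w) =
        star v * g * v - star ?w * ?w - star ?w * ?w + star ?w * g * ?w"
      using g(3) by (simp add: algebra_simps)
    also have "Re (\<mu> \<dots>) = c - 2 * sqnorm ?w + Re (\<mu> (star ?w * g * ?w))"
      using vB wB g(2) by (simp add: functional_simps mems c_def sqnorm_def del: star_mult)
    finally have "sqnorm ?w \<le> c" using cube by simp
    have "star ((e - g) * v) * ((e - g) * v) = star v * v - star v * g * v - star v * g * v + star ?w * ?w"
      using g vB by (simp add: left_diff_distrib left_unit right_diff_distrib mult.assoc algebra_simps)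
    then have "sqnorm ((e - g) * v) = sqnorm v - 2 * c + sqnorm ?w"
      using vB wB g(2) by (simp add: functional_simps mems c_def sqnorm_def del: star_mult)
    then show "sqnorm ((e - g) * v) \<le> 1 * sqnorm v"
      using \<open>sqnorm ?w \<le> c\<close> sqnorm_nonneg[OF wB] by simp
  qed (use g in \<open>auto intro: S.mems simp: S.star_unit\<close>)
  then have eg: "norm (e - g) \<le> 1" by (simp add: power2_le_iff_abs_le abs_square_le_1)
  define t :: "nat \<Rightarrow> real" where "t n = 1 - inverse (real (Suc n))" for n
  have t: "0 \<le> t n" "t n < 1" for n by (auto simp: t_def field_simps)
  have tlim: "t \<longlonglongrightarrow> 1"
    unfolding t_def using tendsto_diff[OF tendsto_const LIMSEQ_inverse_real_of_nat, of 1] by simp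
  have "\<forall>n. \<exists>b\<in>S. star b = b \<and> b * b = e - t n *\<^sub>R (e - g)"
  proof
    fix n
    have "norm (t n *\<^sub>R (e - g)) \<le> t n" using t[of n] eg by (simp add: mult_left_le)
    then show "\<exists>b\<in>S. star b = b \<and> b * b = e - t n *\<^sub>R (e - g)"
      using t[of n] g by (intro S.square_root) (auto intro: S.mems simp: S.star_unit)
  qed
  then obtain b where b: "\<And>n. b n \<in> S" "\<And>n. star (b n) = b n" "\<And>n. b n * b n = e - t n *\<^sub>R (e - g)"
    by metis
  have b_norm: "norm (b n) \<le> sqrt 2" for n
  proof -
    have "(norm (b n))\<^sup>2 = norm (e - t n *\<^sub>R (e - g))" using norm_star_mult[of "b n"] b by simp
    also have "\<dots> \<le> norm e + norm (t n *\<^sub>R (e - g))" by (rule norm_triangle_ineq4)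
    also have "\<dots> \<le> 1 + 1 * 1"
      unfolding norm_scaleR using t[of n] eg norm_unit_le by (intro add_mono mult_mono) auto
    finally show ?thesis by (intro real_le_rsqrt) simp
  qed
  obtain G where G: "finite G" "G \<subseteq> S" "span G = S" by (rule finite_basis)
  have bG: "\<And>n. b n \<in> span G" using b(1) G(3) by simp
  obtain l and r :: "nat \<Rightarrow> nat" where lr: "l \<in> span G" "strict_mono r" "(b \<circ> r) \<longlonglongrightarrow> l"
    using span_bounded_seq_convergent_subseq[of G b, OF G(1) bG b_norm] by (elim bexE exE conjE)
  have "(\<lambda>n. star ((b \<circ> r) n)) \<longlonglongrightarrow> star l" by (intro tendsto_star lr(3))
  then have "(b \<circ> r) \<longlonglongrightarrow> star l" using b(2) by (simp add: o_def)
  then have l_sa: "star l = l" using LIMSEQ_unique lr(3) by blast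
  have "(\<lambda>n. e - (t \<circ> r) n *\<^sub>R (e - g)) \<longlonglongrightarrow> e - 1 *\<^sub>R (e - g)"
    by (intro tendsto_intros LIMSEQ_subseq_LIMSEQ[OF tlim lr(2)])
  moreover have "(\<lambda>n. (b \<circ> r) n * (b \<circ> r) n) \<longlonglongrightarrow> l * l" by (intro tendsto_intros lr(3))
  ultimately have "l * l = g" using b(3) LIMSEQ_unique by (fastforce simp: o_def)
  let ?l = "sqrt (norm h) *\<^sub>R l"
  have "?l * ?l = norm h *\<^sub>R g" using \<open>l * l = g\<close> by simp
  then have "?l * ?l = h" using False by (simp add: g_def)
  moreover have "?l \<in> S" "star ?l = ?l" using lr(1) G(3) l_sa by (simp_all add: S.scaleR_mem)
  ultimately show ?thesis by blast
qed

lemma expect_square: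
  assumes "a \<in> B" shows "\<exists>b\<in>S. star b = b \<and> b * b = expect (star a * a)"
proof (rule positive_imp_square)
  fix s assume s: "s \<in> S"
  then have sB: "s \<in> B" using S_le by auto
  have "\<mu> (star s * expect (star a * a) * s) = \<mu> (expect (star s * (star a * a) * s))"
    using assms s by (simp add: expect_bimodule mems S.mems)
  also have "\<dots> = \<mu> (star (a * s) * (a * s))"
    using assms sB by (simp add: trace_expect mems mult.assoc)
  finally show "0 \<le> Re (\<mu> (star s * expect (star a * a) * s))"
    using functional_nonneg[of "a * s"] assms sB by (simp add: mems)
qed (use assms in \<open>auto intro: expect_mem mems simp: expect_star[symmetric] mems\<close>)

text \<open>In the splitting \<open>a b = (a - E a) b + E a (b - E b) + E a E b\<close> the expectation kills the second summand and fixes the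
  third one, so only the first contributes twice.\<close>

lemma expect_Leibniz:
  assumes "a \<in> B" "b \<in> B"
  shows "norm (a * b - expect (a * b)) \<le> 2 * (norm (a - expect a) * norm b + norm a * norm (b - expect b))"
proof -
  let ?x = "(a - expect a) * b" and ?y = "expect a * (b - expect b)"
  have mem: "?x \<in> B" "?y \<in> B" "expect a \<in> S" "expect b \<in> S" using assms by (auto intro: mems expect_B expect_mem)
  have "expect ?y = 0"
    using assms mem by (simp add: expect_mult_left mems expect_diff expect_B expect_fix)
  have ab: "a * b = (?x + ?y) + expect a * expect b" by (simp add: algebra_simps)
  have "expect (a * b) = expect ?x + expect a * expect b"
    unfolding ab using mem \<open>expect ?y = 0\<close> by (simp add: expect_add expect_fix mems S.mems S_le)
  then have "a * b - expect (a * b) = ?x - expect ?x + ?y" by (simp add: ab)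
  also have "norm \<dots> \<le> norm ?x + norm (expect ?x) + norm ?y"
    using norm_triangle_ineq[of "?x - expect ?x" ?y] norm_triangle_ineq4[of ?x "expect ?x"] by linarith
  also have "\<dots> \<le> norm ?x + norm ?x + 2 * norm ?y" using norm_expect_le[OF mem(1)] norm_ge_zero[of ?y] by linarith
  also have "norm ?x \<le> norm (a - expect a) * norm b" by (rule norm_mult_ineq)
  also have "norm ?y \<le> norm a * norm (b - expect b)"
    by (rule order_trans[OF norm_mult_ineq mult_right_mono]) (use assms norm_expect_le in auto)
  finally show ?thesis by (simp add: mult.commute mult.left_commute)
qed

end

lemma expect_tower:
  assumes S: "finite_dim_expectation B e \<mu> S" and T: "finite_dim_expectation B e \<mu> T"
    and "S \<subseteq> T" "a \<in> B"
  shows "finite_dim_expectation.expect \<mu> S (finite_dim_expectation.expect \<mu> T a) =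
      finite_dim_expectation.expect \<mu> S a"
    and "finite_dim_expectation.expect \<mu> T (finite_dim_expectation.expect \<mu> S a) =
      finite_dim_expectation.expect \<mu> S a"
proof -
  interpret S: finite_dim_expectation B e \<mu> S by (rule S)
  interpret T: finite_dim_expectation B e \<mu> T by (rule T)
  show "S.expect (T.expect a) = S.expect a"
    using assms(3,4) by (intro S.expect_eqI) (auto simp: T.expect_B S.expect_mem S.expect_orth T.expect_orth)
  show "T.expect (S.expect a) = S.expect a"
    using assms(3,4) S.expect_mem by (intro T.expect_fix) auto
qed

section \<open>C*-algebra records: topology and subalgebras\<close>

context unital_cstar
begin

lemma is_cstar: "unital_cstar A" by (rule unital_cstar_axioms)

end

text \<open>Fixing the record type without extension fields is what makes the embedding into the product available.\<close>

locale cstar_record = unital_cstar A for A :: "'a cstar" (structure)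
begin

abbreviation \<iota> :: "'a \<Rightarrow> 'a cstar_product" where "\<iota> \<equiv> emb A"

lemmas \<iota>_simps = emb_simps[OF is_cstar]
lemmas \<iota>_norm = norm_emb[OF is_cstar]
lemmas \<iota>_eq_iff = emb_eq_iff[OF is_cstar]

lemma cdist_eq_dist: "x \<in> carrier A \<Longrightarrow> y \<in> carrier A \<Longrightarrow> cdist A x y = dist (\<iota> x) (\<iota> y)"
  by (simp add: cdist_def \<iota>_norm[symmetric] \<iota>_simps dist_norm)

lemma Metric_space_cdist: "Metric_space (carrier A) (cdist A)"
proof
  fix x y z
  show "0 \<le> cdist A x y" "cdist A x y = cdist A y x"
    by (cases "x \<in> carrier A \<and> y \<in> carrier A"; simp add: cdist_eq_dist dist_commute; auto simp: cdist_def)+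
qed (auto simp: cdist_eq_dist \<iota>_eq_iff dist_triangle)

sublocale M: Metric_space "carrier A" "cdist A" by (rule Metric_space_cdist)

lemma complete_emb: "complete (\<iota> ` carrier A)"
proof (rule completeI)
  fix y assume y: "\<forall>n. y n \<in> \<iota> ` carrier A" and "Cauchy y"
  from y have "\<forall>n. \<exists>x. x \<in> carrier A \<and> y n = \<iota> x" by blast
  then obtain x where x: "\<And>n. x n \<in> carrier A" "\<And>n. y n = \<iota> (x n)" by metis
  have "M.MCauchy x" unfolding M.MCauchy_def
    using x \<open>Cauchy y\<close> by (auto simp: Cauchy_def cdist_eq_dist)
  then obtain l where l: "limitin M.mtopology x l sequentially"
    using complete M.mcomplete_def by blast
  then have lA: "l \<in> carrier A" using M.limitin_mspace by blast
  have "y \<longlonglongrightarrow> \<iota> l"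
    using l x(1) lA unfolding M.limitin_metric tendsto_iff x(2) by (simp add: cdist_eq_dist)
  then show "\<exists>l\<in>\<iota> ` carrier A. y \<longlonglongrightarrow> l" using lA by blast
qed

lemma cstar_subalgebra_carrier: "cstar_subalgebra (\<iota> ` carrier A) (\<iota> \<one>)"
proof
  fix u v assume "u \<in> \<iota> ` carrier A" "v \<in> \<iota> ` carrier A"
  then obtain x y where "x \<in> carrier A" "u = \<iota> x" "y \<in> carrier A" "v = \<iota> y" by auto
  then show "u + v \<in> \<iota> ` carrier A" "u * v \<in> \<iota> ` carrier A"
    by (simp_all flip: \<iota>_simps)
next
  fix u s assume "u \<in> \<iota> ` carrier A"
  then obtain x where "x \<in> carrier A" "u = \<iota> x" by auto
  then show "s *\<^sub>C u \<in> \<iota> ` carrier A" "star u \<in> \<iota> ` carrier A" "\<iota> \<one> * u = u" "u * \<iota> \<one> = u"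
    by (simp_all flip: \<iota>_simps)
qed (auto simp: complete_emb)

sublocale R: cstar_subalgebra "\<iota> ` carrier A" "\<iota> \<one>" by (rule cstar_subalgebra_carrier)

lemma \<iota>_mem: "x \<in> carrier A \<Longrightarrow> \<iota> x \<in> \<iota> ` carrier A" by blast

lemma closedin_iff_closed_emb:
  assumes "S \<subseteq> carrier A"
  shows "closedin (cstar_topology A) S \<longleftrightarrow> closed (\<iota> ` S)"
proof
  assume *: "closedin (cstar_topology A) S"
  show "closed (\<iota> ` S)" unfolding closed_sequential_limits
  proof (intro allI impI, elim conjE)
    fix y l assume y: "\<forall>n. y n \<in> \<iota> ` S" and lim: "y \<longlonglongrightarrow> l"
    have "l \<in> \<iota> ` carrier A"
      using R.closed y lim assms unfolding closed_sequential_limits by blast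
    then obtain x where x: "x \<in> carrier A" "l = \<iota> x" by auto
    have "x \<in> S"
    proof (rule ccontr)
      assume "x \<notin> S"
      then obtain r where r: "r > 0" "disjnt S (M.mball x r)"
        using * x(1) unfolding cstar_topology_def M.closedin_metric by blast
      obtain n where n: "dist (y n) l < r" using lim r(1) unfolding tendsto_iff eventually_sequentially by blast
      obtain z where z: "z \<in> S" "y n = \<iota> z" using y by blast
      then have "z \<in> M.mball x r"
        using n x assms by (auto simp: M.in_mball cdist_eq_dist dist_commute)
      then show False using r(2) z(1) by (auto simp: disjnt_iff)
    qed
    then show "l \<in> \<iota> ` S" using x by blast
  qed
next
  assume cl: "closed (\<iota> ` S)"
  show "closedin (cstar_topology A) S"
    unfolding cstar_topology_def M.closedin_metric
  proof (intro conjI allI impI assms)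
    fix x assume x: "x \<in> carrier A - S"
    then have "\<iota> x \<notin> \<iota> ` S" using assms \<iota>_eq_iff by auto
    then obtain r where r: "r > 0" "ball (\<iota> x) r \<subseteq> - \<iota> ` S"
      using cl unfolding closed_def open_contains_ball by blast
    have "disjnt S (M.mball x r)"
      using r(2) x by (fastforce simp: disjnt_iff M.in_mball cdist_eq_dist subset_iff)
    then show "\<exists>r>0. disjnt S (M.mball x r)" using r(1) by blast
  qed
qed

lemma closure_of_iff:
  assumes "S \<subseteq> carrier A" "x \<in> carrier A"
  shows "x \<in> cstar_topology A closure_of S \<longleftrightarrow> \<iota> x \<in> closure (\<iota> ` S)"
proof -
  have "(\<exists>y\<in>S. y \<in> M.mball x r) \<longleftrightarrow> (\<exists>y\<in>S. cdist A x y < r)" for r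
    using assms by (intro bex_cong) (auto simp: M.in_mball)
  then have "x \<in> cstar_topology A closure_of S \<longleftrightarrow> (\<forall>r>0. \<exists>y\<in>S. cdist A x y < r)"
    unfolding cstar_topology_def M.metric_closure_of using assms by simp
  also have "\<dots> \<longleftrightarrow> (\<forall>r>0. \<exists>y\<in>S. dist (\<iota> y) (\<iota> x) < r)"
    using assms by (simp add: cdist_eq_dist dist_commute subset_iff cong: bex_cong)
  finally show ?thesis by (simp add: closure_approachable)
qed

lemma topspace_cstar_topology: "topspace (cstar_topology A) = carrier A"
  by (simp add: cstar_topology_def)

lemma subalgebraD:
  assumes "unital_cstar_subalgebra A S"
  shows "S \<subseteq> carrier A" "\<zero> \<in> S" "\<one> \<in> S" "x \<in> S \<Longrightarrow> \<ominus> x \<in> S"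
    "x \<in> S \<Longrightarrow> y \<in> S \<Longrightarrow> x \<otimes> y \<in> S" "x \<in> S \<Longrightarrow> y \<in> S \<Longrightarrow> x \<oplus> y \<in> S"
    "x \<in> S \<Longrightarrow> y \<in> S \<Longrightarrow> x \<ominus> y \<in> S" "x \<in> S \<Longrightarrow> s \<odot> x \<in> S" "x \<in> S \<Longrightarrow> adj A x \<in> S"
  using assms subringE[of S A] by (auto simp: unital_cstar_subalgebra_def a_minus_def)

lemma cstar_subalgebra_emb:
  assumes "unital_cstar_subalgebra A S"
  shows "cstar_subalgebra (\<iota> ` S) (\<iota> \<one>)"
proof
  note S = subalgebraD[OF assms]
  fix u v assume "u \<in> \<iota> ` S" "v \<in> \<iota> ` S"
  then obtain x y where "x \<in> S" "u = \<iota> x" "y \<in> S" "v = \<iota> y" by auto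
  moreover from this have "x \<in> carrier A" "y \<in> carrier A" using S(1) by auto
  ultimately show "u + v \<in> \<iota> ` S" "u * v \<in> \<iota> ` S"
    using S(5,6)[of x y] by (simp_all flip: \<iota>_simps)
next
  note S = subalgebraD[OF assms]
  fix u s assume "u \<in> \<iota> ` S"
  then obtain x where x: "x \<in> S" "u = \<iota> x" by auto
  then have "x \<in> carrier A" using S(1) by auto
  then show "s *\<^sub>C u \<in> \<iota> ` S" "star u \<in> \<iota> ` S" "\<iota> \<one> * u = u" "u * \<iota> \<one> = u"
    using x S(8,9)[of x] by (simp_all flip: \<iota>_simps)
next
  show "\<iota> \<one> \<in> \<iota> ` S" using subalgebraD[OF assms] by blast
  have "closed (\<iota> ` S)"
    using assms closedin_iff_closed_emb subalgebraD(1)[OF assms] by (auto simp: unital_cstar_subalgebra_def)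
  then show "complete (\<iota> ` S)"
    by (rule complete_closed_subset[OF _ image_mono complete_emb]) (rule subalgebraD(1)[OF assms])
qed

lemma emb_finsum:
  assumes "finite F" "F \<subseteq> carrier A"
  shows "\<iota> (\<Oplus>v\<in>F. s v \<odot> v) = (\<Sum>v\<in>F. s v *\<^sub>C \<iota> v)"
  using assms
proof (induction F rule: finite_induct)
  case empty
  have "abelian_monoid A" using abelian_group_carrier by (simp add: abelian_group_def)
  then show ?case by (simp add: abelian_monoid.finsum_empty \<iota>_simps)
next
  case (insert v F)
  have am: "abelian_monoid A" using abelian_group_carrier by (simp add: abelian_group_def)
  have "(\<Oplus>v\<in>insert v F. s v \<odot> v) = s v \<odot> v \<oplus> (\<Oplus>v\<in>F. s v \<odot> v)"
    using insert by (intro abelian_monoid.finsum_insert[OF am]) auto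
  moreover have "(\<Oplus>v\<in>F. s v \<odot> v) \<in> carrier A"
    using insert by (intro abelian_monoid.finsum_closed[OF am]) auto
  ultimately show ?case using insert by (simp add: \<iota>_simps)
qed

lemma finsum_smult_closed:
  assumes "finite F" "F \<subseteq> carrier A" shows "(\<Oplus>v\<in>F. s v \<odot> v) \<in> carrier A"
  using assms abelian_group_carrier by (intro abelian_monoid.finsum_closed) (auto simp: abelian_group_def)

lemma finite_dimensional_emb:
  assumes "finite_dimensional A S" "S \<subseteq> carrier A"
  shows "\<exists>G. finite G \<and> \<iota> ` S \<subseteq> span G"
proof -
  obtain F where F: "finite F" "F \<subseteq> S" "\<And>x. x \<in> S \<Longrightarrow> \<exists>s. x = (\<Oplus>v\<in>F. s v \<odot> v)"
    using assms(1) unfolding finite_dimensional_def by blast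
  let ?G = "\<iota> ` F \<union> (\<lambda>v. \<i> *\<^sub>C \<iota> v) ` F"
  have "\<iota> x \<in> span ?G" if x: "x \<in> S" for x
  proof -
    obtain s where s: "x = (\<Oplus>v\<in>F. s v \<odot> v)" using F(3)[OF x] by (elim exE)
    have "\<iota> x = (\<Sum>v\<in>F. s v *\<^sub>C \<iota> v)" unfolding s using F assms(2) by (intro emb_finsum) auto
    also have "\<dots> = (\<Sum>v\<in>F. Re (s v) *\<^sub>R \<iota> v + Im (s v) *\<^sub>R (\<i> *\<^sub>C \<iota> v))"
    proof (rule sum.cong[OF refl])
      fix v
      have "s v *\<^sub>C \<iota> v = (of_real (Re (s v)) + of_real (Im (s v)) * \<i>) *\<^sub>C \<iota> v"
        using complex_eq[of "s v"] by (simp add: mult.commute)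
      also have "\<dots> = Re (s v) *\<^sub>R \<iota> v + Im (s v) *\<^sub>R (\<i> *\<^sub>C \<iota> v)"
        by (simp only: scaleC_add_left scaleC_of_real scaleC_scaleC[symmetric])
      finally show "s v *\<^sub>C \<iota> v = Re (s v) *\<^sub>R \<iota> v + Im (s v) *\<^sub>R (\<i> *\<^sub>C \<iota> v)" .
    qed
    also have "\<dots> \<in> span ?G"
      by (intro span_sum span_add span_scale span_base) auto
    finally show ?thesis .
  qed
  then show ?thesis using F(1) by (intro exI[of _ ?G]) auto
qed

lemma a_minus_subalgebra:
  assumes "unital_cstar_subalgebra A S" "x \<in> S" "y \<in> S"
  shows "x \<ominus>\<^bsub>A\<lparr>carrier := S\<rparr>\<^esub> y = x \<ominus> y"
proof -
  note S = subalgebraD[OF assms(1)]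
  have ring: "ring (A\<lparr>carrier := S\<rparr>)"
    using assms(1) ring.subring_is_ring[of A S] is_cstar
    by (auto simp: unital_cstar_subalgebra_def unital_cstar_def)
  then have ag: "abelian_group (A\<lparr>carrier := S\<rparr>)" by (simp add: ring_def)
  have "\<ominus>\<^bsub>A\<lparr>carrier := S\<rparr>\<^esub> y = \<ominus> y"
    by (rule abelian_group.minus_equality[OF ag])
      (use S assms abelian_group.l_neg[OF abelian_group_carrier, of y] in auto)
  then show ?thesis by (simp add: a_minus_def)
qed

lemma unital_cstar_subrecord:
  assumes "unital_cstar_subalgebra A S"
  shows "unital_cstar (A\<lparr>carrier := S\<rparr>)"
proof -
  note S = subalgebraD[OF assms]
  let ?S = "A\<lparr>carrier := S\<rparr>"
  have ring: "ring ?S"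
    using assms ring.subring_is_ring[of A S] is_cstar
    by (auto simp: unital_cstar_subalgebra_def unital_cstar_def)
  have in_A: "x \<in> S \<Longrightarrow> x \<in> carrier A" for x using S(1) by auto
  have cd: "cdist ?S x y = cdist A x y" if "x \<in> S" "y \<in> S" for x y
    using that in_A a_minus_subalgebra[OF assms that] by (simp add: cdist_def)
  have complete_S: "Metric_space.mcomplete (carrier ?S) (cdist ?S)"
  proof -
    have outside: "cdist ?S x y = 0" if "\<not> (x \<in> S \<and> y \<in> S)" for x y
      using that by (auto simp: cdist_def)
    have met: "Metric_space S (cdist ?S)"
    proof
      fix x y z
      show "0 \<le> cdist ?S x y" by (cases "x \<in> S \<and> y \<in> S") (simp_all add: cd outside)
      show "cdist ?S x y = cdist ?S y x"
        using M.commute[of x y] by (cases "x \<in> S \<and> y \<in> S") (auto simp: cd outside)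
    qed (auto simp: cd in_A intro: M.triangle)
    interpret N: Metric_space S "cdist ?S" by (rule met)
    have "\<exists>l. limitin N.mtopology x l sequentially" if "N.MCauchy x" for x
    proof -
      have x: "\<And>n. x n \<in> S" using that by (auto simp: N.MCauchy_def)
      have "Cauchy (\<lambda>n. \<iota> (x n))"
        using that x unfolding N.MCauchy_def Cauchy_def by (simp add: cd cdist_eq_dist in_A)
      moreover have "complete (\<iota> ` S)"
        using cstar_subalgebra_emb[OF assms] by (simp add: cstar_subalgebra_def)
      moreover have "\<forall>n. \<iota> (x n) \<in> \<iota> ` S" using x by blast
      ultimately obtain u where "u \<in> \<iota> ` S" "(\<lambda>n. \<iota> (x n)) \<longlonglongrightarrow> u" using completeE by metis
      then obtain l where l: "l \<in> S" "(\<lambda>n. \<iota> (x n)) \<longlonglongrightarrow> \<iota> l" by blast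
      have "limitin N.mtopology x l sequentially"
        using l x unfolding N.limitin_metric tendsto_iff by (simp add: cd cdist_eq_dist in_A)
      then show ?thesis by blast
    qed
    then show ?thesis by (simp add: N.mcomplete_def)
  qed
  have module: "Module.module complex_ring ?S"
    by (rule moduleI[OF cring_complex_ring])
      (use ring S in \<open>auto simp: ring_def in_A smult_add_left smult_add_right smult_smult\<close>)
  show ?thesis
    by (intro unital_cstar.intro ring module unital_cstar_axioms.intro complete_S)
      (auto simp: in_A S smult_mult_left smult_mult_right adj_adj adj_add adj_smult adj_mult cnorm_eq_0
        cnorm_triangle cnorm_smult cnorm_mult cstar_identity)
qed

end

lemma cstar_record: "unital_cstar A \<Longrightarrow> cstar_record A"
  by (simp add: cstar_record_def)

section \<open>Quotients by closed ideals\<close>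

locale cstar_ideal = cstar_record A for A :: "'a cstar" (structure) +
  fixes I :: "'a set"
  assumes I: "I \<in> closed_ideals A"
begin

abbreviation Q :: "'a set cstar" where "Q \<equiv> cstar_quotient A I"

abbreviation proj :: "'a \<Rightarrow> 'a set" where "proj \<equiv> quotient_proj A I"

lemma ideal_I: "ideal I A" using I by (simp add: closed_ideals_def)

lemma I_le: "x \<in> I \<Longrightarrow> x \<in> carrier A"
  using ideal.Icarr[OF ideal_I] .

lemma I_closed:
  "\<zero> \<in> I" "x \<in> I \<Longrightarrow> y \<in> I \<Longrightarrow> x \<oplus> y \<in> I" "x \<in> I \<Longrightarrow> \<ominus> x \<in> I"
  "x \<in> I \<Longrightarrow> y \<in> carrier A \<Longrightarrow> x \<otimes> y \<in> I" "x \<in> I \<Longrightarrow> y \<in> carrier A \<Longrightarrow> y \<otimes> x \<in> I"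
  using ideal_I additive_subgroup.zero_closed additive_subgroup.a_closed additive_subgroup.a_inv_closed
    ideal.I_r_closed ideal.I_l_closed ideal.axioms(1)
  by (metis, metis, metis abelian_group_carrier additive_subgroup.a_inv_closed, metis, metis)

lemma abelian_subgroup_I: "abelian_subgroup I A"
  using abelian_group_carrier ideal_I by (simp add: abelian_subgroupI3 ideal.axioms(1))

lemma carrier_Q: "carrier Q = proj ` carrier A"
  by (auto simp: cstar_quotient_def FactRing_def A_RCOSETS_def' quotient_proj_def)

lemma proj_mem [simp, intro]: "x \<in> carrier A \<Longrightarrow> proj x \<in> carrier Q"
  by (auto simp: carrier_Q)

lemma proj_hom: "proj \<in> ring_hom A (A Quot I)"
  using ideal.rcos_ring_hom[OF ideal_I] by (simp add: quotient_proj_def[abs_def])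

lemma proj_add: "x \<in> carrier A \<Longrightarrow> y \<in> carrier A \<Longrightarrow> proj (x \<oplus> y) = proj x \<oplus>\<^bsub>Q\<^esub> proj y"
  using ring_hom_add[OF proj_hom] by (simp add: cstar_quotient_def)

lemma proj_mult: "x \<in> carrier A \<Longrightarrow> y \<in> carrier A \<Longrightarrow> proj (x \<otimes> y) = proj x \<otimes>\<^bsub>Q\<^esub> proj y"
  using ring_hom_mult[OF proj_hom] by (simp add: cstar_quotient_def)

lemma proj_one: "proj \<one> = \<one>\<^bsub>Q\<^esub>"
  using ring_hom_one[OF proj_hom] by (simp add: cstar_quotient_def)

lemma proj_eq_iff:
  assumes "x \<in> carrier A" "y \<in> carrier A" shows "proj x = proj y \<longleftrightarrow> x \<ominus> y \<in> I"
proof -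
  have "x \<in> I +> y \<longleftrightarrow> x \<ominus> y \<in> I"
    using abelian_subgroup.a_rcos_module[OF abelian_subgroup_I] assms
    by (simp add: a_minus_def)
  then show ?thesis
    using abelian_subgroup.a_repr_independence'[OF abelian_subgroup_I, of x y]
      abelian_subgroup.a_rcos_self[OF abelian_subgroup_I assms(1)] assms
    by (auto simp: quotient_proj_def)
qed

lemma mem_proj_iff: "x \<in> carrier A \<Longrightarrow> y \<in> proj x \<longleftrightarrow> y \<in> carrier A \<and> y \<ominus> x \<in> I"
  using abelian_subgroup.a_rcos_module[OF abelian_subgroup_I, of x y]
    abelian_subgroup.a_elemrcos_carrier[OF abelian_subgroup_I, of x y]
  by (auto simp: quotient_proj_def a_minus_def)

lemma mem_proj_self: "x \<in> carrier A \<Longrightarrow> x \<in> proj x"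
  by (simp add: quotient_proj_def abelian_subgroup.a_rcos_self[OF abelian_subgroup_I])

lemma proj_zero: "proj \<zero> = \<zero>\<^bsub>Q\<^esub>"
  using abelian_group.a_coset_join2[OF abelian_group_carrier, of \<zero> I]
    additive_subgroup.a_subgroup[OF ideal.axioms(1)[OF ideal_I]] I_closed(1)
  by (simp add: quotient_proj_def cstar_quotient_def FactRing_def)

lemma two_sided_ideal_emb: "R.two_sided_ideal (\<iota> ` I)"
  unfolding R.two_sided_ideal_def
proof (intro conjI ballI)
  show "\<iota> ` I \<subseteq> \<iota> ` carrier A" using I_le by auto
  show "0 \<in> \<iota> ` I" using I_closed(1) \<iota>_simps(5) by (metis imageI)
next
  fix u v assume "u \<in> \<iota> ` I" "v \<in> \<iota> ` I"
  then obtain x y where "x \<in> I" "u = \<iota> x" "y \<in> I" "v = \<iota> y" by auto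
  then show "u + v \<in> \<iota> ` I" using I_closed(2)[of x y] I_le by (simp flip: \<iota>_simps)
next
  fix u v assume "u \<in> \<iota> ` I" "v \<in> \<iota> ` carrier A"
  then obtain x y where "x \<in> I" "u = \<iota> x" "y \<in> carrier A" "v = \<iota> y" by auto
  then show "u * v \<in> \<iota> ` I" "v * u \<in> \<iota> ` I"
    using I_closed(4,5)[of x y] I_le by (simp_all flip: \<iota>_simps)
qed

lemma closed_ideal_emb: "closed_ideal (\<iota> ` carrier A) (\<iota> \<one>) (\<iota> ` I)"
  using I closedin_iff_closed_emb[of I] I_le
  by unfold_locales (auto simp: two_sided_ideal_emb closed_ideals_def)

sublocale I: closed_ideal "\<iota> ` carrier A" "\<iota> \<one>" "\<iota> ` I" by (rule closed_ideal_emb)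

lemma emb_mem_I_iff: "x \<in> carrier A \<Longrightarrow> \<iota> x \<in> \<iota> ` I \<longleftrightarrow> x \<in> I"
  using I_le \<iota>_eq_iff by auto

lemma smult_I: "x \<in> I \<Longrightarrow> s \<odot> x \<in> I"
  using R.two_sided_ideal_scaleC[OF two_sided_ideal_emb, of "\<iota> x" s] I_le[of x] emb_mem_I_iff[of "s \<odot> x"]
  by (auto simp: \<iota>_simps)

lemma proj_smult: assumes "x \<in> carrier A" shows "proj (s \<odot> x) = s \<odot>\<^bsub>Q\<^esub> proj x"
proof -
  have "I +> (s \<odot> y) = proj (s \<odot> x)" if "y \<in> proj x" for y
  proof -
    have y: "y \<in> carrier A" "y \<ominus> x \<in> I" using that assms by (auto simp: mem_proj_iff)
    have "s \<odot> y \<ominus> s \<odot> x = s \<odot> (y \<ominus> x)"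
      using assms y by (subst \<iota>_eq_iff[symmetric]) (auto simp: \<iota>_simps scaleC_diff_right)
    then show ?thesis using smult_I[OF y(2), of s] proj_eq_iff[of "s \<odot> y" "s \<odot> x"] y assms
      by (simp add: quotient_proj_def)
  qed
  then show ?thesis using mem_proj_self[OF assms] by (auto simp: cstar_quotient_def)
qed

lemma cnorm_proj: assumes "x \<in> carrier A" shows "cnorm Q (proj x) = infdist (\<iota> x) (\<iota> ` I)"
proof -
  have "cnorm A ` proj x = dist (\<iota> x) ` (\<iota> ` I)" (is "?L = ?R")
  proof (intro subset_antisym subsetI)
    fix r assume "r \<in> ?L"
    then obtain y where y: "y \<in> carrier A" "y \<ominus> x \<in> I" "r = cnorm A y" using assms by (auto simp: mem_proj_iff)
    have "\<ominus> (y \<ominus> x) \<in> I" using I_closed(3) y(2) by blast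
    moreover have "r = dist (\<iota> x) (\<iota> (\<ominus> (y \<ominus> x)))" using y assms by (simp add: \<iota>_norm[symmetric] \<iota>_simps dist_norm)
    ultimately show "r \<in> ?R" by blast
  next
    fix r assume "r \<in> ?R"
    then obtain i where i: "i \<in> I" "r = dist (\<iota> x) (\<iota> i)" by auto
    have "(x \<ominus> i) \<ominus> x = \<ominus> i" using assms I_le[OF i(1)] by (subst \<iota>_eq_iff[symmetric]) (auto simp: \<iota>_simps)
    then have "x \<ominus> i \<in> proj x" using assms i I_le I_closed(3) by (auto simp: mem_proj_iff)
    moreover have "r = cnorm A (x \<ominus> i)" using assms i I_le by (simp add: \<iota>_norm[symmetric] \<iota>_simps dist_norm)
    ultimately show "r \<in> ?L" by blast
  qed
  then show ?thesis using I_closed(1) by (auto simp: cstar_quotient_def infdist_def)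
qed

lemma ring_Q: "ring Q"
proof -
  note QR = ideal.quotient_is_ring[OF ideal_I]
  show ?thesis
    by (rule ringI[OF abelian_groupI monoidI])
      (use ring.ring_simprules[OF QR] abelian_groupE(6)[OF ringE(1)[OF QR]] monoid.r_one[OF ringE(2)[OF QR]]
        in \<open>simp_all add: cstar_quotient_def\<close>)
qed

lemma abelian_group_Q: "abelian_group Q" using ring_Q by (simp add: ring_def)

lemma proj_uminus: assumes "x \<in> carrier A" shows "proj (\<ominus> x) = \<ominus>\<^bsub>Q\<^esub> proj x"
proof -
  have "proj (\<ominus> x) \<oplus>\<^bsub>Q\<^esub> proj x = \<zero>\<^bsub>Q\<^esub>"
    using assms proj_add[of "\<ominus> x" x] proj_zero abelian_group.l_neg[OF abelian_group_carrier assms]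
      abelian_group.a_inv_closed[OF abelian_group_carrier assms] by simp
  then show ?thesis
    using assms abelian_group.minus_equality[OF abelian_group_Q] abelian_group.a_inv_closed[OF abelian_group_carrier]
    by (metis proj_mem)
qed

lemma proj_minus: "x \<in> carrier A \<Longrightarrow> y \<in> carrier A \<Longrightarrow> proj (x \<ominus> y) = proj x \<ominus>\<^bsub>Q\<^esub> proj y"
  using abelian_group.a_inv_closed[OF abelian_group_carrier, of y]
  by (simp add: a_minus_def proj_add proj_uminus)

lemma cdist_proj: "x \<in> carrier A \<Longrightarrow> y \<in> carrier A \<Longrightarrow> cdist Q (proj x) (proj y) = infdist (\<iota> x - \<iota> y) (\<iota> ` I)"
  by (simp add: cdist_def proj_minus[symmetric] cnorm_proj \<iota>_simps)

lemma Metric_space_Q: "Metric_space (carrier Q) (cdist Q)"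
proof
  fix X Y
  show "0 \<le> cdist Q X Y"
  proof (cases "X \<in> carrier Q \<and> Y \<in> carrier Q")
    case True
    then show ?thesis by (auto simp: carrier_Q cdist_proj infdist_nonneg)
  qed (auto simp: cdist_def)
  have "infdist (u - v) (\<iota> ` I) = infdist (v - u) (\<iota> ` I)" for u v
    using I.quot_norm_scaleC[of "-1" "u - v"] by simp
  then show "cdist Q X Y = cdist Q Y X"
  proof (cases "X \<in> carrier Q \<and> Y \<in> carrier Q")
    case True
    then show ?thesis using \<open>\<And>u v. infdist (u - v) (\<iota> ` I) = infdist (v - u) (\<iota> ` I)\<close>
      by (auto simp: carrier_Q cdist_proj)
  qed (auto simp: cdist_def)
  show "cdist Q X Y = 0 \<longleftrightarrow> X = Y" if "X \<in> carrier Q" "Y \<in> carrier Q"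
  proof -
    obtain x y where xy: "x \<in> carrier A" "X = proj x" "y \<in> carrier A" "Y = proj y" using \<open>X \<in> carrier Q\<close> \<open>Y \<in> carrier Q\<close> by (auto simp: carrier_Q)
    have "cdist Q X Y = 0 \<longleftrightarrow> \<iota> (x \<ominus> y) \<in> \<iota> ` I" using xy I.quot_norm_eq_0[of "\<iota> x - \<iota> y"] by (simp add: cdist_proj \<iota>_simps)
    then show ?thesis using xy proj_eq_iff emb_mem_I_iff by simp
  qed
next
  fix X Y Z assume "X \<in> carrier Q" "Y \<in> carrier Q" "Z \<in> carrier Q"
  then obtain x y z where xyz: "x \<in> carrier A" "X = proj x" "y \<in> carrier A" "Y = proj y" "z \<in> carrier A" "Z = proj z"
    by (auto simp: carrier_Q)
  have "infdist (\<iota> x - \<iota> z) (\<iota> ` I) \<le> infdist (\<iota> x - \<iota> y) (\<iota> ` I) + infdist (\<iota> y - \<iota> z) (\<iota> ` I)"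
    using I.quot_norm_triangle[of "\<iota> x - \<iota> y" "\<iota> y - \<iota> z"] by simp
  then show "cdist Q X Z \<le> cdist Q X Y + cdist Q Y Z" using xyz by (simp add: cdist_proj)
qed

text \<open>Completeness of the quotient: along a subsequence with distances below \<open>2\<^sup>-\<^sup>n\<close>
  representatives can be chosen that form a Cauchy sequence themselves.\<close>

lemma mcomplete_Q: "Metric_space.mcomplete (carrier Q) (cdist Q)"
proof -
  interpret N: Metric_space "carrier Q" "cdist Q" by (rule Metric_space_Q)
  have "\<exists>L. limitin N.mtopology X L sequentially" if X: "N.MCauchy X" for X
  proof -
    have X_mem: "X n \<in> carrier Q" for n using X by (auto simp: N.MCauchy_def)
    have "\<forall>k. \<exists>N. \<forall>n\<ge>N. \<forall>m\<ge>N. cdist Q (X n) (X m) < (1/2) ^ k"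
    proof
      fix k
      have "\<forall>\<epsilon>>0. \<exists>N. \<forall>n m. N \<le> n \<longrightarrow> N \<le> m \<longrightarrow> cdist Q (X n) (X m) < \<epsilon>"
        using X by (simp add: N.MCauchy_def)
      moreover have "(0::real) < (1/2) ^ k" by simp
      ultimately have "\<exists>N. \<forall>n m. N \<le> n \<longrightarrow> N \<le> m \<longrightarrow> cdist Q (X n) (X m) < (1/2) ^ k"
        by (elim allE[of _ "(1/2) ^ k"] impE)
      then show "\<exists>N. \<forall>n\<ge>N. \<forall>m\<ge>N. cdist Q (X n) (X m) < (1/2) ^ k" by auto
    qed
    then obtain K where K: "\<And>k n m. n \<ge> K k \<Longrightarrow> m \<ge> K k \<Longrightarrow> cdist Q (X n) (X m) < (1/2) ^ k" by metis
    \<comment> \<open>strictly increasing and at least \<open>K k\<close>\<close>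
    define r where "r k = k + (\<Sum>i\<le>k. K i)" for k
    have r_mono: "strict_mono r" by (intro strict_monoI_Suc) (simp add: r_def)
    have "K k \<le> (\<Sum>i\<le>k. K i)" for k by (rule member_le_sum) auto
    then have K_le: "K k \<le> r k" for k unfolding r_def by (rule trans_le_add2)
    have r_fast: "cdist Q (X (r k)) (X (r (Suc k))) < (1/2) ^ k" for k
    proof (rule K)
      show "K k \<le> r k" by (rule K_le)
      also have "\<dots> \<le> r (Suc k)" using r_mono by (simp add: strict_mono_less_eq)
      finally show "K k \<le> r (Suc k)" .
    qed
    have "\<exists>x. \<forall>k. (x k \<in> carrier A \<and> proj (x k) = X (r k)) \<and> norm (\<iota> (x (Suc k)) - \<iota> (x k)) < (1/2) ^ k"
    proof (rule dependent_nat_choice)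
      show "\<exists>x. x \<in> carrier A \<and> proj x = X (r 0)" using X_mem[of "r 0"] by (auto simp: carrier_Q)
    next
      fix x k assume x: "x \<in> carrier A \<and> proj x = X (r k)"
      obtain y where y: "y \<in> carrier A" "proj y = X (r (Suc k))" using X_mem[of "r (Suc k)"] by (auto simp: carrier_Q)
      have "infdist (\<iota> y - \<iota> x) (\<iota> ` I) < (1/2) ^ k"
      proof -
        have "cdist Q (proj y) (proj x) = cdist Q (X (r k)) (X (r (Suc k)))"
          using x y N.commute[of "proj y" "proj x"] by simp
        then show ?thesis using r_fast[of k] x y(1) cdist_proj[of y x] by simp
      qed
      then obtain i where i: "i \<in> I" "norm (\<iota> y - \<iota> x - \<iota> i) < (1/2) ^ k"
        using I.quot_norm_approx[of "(1/2) ^ k - infdist (\<iota> y - \<iota> x) (\<iota> ` I)" "\<iota> y - \<iota> x"] by auto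
      have "proj (y \<ominus> i) = proj y"
      proof -
        have "(y \<ominus> i) \<ominus> y = \<ominus> i" using y I_le[OF i(1)] by (subst \<iota>_eq_iff[symmetric]) (auto simp: \<iota>_simps)
        then show ?thesis using y I_le[OF i(1)] I_closed(3)[OF i(1)] by (subst proj_eq_iff) auto
      qed
      moreover have "norm (\<iota> (y \<ominus> i) - \<iota> x) < (1/2) ^ k" using i y I_le by (simp add: \<iota>_simps algebra_simps)
      ultimately show "\<exists>y. (y \<in> carrier A \<and> proj y = X (r (Suc k))) \<and> norm (\<iota> y - \<iota> x) < (1/2) ^ k"
        using y I_le[OF i(1)] by (intro exI[of _ "y \<ominus> i"]) auto
    qed
    then obtain x where x: "\<And>k. x k \<in> carrier A" "\<And>k. proj (x k) = X (r k)"
      "\<And>k. norm (\<iota> (x (Suc k)) - \<iota> (x k)) < (1/2) ^ k" by metis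
    have tail: "norm (\<iota> (x (m + j)) - \<iota> (x m)) \<le> 2 * (1/2) ^ m - 2 * (1/2) ^ (m + j)" for m j
    proof (induction j)
      case (Suc j)
      have "norm (\<iota> (x (m + Suc j)) - \<iota> (x m)) \<le>
          norm (\<iota> (x (Suc (m + j))) - \<iota> (x (m + j))) + norm (\<iota> (x (m + j)) - \<iota> (x m))"
        using norm_triangle_ineq[of "\<iota> (x (Suc (m + j))) - \<iota> (x (m + j))" "\<iota> (x (m + j)) - \<iota> (x m)"] by simp
      then show ?case using Suc x(3)[of "m + j"] by simp
    qed simp
    have tail': "norm (\<iota> (x n) - \<iota> (x m)) \<le> 2 * (1/2) ^ m" if "m \<le> n" for m n
      using tail[of m "n - m"] that by (auto intro: order_trans)
    have "Cauchy (\<lambda>k. \<iota> (x k))"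
    proof (rule CauchyI')
      fix \<epsilon> :: real assume "\<epsilon> > 0"
      then obtain M where M: "(1/2) ^ M < \<epsilon> / 2" using real_arch_pow_inv[of "\<epsilon> / 2" "1/2"] by auto
      have "dist (\<iota> (x m)) (\<iota> (x n)) < \<epsilon>" if "m \<ge> M" "n > m" for m n
      proof -
        have "(1/2::real) ^ m \<le> (1/2) ^ M" using that by (intro power_decreasing) auto
        moreover have "dist (\<iota> (x m)) (\<iota> (x n)) \<le> 2 * (1/2) ^ m"
          using tail'[of m n] that by (simp add: dist_norm norm_minus_commute)
        ultimately show ?thesis using M by linarith
      qed
      then show "\<exists>M. \<forall>m\<ge>M. \<forall>n>m. dist (\<iota> (x m)) (\<iota> (x n)) < \<epsilon>" by blast
    qed
    moreover have "\<forall>k. \<iota> (x k) \<in> \<iota> ` carrier A" using x(1) by blast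
    ultimately obtain u where "u \<in> \<iota> ` carrier A" "(\<lambda>k. \<iota> (x k)) \<longlonglongrightarrow> u"
      using completeE[OF complete_emb] by metis
    then obtain l where l: "l \<in> carrier A" "(\<lambda>k. \<iota> (x k)) \<longlonglongrightarrow> \<iota> l" by blast
    have "limitin N.mtopology (X \<circ> r) (proj l) sequentially"
      unfolding N.limitin_metric_dist_null
    proof (intro conjI)
      have "(\<lambda>k. cdist Q (X (r k)) (proj l)) \<longlonglongrightarrow> 0"
      proof (rule tendsto_sandwich[OF _ _ tendsto_const])
        show "(\<lambda>k. norm (\<iota> (x k) - \<iota> l)) \<longlonglongrightarrow> 0" using l(2) by (intro tendsto_norm_zero LIM_zero)
        show "\<forall>\<^sub>F k in sequentially. cdist Q (X (r k)) (proj l) \<le> norm (\<iota> (x k) - \<iota> l)"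
          using x(1) l(1) I.quot_norm_le_norm by (simp add: x(2)[symmetric] cdist_proj)
      qed auto
      then show "(\<lambda>k. cdist Q ((X \<circ> r) k) (proj l)) \<longlonglongrightarrow> 0" by simp
    qed (use l X_mem in auto)
    then show ?thesis using N.MCauchy_convergent_subsequence[OF X r_mono] by blast
  qed
  then show ?thesis by (simp add: N.mcomplete_def)
qed

end

locale AF_ideal = cstar_ideal A I for A :: "'a cstar" (structure) and I +
  fixes U :: "nat \<Rightarrow> 'a set"
  assumes AF: "AF_sequence A U"
begin

lemma U_sub: "unital_cstar_subalgebra A (U n)" and U_fd: "finite_dimensional A (U n)"
  and U_Suc: "U n \<subseteq> U (Suc n)" and U_dense: "cstar_topology A closure_of (\<Union>n. U n) = carrier A"
  and U_0: "U 0 = {s \<odot> \<one> | s. True}"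
  using AF by (auto simp: AF_sequence_def)

lemma U_le: "U n \<subseteq> carrier A" using subalgebraD(1)[OF U_sub] .

lemma emb_U_dense: "\<iota> ` carrier A \<subseteq> closure (\<Union>n. \<iota> ` U n)"
proof -
  have "\<iota> x \<in> closure (\<iota> ` (\<Union>n. U n))" if "x \<in> carrier A" for x
    using closure_of_iff[of "\<Union>n. U n" x] U_dense U_le that by blast
  then show ?thesis by (auto simp: image_UN)
qed

lemma quot_norm_star: "x \<in> carrier A \<Longrightarrow> infdist (star (\<iota> x)) (\<iota> ` I) = infdist (\<iota> x) (\<iota> ` I)"
  and quot_norm_C: "x \<in> carrier A \<Longrightarrow> infdist (star (\<iota> x) * \<iota> x) (\<iota> ` I) = (infdist (\<iota> x) (\<iota> ` I))\<^sup>2"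
  by (rule I.quot_norm_star_AF[OF cstar_subalgebra_emb[OF U_sub] image_mono[OF U_le]
        finite_dimensional_emb[OF U_fd U_le] emb_U_dense]; blast)+

text \<open>The quotient norm vanishes exactly on \<open>I\<close> and is invariant under the adjoint.\<close>

lemma adj_I: "x \<in> I \<Longrightarrow> adj A x \<in> I"
  using quot_norm_star[of x] I.quot_norm_eq_0[of "\<iota> x"] I.quot_norm_eq_0[of "\<iota> (adj A x)"]
    emb_mem_I_iff[of x] emb_mem_I_iff[of "adj A x"] I_le[of x] by (simp add: \<iota>_simps)

lemma proj_adj: assumes "x \<in> carrier A" shows "proj (adj A x) = adj Q (proj x)"
proof -
  have "I +> adj A y = proj (adj A x)" if "y \<in> proj x" for y
  proof -
    have y: "y \<in> carrier A" "y \<ominus> x \<in> I" using that assms by (auto simp: mem_proj_iff)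
    have "adj A y \<ominus> adj A x = adj A (y \<ominus> x)"
      using assms y by (subst \<iota>_eq_iff[symmetric]) (auto simp: \<iota>_simps)
    then show ?thesis using adj_I[OF y(2)] proj_eq_iff[of "adj A y" "adj A x"] y assms
      by (simp add: quotient_proj_def)
  qed
  then show ?thesis using mem_proj_self[OF assms] by (auto simp: cstar_quotient_def)
qed

lemmas proj_simps = proj_add proj_mult proj_one proj_zero proj_uminus proj_minus proj_smult proj_adj

text \<open>The axioms are pulled back along the quotient map; the C*-identity is the one for the quotient norm.\<close>

lemma unital_cstar_Q: "unital_cstar Q"
proof -
  have module: "Module.module complex_ring Q"
  proof (rule moduleI[OF cring_complex_ring abelian_group_Q])
    fix s t X Y assume "X \<in> carrier Q" "Y \<in> carrier Q"
    then obtain x y where xy: "x \<in> carrier A" "X = proj x" "y \<in> carrier A" "Y = proj y" by (auto simp: carrier_Q)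
    show "s \<odot>\<^bsub>Q\<^esub> X \<in> carrier Q" "\<one>\<^bsub>complex_ring\<^esub> \<odot>\<^bsub>Q\<^esub> X = X"
      "s \<odot>\<^bsub>Q\<^esub> (X \<oplus>\<^bsub>Q\<^esub> Y) = s \<odot>\<^bsub>Q\<^esub> X \<oplus>\<^bsub>Q\<^esub> s \<odot>\<^bsub>Q\<^esub> Y"
      "(s \<oplus>\<^bsub>complex_ring\<^esub> t) \<odot>\<^bsub>Q\<^esub> X = s \<odot>\<^bsub>Q\<^esub> X \<oplus>\<^bsub>Q\<^esub> t \<odot>\<^bsub>Q\<^esub> X"
      "s \<otimes>\<^bsub>complex_ring\<^esub> t \<odot>\<^bsub>Q\<^esub> X = s \<odot>\<^bsub>Q\<^esub> (t \<odot>\<^bsub>Q\<^esub> X)"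
      using xy by (simp_all add: proj_smult[symmetric] proj_add[symmetric] smult_add_left smult_add_right smult_smult)
  qed
  show ?thesis
  proof (intro unital_cstar.intro ring_Q module unital_cstar_axioms.intro mcomplete_Q)
    fix X Y s assume "X \<in> carrier Q" "Y \<in> carrier Q"
    then obtain x y where xy: "x \<in> carrier A" "X = proj x" "y \<in> carrier A" "Y = proj y" by (auto simp: carrier_Q)
    show "(s \<odot>\<^bsub>Q\<^esub> X) \<otimes>\<^bsub>Q\<^esub> Y = s \<odot>\<^bsub>Q\<^esub> (X \<otimes>\<^bsub>Q\<^esub> Y)" "X \<otimes>\<^bsub>Q\<^esub> (s \<odot>\<^bsub>Q\<^esub> Y) = s \<odot>\<^bsub>Q\<^esub> (X \<otimes>\<^bsub>Q\<^esub> Y)"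
      "adj Q (X \<oplus>\<^bsub>Q\<^esub> Y) = adj Q X \<oplus>\<^bsub>Q\<^esub> adj Q Y" "adj Q (X \<otimes>\<^bsub>Q\<^esub> Y) = adj Q Y \<otimes>\<^bsub>Q\<^esub> adj Q X"
      using xy by (simp_all add: proj_simps(1,2,7,8)[symmetric] smult_mult_left smult_mult_right adj_add adj_mult)
    show "cnorm Q (X \<oplus>\<^bsub>Q\<^esub> Y) \<le> cnorm Q X + cnorm Q Y"
      using xy I.quot_norm_triangle by (simp add: proj_add[symmetric] cnorm_proj \<iota>_simps)
    show "cnorm Q (X \<otimes>\<^bsub>Q\<^esub> Y) \<le> cnorm Q X * cnorm Q Y"
      using xy I.quot_norm_mult by (simp add: proj_mult[symmetric] cnorm_proj \<iota>_simps)
  next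
    fix X s assume "X \<in> carrier Q"
    then obtain x where x: "x \<in> carrier A" "X = proj x" by (auto simp: carrier_Q)
    show "adj Q X \<in> carrier Q" "adj Q (adj Q X) = X" "adj Q (s \<odot>\<^bsub>Q\<^esub> X) = cnj s \<odot>\<^bsub>Q\<^esub> adj Q X"
      using x by (simp_all add: proj_simps(7,8)[symmetric] adj_adj adj_smult)
    show "cnorm Q X = 0 \<longleftrightarrow> X = \<zero>\<^bsub>Q\<^esub>"
    proof -
      have "x \<ominus> \<zero> = x" using x by (subst \<iota>_eq_iff[symmetric]) (auto simp: \<iota>_simps)
      then show ?thesis
        using x I.quot_norm_eq_0[of "\<iota> x"] emb_mem_I_iff[of x] proj_eq_iff[of x \<zero>]
        by (simp add: proj_zero[symmetric] cnorm_proj)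
    qed
    show "cnorm Q (s \<odot>\<^bsub>Q\<^esub> X) = cmod s * cnorm Q X"
      using x I.quot_norm_scaleC by (simp add: proj_smult[symmetric] cnorm_proj \<iota>_simps)
    show "cnorm Q (adj Q X \<otimes>\<^bsub>Q\<^esub> X) = (cnorm Q X)\<^sup>2"
      using x quot_norm_C by (simp add: proj_simps(2,8)[symmetric] cnorm_proj \<iota>_simps)
  qed
qed

end

section \<open>States and conditional expectations of records\<close>

context cstar_record
begin

abbreviation pull :: "('a \<Rightarrow> complex) \<Rightarrow> 'a cstar_product \<Rightarrow> complex" where
  "pull \<phi> u \<equiv> \<phi> (inv_into (carrier A) \<iota> u)"

lemma inj_emb: "inj_on \<iota> (carrier A)" using \<iota>_eq_iff by (auto simp: inj_on_def)

lemma pull_emb [simp]: "x \<in> carrier A \<Longrightarrow> pull \<phi> (\<iota> x) = \<phi> x"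
  by (simp add: inv_into_f_f[OF inj_emb])

lemma states_iff:
  "\<phi> \<in> states A \<longleftrightarrow> \<phi> \<in> extensional (carrier A) \<and>
     positive_functional (\<iota> ` carrier A) (\<iota> \<one>) (pull \<phi>) \<and> \<phi> \<one> = 1"
proof
  assume \<phi>: "\<phi> \<in> states A"
  have "positive_functional (\<iota> ` carrier A) (\<iota> \<one>) (pull \<phi>)"
  proof unfold_locales
    fix u v s assume "u \<in> \<iota> ` carrier A" "v \<in> \<iota> ` carrier A"
    then obtain x y where "x \<in> carrier A" "u = \<iota> x" "y \<in> carrier A" "v = \<iota> y" by auto
    then show "pull \<phi> (u + v) = pull \<phi> u + pull \<phi> v"
      using \<phi> by (simp flip: \<iota>_simps) (simp add: states_def)
  next
    fix u s assume "u \<in> \<iota> ` carrier A"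
    then obtain x where "x \<in> carrier A" "u = \<iota> x" by auto
    then show "pull \<phi> (s *\<^sub>C u) = s * pull \<phi> u" "pull \<phi> (star u * u) \<in> \<real>" "0 \<le> Re (pull \<phi> (star u * u))"
      using \<phi> by (simp_all flip: \<iota>_simps) (simp_all add: states_def)
  qed
  then show "\<phi> \<in> extensional (carrier A) \<and>
     positive_functional (\<iota> ` carrier A) (\<iota> \<one>) (pull \<phi>) \<and> \<phi> \<one> = 1"
    using \<phi> by (auto simp: states_def)
next
  assume *: "\<phi> \<in> extensional (carrier A) \<and>
     positive_functional (\<iota> ` carrier A) (\<iota> \<one>) (pull \<phi>) \<and> \<phi> \<one> = 1"
  then interpret P: positive_functional "\<iota> ` carrier A" "\<iota> \<one>" "pull \<phi>" by blast
  show "\<phi> \<in> states A"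
    unfolding states_def
  proof (intro CollectI conjI ballI allI)
    fix x y s assume x: "x \<in> carrier A" and y: "y \<in> carrier A"
    show "\<phi> (x \<oplus> y) = \<phi> x + \<phi> y" using P.functional_add[of "\<iota> x" "\<iota> y"] x y by (simp flip: \<iota>_simps)
  next
    fix x s assume x: "x \<in> carrier A"
    show "\<phi> (s \<odot> x) = s * \<phi> x" using P.functional_scaleC[of "\<iota> x" s] x by (simp flip: \<iota>_simps)
    show "\<phi> (adj A x \<otimes> x) \<in> \<real>" "0 \<le> Re (\<phi> (adj A x \<otimes> x))"
      using P.functional_real[of "\<iota> x"] P.functional_nonneg[of "\<iota> x"] x by (simp_all flip: \<iota>_simps)
  qed (use * in auto)
qed

lemma state_functional: "\<phi> \<in> states A \<Longrightarrow> positive_functional (\<iota> ` carrier A) (\<iota> \<one>) (pull \<phi>)"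
  using states_iff by blast

lemma state_one: "\<phi> \<in> states A \<Longrightarrow> \<phi> \<one> = 1" using states_iff by blast

lemma state_bounded: assumes "\<phi> \<in> states A" "x \<in> carrier A" shows "cmod (\<phi> x) \<le> cnorm A x"
  using positive_functional.functional_bounded[OF state_functional[OF assms(1)], of "\<iota> x"] assms
    state_one[OF assms(1)] by (simp add: \<iota>_norm)

lemma state_linear:
  assumes "\<phi> \<in> states A" "x \<in> carrier A" "y \<in> carrier A"
  shows "\<phi> (x \<oplus> y) = \<phi> x + \<phi> y" "\<phi> (x \<ominus> y) = \<phi> x - \<phi> y"
proof -
  interpret P: positive_functional "\<iota> ` carrier A" "\<iota> \<one>" "pull \<phi>" by (rule state_functional[OF assms(1)])
  show "\<phi> (x \<oplus> y) = \<phi> x + \<phi> y" "\<phi> (x \<ominus> y) = \<phi> x - \<phi> y"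
    using P.functional_add[of "\<iota> x" "\<iota> y"] P.functional_diff[of "\<iota> x" "\<iota> y"] assms
    by (simp_all flip: \<iota>_simps)
qed

lemma state_smult: "\<phi> \<in> states A \<Longrightarrow> x \<in> carrier A \<Longrightarrow> \<phi> (s \<odot> x) = s * \<phi> x"
  by (simp add: states_def)

lemma faithful_trace_emb:
  assumes "faithful_tracial_state A \<mu>"
  shows "faithful_trace (\<iota> ` carrier A) (\<iota> \<one>) (pull \<mu>)"
proof -
  have \<mu>: "\<mu> \<in> states A" using assms by (simp add: faithful_tracial_state_def)
  interpret positive_functional "\<iota> ` carrier A" "\<iota> \<one>" "pull \<mu>" by (rule state_functional[OF \<mu>])
  show ?thesis
  proof unfold_locales
    fix u v assume "u \<in> \<iota> ` carrier A" "v \<in> \<iota> ` carrier A"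
    then obtain x y where "x \<in> carrier A" "u = \<iota> x" "y \<in> carrier A" "v = \<iota> y" by auto
    then show "pull \<mu> (u * v) = pull \<mu> (v * u)"
      using assms by (simp flip: \<iota>_simps) (simp add: faithful_tracial_state_def)
  next
    fix u assume "u \<in> \<iota> ` carrier A" and 0: "pull \<mu> (star u * u) = 0"
    then obtain x where x: "x \<in> carrier A" "u = \<iota> x" by auto
    then have "\<mu> (adj A x \<otimes> x) = 0" using 0 by (simp flip: \<iota>_simps)
    then have "x = \<zero>" using assms x by (simp add: faithful_tracial_state_def)
    then show "u = 0" using x by (simp add: \<iota>_simps)
  qed (simp add: state_one[OF \<mu>])
qed

end

locale trace_record = cstar_record A for A :: "'a cstar" (structure) +
  fixes \<mu> :: "'a \<Rightarrow> complex"
  assumes tracial: "faithful_tracial_state A \<mu>"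
begin

sublocale T: faithful_trace "\<iota> ` carrier A" "\<iota> \<one>" "pull \<mu>" by (rule faithful_trace_emb[OF tracial])

lemma \<mu>_state: "\<mu> \<in> states A" using tracial by (simp add: faithful_tracial_state_def)

lemma one_ne_zero: "\<iota> \<one> \<noteq> 0"
proof
  assume "\<iota> \<one> = 0"
  then have "pull \<mu> (\<iota> \<one>) = 0" using T.functional_zero by metis
  then show False using T.trace_unit by simp
qed

end

locale expectation_record = trace_record A \<mu> for A :: "'a cstar" (structure) and \<mu> +
  fixes S :: "'a set"
  assumes sub: "unital_cstar_subalgebra A S" and fd: "finite_dimensional A S"
begin

lemmas S = subalgebraD[OF sub]

lemma finite_dim_expectation_emb: "finite_dim_expectation (\<iota> ` carrier A) (\<iota> \<one>) (pull \<mu>) (\<iota> ` S)"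
  by (intro finite_dim_expectation.intro T.faithful_trace_axioms finite_dim_expectation_axioms.intro
      cstar_subalgebra_emb[OF sub] image_mono S(1) finite_dimensional_emb[OF fd])

sublocale E: finite_dim_expectation "\<iota> ` carrier A" "\<iota> \<one>" "pull \<mu>" "\<iota> ` S"
  by (rule finite_dim_expectation_emb)

lemma S_le: "x \<in> S \<Longrightarrow> x \<in> carrier A" using S(1) by auto

definition expect_elem :: "'a \<Rightarrow> 'a" where
  "expect_elem = restrict (\<lambda>a. inv_into (carrier A) \<iota> (E.expect (\<iota> a))) (carrier A)"

lemma expect_elem: assumes "a \<in> carrier A"
  shows "expect_elem a \<in> S" "\<iota> (expect_elem a) = E.expect (\<iota> a)"
proof -
  obtain s where s: "s \<in> S" "E.expect (\<iota> a) = \<iota> s" using E.expect_mem[of "\<iota> a"] assms by auto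
  then have "expect_elem a = s" using assms S_le by (simp add: expect_elem_def inv_into_f_f[OF inj_emb])
  then show "expect_elem a \<in> S" "\<iota> (expect_elem a) = E.expect (\<iota> a)" using s by auto
qed

lemma conditional_expectation_expect_elem: "conditional_expectation A S expect_elem"
  unfolding conditional_expectation_def
proof (intro conjI ballI allI)
  note [simp] = expect_elem S_le \<iota>_simps
  show "expect_elem \<in> carrier A \<rightarrow>\<^sub>E S" using expect_elem by (auto simp: expect_elem_def)
  fix a b s assume a: "a \<in> carrier A"
  show "expect_elem (s \<odot> a) = s \<odot> expect_elem a"
    using a by (subst \<iota>_eq_iff[symmetric]) (auto simp: E.expect_scaleC)
  show "\<exists>b\<in>S. expect_elem (adj A a \<otimes> a) = adj A b \<otimes> b"
  proof -
    obtain u where u: "u \<in> \<iota> ` S" "star u = u" "u * u = E.expect (star (\<iota> a) * \<iota> a)"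
      using E.expect_square[of "\<iota> a"] a by blast
    then obtain b where b: "b \<in> S" "u = \<iota> b" by auto
    have "\<iota> (expect_elem (adj A a \<otimes> a)) = \<iota> (adj A b \<otimes> b)"
      using a b u by simp
    then show ?thesis using a b by (subst (asm) \<iota>_eq_iff) auto
  qed
  show "cnorm A (expect_elem a) \<le> cnorm A a"
    using a E.norm_expect_le[of "\<iota> a"] by (simp flip: \<iota>_norm)
next
  fix b assume b: "b \<in> S"
  then show "expect_elem b = b"
    using expect_elem[of b] E.expect_fix[of "\<iota> b"] S_le by (subst \<iota>_eq_iff[symmetric]) auto
next
  fix a b assume "a \<in> carrier A" "b \<in> carrier A"
  then show "expect_elem (a \<oplus> b) = expect_elem a \<oplus> expect_elem b"
    by (subst \<iota>_eq_iff[symmetric]) (auto simp: E.expect_add expect_elem S_le \<iota>_simps)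
next
  fix a b d assume "a \<in> carrier A" "b \<in> S" "d \<in> S"
  then show "expect_elem (b \<otimes> a \<otimes> d) = b \<otimes> expect_elem a \<otimes> d"
    by (subst \<iota>_eq_iff[symmetric]) (auto simp: E.expect_bimodule expect_elem S_le \<iota>_simps)
qed

text \<open>A trace-preserving conditional expectation is orthogonal for the trace, by its bimodule
  property; this characterises it.\<close>

lemma cond_exp_eq: "cond_exp A \<mu> S = expect_elem"
  unfolding cond_exp_def
proof (rule the_equality)
  show "conditional_expectation A S expect_elem \<and> (\<forall>a\<in>carrier A. \<mu> (expect_elem a) = \<mu> a)"
  proof (intro conjI ballI conditional_expectation_expect_elem)
    fix a assume a: "a \<in> carrier A"
    then have "pull \<mu> (\<iota> (expect_elem a)) = pull \<mu> (\<iota> a)"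
      using E.trace_expect[of "\<iota> a"] by (simp only: expect_elem \<iota>_mem)
    then show "\<mu> (expect_elem a) = \<mu> a" using a expect_elem(1)[OF a] S_le pull_emb by metis
  qed
next
  fix F assume F: "conditional_expectation A S F \<and> (\<forall>a\<in>carrier A. \<mu> (F a) = \<mu> a)"
  have F_mem: "F a \<in> S" if "a \<in> carrier A" for a using F that by (auto simp: conditional_expectation_def)
  show "F = expect_elem"
  proof
    fix a
    show "F a = expect_elem a"
    proof (cases "a \<in> carrier A")
      case True
      have "E.expect (\<iota> a) = \<iota> (F a)"
      proof (rule E.expect_eqI)
        fix u assume "u \<in> \<iota> ` S"
        then obtain s where s: "s \<in> S" "u = \<iota> s" by auto
        have "F (s \<otimes> a \<otimes> \<one>) = s \<otimes> F a \<otimes> \<one>"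
          using F s True S(3) unfolding conditional_expectation_def by blast
        moreover have "s \<otimes> a \<otimes> \<one> = s \<otimes> a" "s \<otimes> F a \<otimes> \<one> = s \<otimes> F a"
          using s True S_le F_mem by auto
        ultimately have "F (s \<otimes> a) = s \<otimes> F a" by simp
        moreover have "\<mu> (F (s \<otimes> a)) = \<mu> (s \<otimes> a)" using F s True S_le by auto
        ultimately have "\<mu> (s \<otimes> a) = \<mu> (s \<otimes> F a)" by simp
        then show "pull \<mu> (u * \<iota> a) = pull \<mu> (u * \<iota> (F a))"
          using s True S_le F_mem by (simp flip: \<iota>_simps)
      qed (use True F_mem in auto)
      then show ?thesis using True expect_elem F_mem S_le \<iota>_eq_iff by metis
    next
      case False
      then show ?thesis using F unfolding conditional_expectation_def expect_elem_def
        by (auto simp: PiE_def extensional_def)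
    qed
  qed
qed

lemma cond_exp_mem: "a \<in> carrier A \<Longrightarrow> cond_exp A \<mu> S a \<in> S"
  by (simp add: cond_exp_eq expect_elem)

lemma cond_exp_carrier: "a \<in> carrier A \<Longrightarrow> cond_exp A \<mu> S a \<in> carrier A"
  using cond_exp_mem S_le by blast

lemma emb_cond_exp: "a \<in> carrier A \<Longrightarrow> \<iota> (cond_exp A \<mu> S a) = E.expect (\<iota> a)"
  by (simp add: cond_exp_eq expect_elem)

lemma cond_exp_orth: assumes "a \<in> carrier A" "s \<in> S" shows "\<mu> (s \<otimes> cond_exp A \<mu> S a) = \<mu> (s \<otimes> a)"
  using E.expect_orth[of "\<iota> a" "\<iota> s"] assms S_le cond_exp_carrier[OF assms(1)]
  by (simp flip: emb_cond_exp \<iota>_simps)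

lemma cond_exp_eqI:
  assumes "a \<in> carrier A" "p \<in> S" "\<And>s. s \<in> S \<Longrightarrow> \<mu> (s \<otimes> a) = \<mu> (s \<otimes> p)"
  shows "cond_exp A \<mu> S a = p"
proof -
  have "E.expect (\<iota> a) = \<iota> p"
  proof (rule E.expect_eqI)
    fix u assume "u \<in> \<iota> ` S"
    then obtain s where "s \<in> S" "u = \<iota> s" by auto
    then show "pull \<mu> (u * \<iota> a) = pull \<mu> (u * \<iota> p)"
      using assms S_le by (simp flip: \<iota>_simps)
  qed (use assms in auto)
  then show ?thesis using emb_cond_exp[OF assms(1)] cond_exp_carrier[OF assms(1)] assms(2) S_le \<iota>_eq_iff by metis
qed

end

section \<open>AF algebras with a faithful trace as quantum compact metric spaces\<close>

locale AF_trace = trace_record A \<mu> for A :: "'a cstar" (structure) and \<mu> +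
  fixes V :: "nat \<Rightarrow> 'a set" and \<beta> :: "nat \<Rightarrow> real"
  assumes AF: "AF_sequence A V" and \<beta>_pos: "0 < \<beta> n" and \<beta>_tendsto: "\<beta> \<longlonglongrightarrow> 0"
begin

lemma V_sub: "unital_cstar_subalgebra A (V n)" and V_fd: "finite_dimensional A (V n)"
  and V_Suc: "V n \<subseteq> V (Suc n)" and V_dense: "cstar_topology A closure_of (\<Union>n. V n) = carrier A"
  and V_0: "V 0 = {s \<odot> \<one> | s. True}"
  using AF by (auto simp: AF_sequence_def)

lemma V_mono: "m \<le> n \<Longrightarrow> V m \<subseteq> V n"
  using V_Suc by (rule lift_Suc_mono_le)

lemma expectation_record_V: "expectation_record A \<mu> (V n)"
  by (intro expectation_record.intro trace_record_axioms expectation_record_axioms.intro V_sub V_fd)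

sublocale C: expectation_record A \<mu> "V n" for n by (rule expectation_record_V)

lemma V_le: "x \<in> V n \<Longrightarrow> x \<in> carrier A" by (rule C.S_le)

definition dev :: "nat \<Rightarrow> 'a \<Rightarrow> real" where
  "dev n a = cnorm A (a \<ominus> cond_exp A \<mu> (V n) a)"

abbreviation L :: "'a \<Rightarrow> ennreal" where "L \<equiv> AF_lip A V \<mu> \<beta>"

lemma L_eq: "L a = (SUP n. ennreal (dev n a / \<beta> n))"
  by (simp add: AF_lip_def dev_def)

lemma dev_emb: "a \<in> carrier A \<Longrightarrow> dev n a = norm (\<iota> a - C.E.expect n (\<iota> a))"
  by (simp add: dev_def \<iota>_norm[symmetric] \<iota>_simps C.cond_exp_carrier C.emb_cond_exp)

lemma dev_nonneg: "a \<in> carrier A \<Longrightarrow> 0 \<le> dev n a"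
  by (simp add: dev_emb)

lemma dev_add: "a \<in> carrier A \<Longrightarrow> b \<in> carrier A \<Longrightarrow> dev n (a \<oplus> b) \<le> dev n a + dev n b"
  using norm_triangle_ineq[of "\<iota> a - C.E.expect n (\<iota> a)" "\<iota> b - C.E.expect n (\<iota> b)"]
  by (simp add: dev_emb \<iota>_simps C.E.expect_add algebra_simps)

lemma dev_smult: "a \<in> carrier A \<Longrightarrow> dev n (s \<odot> a) = cmod s * dev n a"
  by (simp add: dev_emb \<iota>_simps C.E.expect_scaleC scaleC_diff_right[symmetric])

lemma dev_V: "m \<le> n \<Longrightarrow> a \<in> V m \<Longrightarrow> dev n a = 0"
  using V_mono[of m n] V_le[of a n] by (auto simp: dev_emb C.E.expect_fix)

lemma dev_mult:
  assumes "a \<in> carrier A" "b \<in> carrier A"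
  shows "dev n (a \<otimes> b) \<le> 2 * (dev n a * cnorm A b + cnorm A a * dev n b)"
  using C.E.expect_Leibniz[of "\<iota> a" "\<iota> b" n] assms by (simp add: dev_emb \<iota>_simps \<iota>_norm)

lemma L_leI: assumes "0 \<le> r" "\<And>n. dev n a \<le> r * \<beta> n" shows "L a \<le> ennreal r"
  unfolding L_eq by (rule SUP_least) (use assms \<beta>_pos in \<open>auto intro!: ennreal_leI simp: field_simps\<close>)

lemma dev_leD: assumes "L a \<le> ennreal r" "0 \<le> r" shows "dev n a \<le> r * \<beta> n"
proof -
  have "ennreal (dev n a / \<beta> n) \<le> ennreal r"
    using assms(1) unfolding L_eq by (meson SUP_upper UNIV_I order_trans)
  then show ?thesis using \<beta>_pos[of n] assms(2) by (simp add: field_simps)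
qed

lemma ennreal_dev_le_L: "ennreal (dev n a / \<beta> n) \<le> L a"
  unfolding L_eq by (rule SUP_upper) simp

text \<open>Only the first \<open>m\<close> deviations of an element of \<open>V m\<close> can be non-zero.\<close>

lemma L_V_finite: assumes "a \<in> V m" shows "L a < \<infinity>"
proof -
  have "L a \<le> (\<Sum>n<m. ennreal (dev n a / \<beta> n))"
    unfolding L_eq
  proof (rule SUP_least)
    fix n
    show "ennreal (dev n a / \<beta> n) \<le> (\<Sum>n<m. ennreal (dev n a / \<beta> n))"
    proof (cases "n < m")
      case True
      then show ?thesis by (intro member_le_sum) auto
    next
      case False
      then show ?thesis using dev_V[of m n a] assms by simp
    qed
  qed
  also have "\<dots> < \<infinity>" by simp
  finally show ?thesis .
qed

lemma L_add: "a \<in> carrier A \<Longrightarrow> b \<in> carrier A \<Longrightarrow> L (a \<oplus> b) \<le> L a + L b"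
  unfolding L_eq[of "a \<oplus> b"]
proof (rule SUP_least)
  fix n assume ab: "a \<in> carrier A" "b \<in> carrier A"
  have "dev n (a \<oplus> b) / \<beta> n \<le> dev n a / \<beta> n + dev n b / \<beta> n"
    using dev_add[OF ab] \<beta>_pos[of n] by (simp add: add_divide_distrib[symmetric] divide_right_mono)
  then have "ennreal (dev n (a \<oplus> b) / \<beta> n) \<le> ennreal (dev n a / \<beta> n) + ennreal (dev n b / \<beta> n)"
    using ab dev_nonneg \<beta>_pos by (subst ennreal_plus[symmetric]) (auto intro: divide_nonneg_pos ennreal_leI)
  also have "\<dots> \<le> L a + L b" by (intro add_mono ennreal_dev_le_L)
  finally show "ennreal (dev n (a \<oplus> b) / \<beta> n) \<le> L a + L b" .
qed

lemma L_smult: assumes "a \<in> carrier A" shows "L (complex_of_real t \<odot> a) = ennreal \<bar>t\<bar> * L a"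
proof -
  have "ennreal (dev n (complex_of_real t \<odot> a) / \<beta> n) = ennreal \<bar>t\<bar> * ennreal (dev n a / \<beta> n)" for n
    using assms dev_nonneg \<beta>_pos[of n] by (simp add: dev_smult ennreal_mult'[symmetric])
  then show ?thesis by (simp add: L_eq SUP_mult_left_ennreal)
qed

lemma saD: "a \<in> sa A \<Longrightarrow> a \<in> carrier A" by (simp add: sa_def)

lemma sa_iff: "a \<in> sa A \<longleftrightarrow> a \<in> carrier A \<and> star (\<iota> a) = \<iota> a"
  using \<iota>_eq_iff[of "adj A a" a] by (auto simp: sa_def \<iota>_simps)

lemma seminorm: "seminorm_on_sa A L"
  by (auto simp: seminorm_on_sa_def L_add L_smult saD)

lemma half_mem: "a \<in> carrier A \<Longrightarrow> b \<in> carrier A \<Longrightarrow> jordan_prod A a b \<in> carrier A \<and> lie_prod A a b \<in> carrier A"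
  by (simp add: jordan_prod_def lie_prod_def)

lemma ennreal_expand:
  "0 \<le> p \<Longrightarrow> 0 \<le> q \<Longrightarrow> 0 \<le> r \<Longrightarrow> 0 \<le> w \<Longrightarrow>
    ennreal (2 * (p * q + r * w)) = 2 * (ennreal p * ennreal q + ennreal r * ennreal w)"
  by (simp add: ennreal_mult ennreal_plus)

lemma L_Leibniz:
  assumes "a \<in> carrier A" "b \<in> carrier A"
  shows "max (L (jordan_prod A a b)) (L (lie_prod A a b))
      \<le> 2 * (ennreal (cnorm A a) * L b + ennreal (cnorm A b) * L a)"
proof -
  have bound: "L x \<le> 2 * (ennreal (cnorm A a) * L b + ennreal (cnorm A b) * L a)"
    if x: "\<And>n. dev n x \<le> (dev n (a \<otimes> b) + dev n (b \<otimes> a)) / 2" for x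
    unfolding L_eq[of x]
  proof (rule SUP_least)
    fix n
    have "dev n x \<le> 2 * (dev n a * cnorm A b + cnorm A a * dev n b)"
      using x[of n] dev_mult[OF assms, of n] dev_mult[OF assms(2,1), of n] by (simp add: algebra_simps)
    then have "dev n x / \<beta> n \<le> 2 * (dev n a * cnorm A b + cnorm A a * dev n b) / \<beta> n"
      using \<beta>_pos[of n] by (intro divide_right_mono) auto
    also have "\<dots> = 2 * (cnorm A a * (dev n b / \<beta> n) + cnorm A b * (dev n a / \<beta> n))"
      by (simp add: add_divide_distrib algebra_simps)
    finally have "ennreal (dev n x / \<beta> n) \<le> ennreal (2 * (cnorm A a * (dev n b / \<beta> n) + cnorm A b * (dev n a / \<beta> n)))"
      by (rule ennreal_leI)
    also have "\<dots> = 2 * (ennreal (cnorm A a) * ennreal (dev n b / \<beta> n) + ennreal (cnorm A b) * ennreal (dev n a / \<beta> n))"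
      using assms cnorm_nonneg dev_nonneg \<beta>_pos[of n] by (intro ennreal_expand) (auto intro: divide_nonneg_pos)
    also have "\<dots> \<le> 2 * (ennreal (cnorm A a) * L b + ennreal (cnorm A b) * L a)"
      by (intro mult_left_mono add_mono ennreal_dev_le_L) auto
    finally show "ennreal (dev n x / \<beta> n) \<le> 2 * (ennreal (cnorm A a) * L b + ennreal (cnorm A b) * L a)" .
  qed
  have "dev n (jordan_prod A a b) \<le> (dev n (a \<otimes> b) + dev n (b \<otimes> a)) / 2" for n
    using dev_add[of "a \<otimes> b" "b \<otimes> a" n] assms by (simp add: jordan_prod_def dev_smult)
  moreover have "dev n (lie_prod A a b) \<le> (dev n (a \<otimes> b) + dev n (b \<otimes> a)) / 2" for n
  proof -
    have "a \<otimes> b \<ominus> b \<otimes> a = a \<otimes> b \<oplus> (-1) \<odot> (b \<otimes> a)"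
      using assms by (subst \<iota>_eq_iff[symmetric]) (auto simp: \<iota>_simps)
    then have "dev n (a \<otimes> b \<ominus> b \<otimes> a) \<le> dev n (a \<otimes> b) + dev n (b \<otimes> a)"
      using dev_add[of "a \<otimes> b" "(-1) \<odot> (b \<otimes> a)" n] assms by (simp add: dev_smult)
    then show ?thesis using assms by (simp add: lie_prod_def dev_smult norm_divide norm_mult)
  qed
  ultimately show ?thesis using bound by simp
qed

lemma cnj_half_i: "cnj (1 / (2 * \<i>)) = - (1 / (2 * \<i>))"
  by (simp add: complex_eq_iff)

lemma jordan_lie_sa: assumes "a \<in> sa A" "b \<in> sa A" shows "jordan_prod A a b \<in> sa A" "lie_prod A a b \<in> sa A"
proof -
  have ab: "a \<in> carrier A" "b \<in> carrier A" "star (\<iota> a) = \<iota> a" "star (\<iota> b) = \<iota> b"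
    using assms by (auto simp: sa_iff)
  show "jordan_prod A a b \<in> sa A"
    using ab by (simp add: sa_iff jordan_prod_def \<iota>_simps add.commute)
  have "\<iota> (lie_prod A a b) = (1 / (2 * \<i>)) *\<^sub>C (\<iota> a * \<iota> b - \<iota> b * \<iota> a)"
    using ab by (simp add: lie_prod_def \<iota>_simps)
  moreover have "star (c *\<^sub>C (\<iota> a * \<iota> b - \<iota> b * \<iota> a)) = c *\<^sub>C (\<iota> a * \<iota> b - \<iota> b * \<iota> a)" if "cnj c = - c" for c
    using ab by (simp add: that scaleC_diff_right)
  ultimately have "star (\<iota> (lie_prod A a b)) = \<iota> (lie_prod A a b)" using cnj_half_i by metis
  then show "lie_prod A a b \<in> sa A" using ab half_mem by (simp add: sa_iff)
qed

lemma jordan_lie: "jordan_lie_subalgebra A (lip_domain A L)"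
  unfolding jordan_lie_subalgebra_def
proof (intro conjI ballI allI)
  show "lip_domain A L \<subseteq> sa A" by (auto simp: lip_domain_def)
  have "\<zero> \<in> V 0" using subalgebraD(2)[OF V_sub] .
  then show "\<zero> \<in> lip_domain A L" using L_V_finite[of \<zero> 0] by (auto simp: lip_domain_def sa_iff \<iota>_simps)
next
  fix a b assume "a \<in> lip_domain A L" "b \<in> lip_domain A L"
  then have ab: "a \<in> sa A" "b \<in> sa A" "L a < \<infinity>" "L b < \<infinity>" by (auto simp: lip_domain_def)
  have "L a + L b < \<infinity>" using ab by simp
  then have "L (a \<oplus> b) < \<infinity>" using L_add[of a b] ab saD by (meson le_less_trans)
  then show "a \<oplus> b \<in> lip_domain A L" using ab by (auto simp: lip_domain_def sa_iff \<iota>_simps)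
  have "2 * (ennreal (cnorm A a) * L b + ennreal (cnorm A b) * L a) < \<infinity>"
    using ab by (simp add: ennreal_mult_less_top)
  then have "max (L (jordan_prod A a b)) (L (lie_prod A a b)) < \<infinity>"
    using L_Leibniz[of a b] ab saD by (meson le_less_trans)
  then show "jordan_prod A a b \<in> lip_domain A L" "lie_prod A a b \<in> lip_domain A L"
    using jordan_lie_sa ab by (auto simp: lip_domain_def)
next
  fix t a assume "a \<in> lip_domain A L"
  then have a: "a \<in> sa A" "L a < \<infinity>" by (auto simp: lip_domain_def)
  have "L (complex_of_real t \<odot> a) < \<infinity>" using a L_smult[of a t] saD by (simp add: ennreal_mult_less_top)
  then show "complex_of_real t \<odot> a \<in> lip_domain A L" using a by (auto simp: lip_domain_def sa_iff \<iota>_simps)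
qed

lemma emb_V_dense: "x \<in> carrier A \<Longrightarrow> 0 < \<epsilon> \<Longrightarrow> \<exists>n. \<exists>y\<in>V n. norm (\<iota> x - \<iota> y) < \<epsilon>"
proof -
  assume x: "x \<in> carrier A" "0 < \<epsilon>"
  have "\<iota> x \<in> closure (\<iota> ` (\<Union>n. V n))"
    using closure_of_iff[of "\<Union>n. V n" x] V_dense V_le x by blast
  then obtain n y where y: "y \<in> V n" "dist (\<iota> y) (\<iota> x) < \<epsilon>"
    using x(2) unfolding closure_approachable by blast
  moreover have "norm (\<iota> x - \<iota> y) = dist (\<iota> y) (\<iota> x)" by (simp add: dist_norm norm_minus_commute)
  ultimately have "norm (\<iota> x - \<iota> y) < \<epsilon>" by simp
  then show ?thesis using y(1) by blast
qed

text \<open>Averaging with the adjoint turns an approximation by elements of the \<open>V n\<close> into one by self-adjoint elements.\<close>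

lemma lip_domain_dense_sa:
  assumes x: "x \<in> sa A" and "0 < \<epsilon>" shows "\<exists>y\<in>lip_domain A L. norm (\<iota> x - \<iota> y) < \<epsilon>"
proof -
  obtain n y where y: "y \<in> V n" "norm (\<iota> x - \<iota> y) < \<epsilon>" using emb_V_dense[OF saD[OF x] assms(2)] by blast
  define z where "z = (1/2) \<odot> (y \<oplus> adj A y)"
  have z: "z \<in> V n" using y subalgebraD[OF V_sub] by (auto simp: z_def)
  have yA: "y \<in> carrier A" using V_le y by blast
  have z_emb: "\<iota> z = (1/2) *\<^sub>C (\<iota> y + star (\<iota> y))" using yA by (simp add: z_def \<iota>_simps)
  have "z \<in> sa A" using V_le[OF z] by (simp add: sa_iff z_emb add.commute)
  then have "z \<in> lip_domain A L" using L_V_finite[OF z] by (simp add: lip_domain_def)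
  moreover have "norm (\<iota> x - \<iota> z) < \<epsilon>"
  proof -
    have "\<iota> x = (1/2) *\<^sub>C (\<iota> x + star (\<iota> x))"
    proof -
      have "(1/2) *\<^sub>C (\<iota> x + \<iota> x) = (1/2 + 1/2) *\<^sub>C \<iota> x" by (simp only: scaleC_add_left scaleC_add_right)
      then show ?thesis using x by (simp add: sa_iff)
    qed
    then have "\<iota> x - \<iota> z = (1/2) *\<^sub>C ((\<iota> x - \<iota> y) + star (\<iota> x - \<iota> y))"
      by (simp add: z_emb scaleC_diff_right scaleC_add_right)
    then have "norm (\<iota> x - \<iota> z) = norm ((\<iota> x - \<iota> y) + star (\<iota> x - \<iota> y)) / 2" by simp
    also have "\<dots> \<le> norm (\<iota> x - \<iota> y)"
      using norm_triangle_ineq[of "\<iota> x - \<iota> y" "star (\<iota> x - \<iota> y)"] norm_star[of "\<iota> x - \<iota> y"] by simp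
    finally show ?thesis using y by simp
  qed
  ultimately show ?thesis by blast
qed

lemma lip_domain_dense: "subtopology (cstar_topology A) (sa A) closure_of lip_domain A L = sa A"
proof -
  have le: "lip_domain A L \<subseteq> sa A" "lip_domain A L \<subseteq> carrier A" by (auto simp: lip_domain_def saD)
  have "x \<in> cstar_topology A closure_of lip_domain A L" if "x \<in> sa A" for x
    using closure_of_iff[OF le(2), of x] lip_domain_dense_sa[OF that] that saD
    by (auto simp: closure_approachable dist_norm norm_minus_commute)
  then show ?thesis using le(1) by (auto simp: closure_of_subtopology Int_absorb1)
qed

lemma L_kernel: "{a \<in> sa A. L a = 0} = {complex_of_real t \<odot> \<one> | t. True}"
proof (intro subset_antisym subsetI)
  fix a assume "a \<in> {a \<in> sa A. L a = 0}"
  then have a: "a \<in> sa A" "a \<in> carrier A" "L a = 0" by (auto simp: saD)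
  have "dev 0 a \<le> 0 * \<beta> 0" using a by (intro dev_leD) auto
  then have "\<iota> a = C.E.expect 0 (\<iota> a)" using a by (simp add: dev_emb)
  then have "\<iota> a = \<iota> (cond_exp A \<mu> (V 0) a)" using C.emb_cond_exp[OF a(2), of 0] by simp
  then have "a = cond_exp A \<mu> (V 0) a" using a C.cond_exp_carrier by (simp add: \<iota>_eq_iff)
  then have "a \<in> V 0" using C.cond_exp_mem[OF a(2)] by metis
  then obtain s where s: "a = s \<odot> \<one>" by (auto simp: V_0)
  have "cnj s *\<^sub>C \<iota> \<one> = s *\<^sub>C \<iota> \<one>" using a(1) by (simp add: sa_iff s \<iota>_simps R.star_unit)
  then have "(cnj s - s) *\<^sub>C \<iota> \<one> = 0" by (simp add: scaleC_diff_left)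
  then have "cmod (cnj s - s) * norm (\<iota> \<one>) = 0" by (metis norm_scaleC norm_zero)
  then have "cnj s = s" using one_ne_zero by simp
  then have "s = complex_of_real (Re s)" by (metis Reals_cnj_iff of_real_Re)
  then have "a = complex_of_real (Re s) \<odot> \<one>" using s by simp
  then show "a \<in> {complex_of_real t \<odot> \<one> | t. True}" by blast
next
  fix a assume "a \<in> {complex_of_real t \<odot> \<one> | t. True}"
  then obtain t where t: "a = complex_of_real t \<odot> \<one>" by auto
  have "a \<in> V 0" by (auto simp: V_0 t)
  then have "L a \<le> ennreal 0" using dev_V[of 0 _ a] by (intro L_leI) auto
  moreover have "a \<in> sa A" by (simp add: sa_iff t \<iota>_simps R.star_unit)
  ultimately show "a \<in> {a \<in> sa A. L a = 0}" by simp
qed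

lemma tendsto_dev:
  assumes "\<And>k. a k \<in> carrier A" "l \<in> carrier A" "(\<lambda>k. \<iota> (a k)) \<longlonglongrightarrow> \<iota> l"
  shows "(\<lambda>k. dev n (a k)) \<longlonglongrightarrow> dev n l"
proof -
  have "(\<lambda>k. C.E.expect n (\<iota> (a k))) \<longlonglongrightarrow> C.E.expect n (\<iota> l)"
    unfolding tendsto_iff
  proof (intro allI impI)
    fix r :: real assume "r > 0"
    then have "\<forall>\<^sub>F k in sequentially. dist (\<iota> (a k)) (\<iota> l) < r" using assms(3) by (simp add: tendsto_iff)
    then show "\<forall>\<^sub>F k in sequentially. dist (C.E.expect n (\<iota> (a k))) (C.E.expect n (\<iota> l)) < r"
    proof (rule eventually_mono)
      fix k assume *: "dist (\<iota> (a k)) (\<iota> l) < r"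
      have "norm (C.E.expect n (\<iota> (a k) - \<iota> l)) \<le> norm (\<iota> (a k) - \<iota> l)"
        using assms by (intro C.E.norm_expect_le R.mems) auto
      then show "dist (C.E.expect n (\<iota> (a k))) (C.E.expect n (\<iota> l)) < r"
        using * assms by (simp add: dist_norm C.E.expect_diff)
    qed
  qed
  then show ?thesis
    using assms by (simp add: dev_emb) (intro tendsto_intros)
qed

lemma L_lower_semicontinuous: "closedin (subtopology (cstar_topology A) (sa A)) {a \<in> sa A. L a \<le> r}"
proof (rule closedin_subset_topspace)
  have "closed (\<iota> ` {a \<in> sa A. L a \<le> r})"
    unfolding closed_sequential_limits
  proof (intro allI impI, elim conjE)
    fix y l assume y: "\<forall>k. y k \<in> \<iota> ` {a \<in> sa A. L a \<le> r}" and lim: "y \<longlonglongrightarrow> l"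
    have "\<forall>k. \<exists>a. a \<in> sa A \<and> L a \<le> r \<and> y k = \<iota> a" using y by blast
    then obtain a where a: "\<And>k. a k \<in> sa A" "\<And>k. L (a k) \<le> r" "\<And>k. y k = \<iota> (a k)" by metis
    have "\<forall>k. y k \<in> \<iota> ` carrier A" using a saD by blast
    then have "l \<in> \<iota> ` carrier A" using R.closed lim unfolding closed_sequential_limits by blast
    then obtain z where z: "z \<in> carrier A" "l = \<iota> z" by auto
    have lim': "(\<lambda>k. \<iota> (a k)) \<longlonglongrightarrow> \<iota> z" using lim unfolding z(2) ext[of y "\<lambda>k. \<iota> (a k)", OF a(3)] .
    have "(\<lambda>k. star (\<iota> (a k))) \<longlonglongrightarrow> star (\<iota> z)" by (rule tendsto_star[OF lim'])
    then have "star (\<iota> z) = \<iota> z" using a(1) lim' by (simp add: sa_iff LIMSEQ_unique)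
    then have "z \<in> sa A" using z by (simp add: sa_iff)
    moreover have "L z \<le> r" unfolding L_eq
    proof (rule SUP_least)
      fix n
      have "(\<lambda>k. ennreal (dev n (a k) / \<beta> n)) \<longlonglongrightarrow> ennreal (dev n z / \<beta> n)"
        using tendsto_dev[OF saD[OF a(1)] z(1) lim', of n] \<beta>_pos[of n]
        by (intro tendsto_ennrealI tendsto_divide tendsto_const) auto
      moreover have "ennreal (dev n (a k) / \<beta> n) \<le> r" for k
        using ennreal_dev_le_L[of n "a k"] a(2)[of k] by (rule order_trans)
      ultimately show "ennreal (dev n z / \<beta> n) \<le> r" by (intro LIMSEQ_le_const2) auto
    qed
    ultimately show "l \<in> \<iota> ` {a \<in> sa A. L a \<le> r}" using z by blast
  qed
  then show "closedin (cstar_topology A) {a \<in> sa A. L a \<le> r}"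
    by (subst closedin_iff_closed_emb) (auto simp: saD)
qed auto

lemma lip_ball_iff: "a \<in> lip_ball A L \<longleftrightarrow> a \<in> sa A \<and> (\<forall>n. dev n a \<le> \<beta> n)"
  using L_leI[of 1 a] dev_leD[of a 1] by (auto simp: lip_ball_def)

lemma lip_ball_carrier: "a \<in> lip_ball A L \<Longrightarrow> a \<in> carrier A" by (simp add: lip_ball_def saD)

lemma expect_0: assumes "a \<in> carrier A" obtains s where "C.E.expect 0 (\<iota> a) = s *\<^sub>C \<iota> \<one>"
proof -
  have "C.E.expect 0 (\<iota> a) \<in> \<iota> ` V 0" using assms by (intro C.E.expect_mem) auto
  then show ?thesis using that by (auto simp: V_0 \<iota>_simps)
qed

text \<open>States agree on scalars, so elements of the Lip ball need to be approximated modulo scalars only.\<close>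

lemma state_diff_scalar:
  assumes "\<phi> \<in> states A" "\<psi> \<in> states A" "a \<in> carrier A" "t \<in> carrier A"
    and "norm (\<iota> a - \<iota> t - s *\<^sub>C \<iota> \<one>) \<le> \<epsilon>"
  shows "cmod (\<phi> a - \<psi> a) \<le> 2 * \<epsilon> + cmod (\<phi> t - \<psi> t)"
proof -
  define x where "x = a \<ominus> t \<ominus> s \<odot> \<one>"
  have x: "x \<in> carrier A" "cnorm A x \<le> \<epsilon>" using assms by (auto simp: x_def \<iota>_norm[symmetric] \<iota>_simps)
  have "\<phi> x = \<phi> a - \<phi> t - s" "\<psi> x = \<psi> a - \<psi> t - s"
    using assms by (simp_all add: x_def state_linear state_smult state_one)
  then have "\<phi> a - \<psi> a = (\<phi> x - \<psi> x) + (\<phi> t - \<psi> t)" by simp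
  then have "cmod (\<phi> a - \<psi> a) \<le> cmod (\<phi> x - \<psi> x) + cmod (\<phi> t - \<psi> t)"
    using norm_triangle_ineq by metis
  also have "cmod (\<phi> x - \<psi> x) \<le> cmod (\<phi> x) + cmod (\<psi> x)" by (rule norm_triangle_ineq4)
  also have "\<dots> \<le> \<epsilon> + \<epsilon>"
    using state_bounded[OF assms(1) x(1)] state_bounded[OF assms(2) x(1)] x(2) by linarith
  finally show ?thesis by simp
qed

lemma state_diff_lip_ball:
  assumes "\<phi> \<in> states A" "\<psi> \<in> states A" "a \<in> lip_ball A L"
  shows "cmod (\<phi> a - \<psi> a) \<le> 2 * \<beta> 0"
proof -
  have a: "a \<in> carrier A" "dev 0 a \<le> \<beta> 0" using assms lip_ball_iff lip_ball_carrier by auto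
  obtain s where s: "C.E.expect 0 (\<iota> a) = s *\<^sub>C \<iota> \<one>" using expect_0[OF a(1)] .
  have "norm (\<iota> a - \<iota> \<zero> - s *\<^sub>C \<iota> \<one>) \<le> \<beta> 0"
    using a s by (simp add: \<iota>_simps dev_emb)
  then have "cmod (\<phi> a - \<psi> a) \<le> 2 * \<beta> 0 + cmod (\<phi> \<zero> - \<psi> \<zero>)"
    using assms a by (intro state_diff_scalar) auto
  moreover have "\<phi> \<zero> = 0" "\<psi> \<zero> = 0"
    using state_bounded[OF assms(1), of \<zero>] state_bounded[OF assms(2), of \<zero>] by auto
  ultimately show ?thesis by simp
qed

definition mk_real :: "('a \<Rightarrow> complex) \<Rightarrow> ('a \<Rightarrow> complex) \<Rightarrow> real" where
  "mk_real \<phi> \<psi> = enn2real (mk A L \<phi> \<psi>)"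

lemma mk_finite: assumes "\<phi> \<in> states A" "\<psi> \<in> states A" shows "mk A L \<phi> \<psi> < \<infinity>"
proof -
  have "mk A L \<phi> \<psi> \<le> ennreal (2 * \<beta> 0)"
    unfolding mk_def by (rule SUP_least) (use assms state_diff_lip_ball in \<open>auto intro: ennreal_leI\<close>)
  then show ?thesis by (rule le_less_trans) simp
qed

lemma mk_real_upper:
  assumes "\<phi> \<in> states A" "\<psi> \<in> states A" "a \<in> lip_ball A L" shows "cmod (\<phi> a - \<psi> a) \<le> mk_real \<phi> \<psi>"
proof -
  have "ennreal (cmod (\<phi> a - \<psi> a)) \<le> mk A L \<phi> \<psi>" unfolding mk_def by (rule SUP_upper[OF assms(3)])
  also have "\<dots> = ennreal (mk_real \<phi> \<psi>)" using mk_finite[OF assms(1,2)] by (simp add: mk_real_def)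
  finally show ?thesis by (simp add: mk_real_def)
qed

lemma mk_real_least:
  assumes "0 \<le> K" "\<And>a. a \<in> lip_ball A L \<Longrightarrow> cmod (\<phi> a - \<psi> a) \<le> K" shows "mk_real \<phi> \<psi> \<le> K"
  unfolding mk_real_def mk_def
  by (intro enn2real_leI assms(1) SUP_least ennreal_leI assms(2))

text \<open>Approximate \<open>x\<close> by \<open>y\<close> in the domain of \<open>L\<close> and scale \<open>y\<close> into the Lip ball.\<close>

lemma mk_controls_sa:
  assumes "x \<in> sa A" "0 < \<epsilon>"
  shows "\<exists>\<delta>>0. \<forall>\<phi>\<in>states A. \<forall>\<psi>\<in>states A. mk_real \<phi> \<psi> < \<delta> \<longrightarrow> cmod (\<phi> x - \<psi> x) < \<epsilon>"
proof -
  obtain y where y: "y \<in> lip_domain A L" "norm (\<iota> x - \<iota> y) < \<epsilon> / 4"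
    using lip_domain_dense_sa[OF assms(1), of "\<epsilon> / 4"] assms(2) by auto
  have yA: "y \<in> sa A" "y \<in> carrier A" "L y < \<infinity>" using y by (auto simp: lip_domain_def saD)
  define r where "r = enn2real (L y) + 1"
  have r: "r > 0" by (simp add: r_def add_nonneg_pos)
  have "L y \<le> ennreal r" using yA(3) by (simp add: r_def ennreal_plus)
  define z where "z = complex_of_real (1 / r) \<odot> y"
  have z: "z \<in> lip_ball A L"
  proof -
    have "ennreal \<bar>1 / r\<bar> * L y \<le> ennreal (1 / r) * ennreal r"
      using r \<open>L y \<le> ennreal r\<close> by (intro mult_mono) auto
    also have "\<dots> = 1" using r by (simp flip: ennreal_mult')
    finally have "L z \<le> 1" using L_smult[OF yA(2), of "1 / r"] by (simp add: z_def)
    then show ?thesis using yA by (auto simp: lip_ball_def z_def sa_iff \<iota>_simps)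
  qed
  have "cmod (\<phi> x - \<psi> x) < \<epsilon>"
    if st: "\<phi> \<in> states A" "\<psi> \<in> states A" and small: "mk_real \<phi> \<psi> < \<epsilon> / (2 * r)" for \<phi> \<psi>
  proof -
    have "\<phi> z - \<psi> z = complex_of_real (1 / r) * (\<phi> y - \<psi> y)"
      using st yA by (simp add: z_def state_linear state_smult right_diff_distrib)
    then have "cmod (\<phi> y - \<psi> y) = r * cmod (\<phi> z - \<psi> z)" using r by (simp add: norm_mult norm_divide)
    also have "\<dots> \<le> r * mk_real \<phi> \<psi>" using mk_real_upper[OF st z] r by (intro mult_left_mono) auto
    also have "\<dots> < \<epsilon> / 2" using small r by (simp add: field_simps)
    finally have "cmod (\<phi> y - \<psi> y) < \<epsilon> / 2" .
    moreover have "cmod (\<phi> x - \<psi> x) \<le> 2 * (\<epsilon> / 4) + cmod (\<phi> y - \<psi> y)"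
      using st yA saD[OF assms(1)] y(2) by (intro state_diff_scalar[where s = 0]) auto
    ultimately show ?thesis by simp
  qed
  then show ?thesis using r assms(2) by (intro exI[of _ "\<epsilon> / (2 * r)"]) auto
qed

lemma sa_decomp:
  assumes "x \<in> carrier A" obtains h k where "h \<in> sa A" "k \<in> sa A" "x = h \<oplus> \<i> \<odot> k"
proof
  show "(1/2) \<odot> (x \<oplus> adj A x) \<in> sa A" using assms by (simp add: sa_iff \<iota>_simps add.commute)
  have "\<iota> ((1 / (2 * \<i>)) \<odot> (x \<ominus> adj A x)) = (1 / (2 * \<i>)) *\<^sub>C (\<iota> x - star (\<iota> x))"
    using assms by (simp add: \<iota>_simps)
  moreover have "star (c *\<^sub>C (\<iota> x - star (\<iota> x))) = c *\<^sub>C (\<iota> x - star (\<iota> x))" if "cnj c = - c" for c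
    by (simp add: that scaleC_diff_right)
  ultimately have "star (\<iota> ((1 / (2 * \<i>)) \<odot> (x \<ominus> adj A x))) = \<iota> ((1 / (2 * \<i>)) \<odot> (x \<ominus> adj A x))"
    using cnj_half_i by metis
  then show "(1 / (2 * \<i>)) \<odot> (x \<ominus> adj A x) \<in> sa A"
    using assms by (simp add: sa_iff)
  have "\<iota> x = (1/2 + 1/2) *\<^sub>C \<iota> x" by simp
  then have "\<iota> x = (1/2) *\<^sub>C (\<iota> x + star (\<iota> x)) + (1/2) *\<^sub>C (\<iota> x - star (\<iota> x))"
    by (simp only: scaleC_add_left scaleC_add_right scaleC_diff_right) simp
  then show "x = (1/2) \<odot> (x \<oplus> adj A x) \<oplus> \<i> \<odot> ((1 / (2 * \<i>)) \<odot> (x \<ominus> adj A x))"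
    using assms by (subst \<iota>_eq_iff[symmetric]) (auto simp: \<iota>_simps)
qed

lemma mk_controls:
  assumes "x \<in> carrier A" "0 < \<epsilon>"
  shows "\<exists>\<delta>>0. \<forall>\<phi>\<in>states A. \<forall>\<psi>\<in>states A. mk_real \<phi> \<psi> < \<delta> \<longrightarrow> cmod (\<phi> x - \<psi> x) < \<epsilon>"
proof -
  obtain h k where hk: "h \<in> sa A" "k \<in> sa A" "x = h \<oplus> \<i> \<odot> k" using sa_decomp[OF assms(1)] .
  obtain \<delta> where \<delta>: "\<delta> > 0" "\<And>\<phi> \<psi>. \<phi> \<in> states A \<Longrightarrow> \<psi> \<in> states A \<Longrightarrow> mk_real \<phi> \<psi> < \<delta> \<Longrightarrow> cmod (\<phi> h - \<psi> h) < \<epsilon> / 2"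
    using mk_controls_sa[OF hk(1), of "\<epsilon> / 2"] assms(2) by (metis half_gt_zero)
  obtain \<delta>' where \<delta>': "\<delta>' > 0" "\<And>\<phi> \<psi>. \<phi> \<in> states A \<Longrightarrow> \<psi> \<in> states A \<Longrightarrow> mk_real \<phi> \<psi> < \<delta>' \<Longrightarrow> cmod (\<phi> k - \<psi> k) < \<epsilon> / 2"
    using mk_controls_sa[OF hk(2), of "\<epsilon> / 2"] assms(2) by (metis half_gt_zero)
  have "cmod (\<phi> x - \<psi> x) < \<epsilon>"
    if st: "\<phi> \<in> states A" "\<psi> \<in> states A" and small: "mk_real \<phi> \<psi> < min \<delta> \<delta>'" for \<phi> \<psi>
  proof -
    have "\<phi> x - \<psi> x = (\<phi> h - \<psi> h) + \<i> * (\<phi> k - \<psi> k)"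
      using st hk saD by (simp add: state_linear state_smult algebra_simps)
    then have "cmod (\<phi> x - \<psi> x) \<le> cmod (\<phi> h - \<psi> h) + cmod (\<phi> k - \<psi> k)"
      using norm_triangle_ineq[of "\<phi> h - \<psi> h" "\<i> * (\<phi> k - \<psi> k)"] by (simp add: norm_mult)
    then show ?thesis using \<delta>(2)[OF st] \<delta>'(2)[OF st] small by simp
  qed
  then show ?thesis using \<delta>(1) \<delta>'(1) by (intro exI[of _ "min \<delta> \<delta>'"]) auto
qed

lemma Metric_space_mk: "Metric_space (states A) mk_real"
proof
  fix \<phi> \<psi> \<theta>
  show "0 \<le> mk_real \<phi> \<psi>" by (simp add: mk_real_def)
  show "mk_real \<phi> \<psi> = mk_real \<psi> \<phi>" by (simp add: mk_real_def mk_def norm_minus_commute)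
  show "mk_real \<phi> \<psi> = 0 \<longleftrightarrow> \<phi> = \<psi>" if st: "\<phi> \<in> states A" "\<psi> \<in> states A"
  proof
    assume 0: "mk_real \<phi> \<psi> = 0"
    have "\<phi> x = \<psi> x" if x: "x \<in> carrier A" for x
    proof (rule ccontr)
      assume "\<phi> x \<noteq> \<psi> x"
      then have "0 < cmod (\<phi> x - \<psi> x)" by simp
      from mk_controls[OF x this] st 0 show False by fastforce
    qed
    moreover have "\<phi> \<in> extensional (carrier A)" "\<psi> \<in> extensional (carrier A)" using st states_iff by auto
    ultimately show "\<phi> = \<psi>" by (intro extensionalityI) auto
  next
    assume "\<phi> = \<psi>"
    have "mk_real \<phi> \<psi> \<le> 0" by (rule mk_real_least) (auto simp: \<open>\<phi> = \<psi>\<close>)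
    then show "mk_real \<phi> \<psi> = 0" by (simp add: mk_real_def order_antisym)
  qed
  assume st: "\<phi> \<in> states A" "\<psi> \<in> states A" "\<theta> \<in> states A"
  show "mk_real \<phi> \<theta> \<le> mk_real \<phi> \<psi> + mk_real \<psi> \<theta>"
  proof (rule mk_real_least)
    fix a assume a: "a \<in> lip_ball A L"
    show "cmod (\<phi> a - \<theta> a) \<le> mk_real \<phi> \<psi> + mk_real \<psi> \<theta>"
      using norm_triangle_ineq[of "\<phi> a - \<psi> a" "\<psi> a - \<theta> a"] mk_real_upper[OF st(1,2) a] mk_real_upper[OF st(2,3) a]
      by simp
  qed (simp add: mk_real_def)
qed

text \<open>Modulo scalars the Lip ball is totally bounded: it is uniformly approximated by bounded
  subsets of the finite-dimensional algebras \<open>V n\<close>.\<close>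

lemma lip_ball_net:
  assumes "0 < \<epsilon>"
  shows "\<exists>T. finite T \<and> T \<subseteq> carrier A \<and> (\<forall>a\<in>lip_ball A L. \<exists>t\<in>T. \<exists>s. norm (\<iota> a - \<iota> t - s *\<^sub>C \<iota> \<one>) \<le> \<epsilon>)"
proof -
  obtain n where n: "\<beta> n < \<epsilon> / 2"
    using order_tendstoD(2)[OF \<beta>_tendsto, of "\<epsilon> / 2"] assms by (auto simp: eventually_sequentially)
  obtain G where G: "finite G" "G \<subseteq> \<iota> ` V n" "span G = \<iota> ` V n" by (rule C.E.finite_basis)
  let ?K = "{u \<in> span G. norm u \<le> \<beta> 0}"
  obtain k where k: "finite k" "k \<subseteq> ?K" "?K \<subseteq> (\<Union>x\<in>k. ball x (\<epsilon> / 2))"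
    using seq_compact_imp_totally_bounded[OF compact_imp_seq_compact[OF compact_bounded_span_finite[OF G(1)]]]
      half_gt_zero[OF assms] by meson
  have "k \<subseteq> \<iota> ` V n" using k(2) G(3) by blast
  then obtain T where T: "finite T" "T \<subseteq> V n" "k = \<iota> ` T" using k(1) finite_subset_image by metis
  have "\<exists>t\<in>T. \<exists>s. norm (\<iota> a - \<iota> t - s *\<^sub>C \<iota> \<one>) \<le> \<epsilon>" if a: "a \<in> lip_ball A L" for a
  proof -
    have aA: "a \<in> carrier A" "\<And>m. dev m a \<le> \<beta> m" using a lip_ball_iff lip_ball_carrier by auto
    obtain s where s: "C.E.expect 0 (\<iota> a) = s *\<^sub>C \<iota> \<one>" using expect_0[OF aA(1)] .
    define b where "b = \<iota> a - s *\<^sub>C \<iota> \<one>"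
    have b: "b \<in> \<iota> ` carrier A" using aA by (auto simp: b_def intro!: R.mems)
    have "norm b \<le> \<beta> 0" using aA(2)[of 0] aA(1) s by (simp add: b_def dev_emb)
    then have "norm (C.E.expect n b) \<le> \<beta> 0" using C.E.norm_expect_le[OF b] order_trans by blast
    then have "C.E.expect n b \<in> ?K" using C.E.expect_mem[OF b] G(3) by auto
    then obtain u where u: "u \<in> k" "C.E.expect n b \<in> ball u (\<epsilon> / 2)" using k(3) by blast
    then obtain t where t: "t \<in> T" "norm (C.E.expect n b - \<iota> t) < \<epsilon> / 2"
      using T(3) by (auto simp: dist_norm norm_minus_commute)
    have "s *\<^sub>C \<iota> \<one> \<in> \<iota> ` V n" by (intro C.E.S.mems)
    then have "C.E.expect n b = C.E.expect n (\<iota> a) - s *\<^sub>C \<iota> \<one>"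
      unfolding b_def using aA(1) by (simp add: C.E.expect_diff C.E.expect_fix R.mems)
    then have "\<iota> a - \<iota> t - s *\<^sub>C \<iota> \<one> = (\<iota> a - C.E.expect n (\<iota> a)) + (C.E.expect n b - \<iota> t)" by simp
    then have "norm (\<iota> a - \<iota> t - s *\<^sub>C \<iota> \<one>) \<le> dev n a + norm (C.E.expect n b - \<iota> t)"
      using norm_triangle_ineq aA(1) by (metis dev_emb)
    also have "\<dots> \<le> \<epsilon>" using aA(2)[of n] n t(2) by simp
    finally show ?thesis using t(1) by blast
  qed
  then show ?thesis using T(1,2) V_le by (intro exI[of _ T]) auto
qed

lemma topspace_weak_star: "topspace (weak_star_topology A) = states A"
  by (auto simp: weak_star_topology_def states_def PiE_def)

lemma continuous_map_eval: "x \<in> carrier A \<Longrightarrow> continuous_map (weak_star_topology A) euclidean (\<lambda>\<phi>. \<phi> x)"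
  unfolding weak_star_topology_def
  using continuous_map_product_projection[of x "carrier A" "\<lambda>_. euclidean"]
  by (rule continuous_map_from_subtopology)

text \<open>Evaluation maps are continuous for the metric by \<open>mk_controls\<close>. Conversely, closeness on a finite net of
  the Lip ball is a weak-* open condition and bounds the metric.\<close>

lemma metrizes: "metrizes_by (weak_star_topology A) (mk A L)"
proof -
  interpret N: Metric_space "states A" mk_real by (rule Metric_space_mk)
  have "openin N.mtopology S" if S: "openin (weak_star_topology A) S" for S
  proof -
    obtain T where T: "openin (product_topology (\<lambda>_. euclidean) (carrier A)) T" "S = T \<inter> states A"
      using S by (auto simp: weak_star_topology_def openin_subtopology)
    have coord: "continuous_map N.mtopology euclidean (\<lambda>\<phi>. \<phi> x)" if x: "x \<in> carrier A" for x
      unfolding continuous_map_def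
    proof (intro conjI allI impI)
      fix W :: "complex set" assume "openin euclidean W"
      then have W: "open W" by simp
      show "openin N.mtopology {\<phi> \<in> topspace N.mtopology. \<phi> x \<in> W}"
        unfolding N.openin_mtopology
      proof (intro conjI allI impI)
        fix \<phi> assume "\<phi> \<in> {\<phi> \<in> topspace N.mtopology. \<phi> x \<in> W}"
        then have \<phi>: "\<phi> \<in> states A" "\<phi> x \<in> W" by auto
        obtain \<epsilon> where \<epsilon>: "\<epsilon> > 0" "\<And>z. dist z (\<phi> x) < \<epsilon> \<Longrightarrow> z \<in> W" using W \<phi>(2) open_dist by blast
        obtain \<delta> where \<delta>: "\<delta> > 0" "\<forall>\<phi>\<in>states A. \<forall>\<psi>\<in>states A. mk_real \<phi> \<psi> < \<delta> \<longrightarrow> cmod (\<phi> x - \<psi> x) < \<epsilon>"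
          using mk_controls[OF x \<epsilon>(1)] by blast
        have "N.mball \<phi> \<delta> \<subseteq> {\<phi> \<in> topspace N.mtopology. \<phi> x \<in> W}"
          using \<delta>(2) \<phi>(1) \<epsilon>(2) by (auto simp: N.in_mball dist_norm norm_minus_commute)
        then show "\<exists>r>0. N.mball \<phi> r \<subseteq> {\<phi> \<in> topspace N.mtopology. \<phi> x \<in> W}" using \<delta>(1) by blast
      qed auto
    qed auto
    have "continuous_map N.mtopology (product_topology (\<lambda>_. euclidean) (carrier A)) (\<lambda>\<phi>. \<phi>)"
      unfolding continuous_map_componentwise using coord states_iff by auto
    from openin_continuous_map_preimage[OF this T(1)] show ?thesis
      using T(2) by (simp add: Int_def conj_commute)
  qed
  moreover have "openin (weak_star_topology A) S" if S: "openin N.mtopology S" for S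
    unfolding openin_subopen[of _ S]
  proof
    fix \<phi> assume "\<phi> \<in> S"
    then obtain r where r: "r > 0" "N.mball \<phi> r \<subseteq> S" and \<phi>: "\<phi> \<in> states A"
      using S unfolding N.openin_mtopology by blast
    obtain T where T: "finite T" "T \<subseteq> carrier A"
      "\<And>a. a \<in> lip_ball A L \<Longrightarrow> \<exists>t\<in>T. \<exists>s. norm (\<iota> a - \<iota> t - s *\<^sub>C \<iota> \<one>) \<le> r / 8"
      using lip_ball_net[of "r / 8"] r(1) by auto
    let ?O = "(\<Inter>t\<in>T. {\<psi> \<in> topspace (weak_star_topology A). \<psi> t \<in> ball (\<phi> t) (r / 4)}) \<inter> topspace (weak_star_topology A)"
    have "openin (weak_star_topology A) ?O"
      using T(1,2) by (intro openin_INT openin_continuous_map_preimage[OF continuous_map_eval]) auto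
    moreover have "\<phi> \<in> ?O" using \<phi> r(1) by (auto simp: topspace_weak_star)
    moreover have "?O \<subseteq> N.mball \<phi> r"
    proof
      fix \<psi> assume "\<psi> \<in> ?O"
      then have \<psi>: "\<psi> \<in> states A" "\<And>t. t \<in> T \<Longrightarrow> cmod (\<phi> t - \<psi> t) < r / 4"
        by (auto simp: topspace_weak_star dist_norm)
      have "mk_real \<phi> \<psi> \<le> r / 2"
      proof (rule mk_real_least)
        fix a assume a: "a \<in> lip_ball A L"
        obtain t s where ts: "t \<in> T" "norm (\<iota> a - \<iota> t - s *\<^sub>C \<iota> \<one>) \<le> r / 8" using T(3)[OF a] by blast
        have "cmod (\<phi> a - \<psi> a) \<le> 2 * (r / 8) + cmod (\<phi> t - \<psi> t)"
          using \<phi> \<psi>(1) lip_ball_carrier[OF a] ts T(2) by (intro state_diff_scalar) auto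
        then show "cmod (\<phi> a - \<psi> a) \<le> r / 2" using \<psi>(2)[OF ts(1)] by simp
      qed (use r in simp)
      then show "\<psi> \<in> N.mball \<phi> r" using \<phi> \<psi>(1) r(1) by (simp add: N.in_mball)
    qed
    ultimately show "\<exists>T. openin (weak_star_topology A) T \<and> \<phi> \<in> T \<and> T \<subseteq> S" using r(2) by blast
  qed
  ultimately have "N.mtopology = weak_star_topology A" by (auto simp: topology_eq)
  then show ?thesis
    using Metric_space_mk mk_finite unfolding metrizes_by_def topspace_weak_star mk_real_def[abs_def] by auto
qed

theorem QQCMS_AF: "(A, L) \<in> QQCMS"
  unfolding QQCMS_def
  using is_cstar seminorm jordan_lie lip_domain_dense L_kernel metrizes L_lower_semicontinuous
  by (auto simp: L_Leibniz[simplified] lip_domain_def saD)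

end

section \<open>Finite-dimensional subalgebras as metric spaces\<close>

context cstar_record
begin

lemma finite_dim_closedin:
  assumes "S \<subseteq> carrier A" "finite_dimensional A S" "S \<noteq> {}"
    "\<And>x y. x \<in> S \<Longrightarrow> y \<in> S \<Longrightarrow> x \<oplus> y \<in> S" "\<And>s x. x \<in> S \<Longrightarrow> s \<odot> x \<in> S"
  shows "closedin (cstar_topology A) S"
proof -
  obtain G where G: "finite G" "\<iota> ` S \<subseteq> span G" using finite_dimensional_emb[OF assms(2,1)] by blast
  have "subspace (\<iota> ` S)"
    unfolding subspace_def
  proof (intro conjI ballI allI)
    obtain x where x: "x \<in> S" using assms(3) by auto
    then have "\<iota> (0 \<odot> x) \<in> \<iota> ` S" "x \<in> carrier A" using assms(1,5) by blast+
    then show "0 \<in> \<iota> ` S" using \<iota>_simps(6)[of x 0] by (simp del: zero_smult)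
  next
    fix u v assume "u \<in> \<iota> ` S" "v \<in> \<iota> ` S"
    then obtain x y where xy: "x \<in> S" "u = \<iota> x" "y \<in> S" "v = \<iota> y" by auto
    then have "\<iota> (x \<oplus> y) \<in> \<iota> ` S" "x \<in> carrier A" "y \<in> carrier A" using assms(1,4) by blast+
    then show "u + v \<in> \<iota> ` S" using xy \<iota>_simps(1)[of x y] by simp
  next
    fix r u assume "u \<in> \<iota> ` S"
    then obtain x where x: "x \<in> S" "u = \<iota> x" by auto
    then have "\<iota> (complex_of_real r \<odot> x) \<in> \<iota> ` S" "x \<in> carrier A" using assms(1,5) by blast+
    then show "r *\<^sub>R u \<in> \<iota> ` S" using x \<iota>_simps(6)[of x "complex_of_real r"] by (simp add: scaleC_of_real)
  qed
  then obtain G' where "finite G'" "G' \<subseteq> \<iota> ` S" "span G' = \<iota> ` S"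
    using finite_basis_of_subspace[OF G(1) _ G(2)] by metis
  then have "closed (\<iota> ` S)" using closed_span_finite by metis
  then show ?thesis using closedin_iff_closed_emb[OF assms(1)] by simp
qed

lemma unital_cstar_subalgebraI:
  assumes "S \<subseteq> carrier A" "finite_dimensional A S" "\<one> \<in> S"
    "\<And>x y. x \<in> S \<Longrightarrow> y \<in> S \<Longrightarrow> x \<oplus> y \<in> S" "\<And>x y. x \<in> S \<Longrightarrow> y \<in> S \<Longrightarrow> x \<otimes> y \<in> S"
    "\<And>s x. x \<in> S \<Longrightarrow> s \<odot> x \<in> S" "\<And>x. x \<in> S \<Longrightarrow> adj A x \<in> S"
  shows "unital_cstar_subalgebra A S"
proof -
  have ring: "ring A" using is_cstar by (simp add: unital_cstar_def)
  have "\<ominus> x \<in> S" if "x \<in> S" for x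
    using assms(6)[OF that, of "-1"] minus_one_smult[of x] that assms(1) by auto
  then have "subring S A" using assms by (intro ring.subringI[OF ring]) auto
  moreover have "closedin (cstar_topology A) S"
    using assms by (intro finite_dim_closedin) auto
  ultimately show ?thesis using assms(6,7) by (simp add: unital_cstar_subalgebra_def)
qed

lemma minus_self_norm: "x \<in> carrier A \<Longrightarrow> cnorm A (x \<ominus> x) = 0"
  by (simp add: \<iota>_norm[symmetric] \<iota>_simps)

lemma minus_commute_norm: "x \<in> carrier A \<Longrightarrow> y \<in> carrier A \<Longrightarrow> cnorm A (x \<ominus> y) = cnorm A (y \<ominus> x)"
  by (simp add: \<iota>_norm[symmetric] \<iota>_simps norm_minus_commute)

lemma finsum_subrecord:
  assumes S: "unital_cstar_subalgebra A S" and "finite F" "F \<subseteq> S"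
  shows "(\<Oplus>\<^bsub>A\<lparr>carrier := S\<rparr>\<^esub>v\<in>F. s v \<odot> v) = (\<Oplus>v\<in>F. s v \<odot> v)"
  using assms(2,3)
proof (induction F rule: finite_induct)
  let ?S = "A\<lparr>carrier := S\<rparr>"
  note SD = subalgebraD[OF S]
  have am: "abelian_monoid A" using abelian_group_carrier by (simp add: abelian_group_def)
  have "abelian_group ?S" using unital_cstar_subrecord[OF S] unital_cstar.abelian_group_carrier by blast
  then have am': "abelian_monoid ?S" by (simp add: abelian_group_def)
  { case empty
    show ?case using abelian_monoid.finsum_empty[OF am] abelian_monoid.finsum_empty[OF am'] by simp }
  { case (insert v F)
    have "(\<Oplus>\<^bsub>?S\<^esub>v\<in>insert v F. s v \<odot> v) = s v \<odot> v \<oplus>\<^bsub>?S\<^esub> (\<Oplus>\<^bsub>?S\<^esub>v\<in>F. s v \<odot> v)"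
      using insert SD(8) by (intro abelian_monoid.finsum_insert[OF am']) auto
    moreover have "(\<Oplus>v\<in>insert v F. s v \<odot> v) = s v \<odot> v \<oplus> (\<Oplus>v\<in>F. s v \<odot> v)"
      using insert SD(1) by (intro abelian_monoid.finsum_insert[OF am]) auto
    ultimately show ?case using insert by simp }
qed

lemma finite_dimensional_subrecord:
  assumes S: "unital_cstar_subalgebra A S" and "finite_dimensional A T" "T \<subseteq> S"
  shows "finite_dimensional (A\<lparr>carrier := S\<rparr>) T"
proof -
  obtain F where F: "finite F" "F \<subseteq> T" "\<forall>x\<in>T. \<exists>s. x = (\<Oplus>v\<in>F. s v \<odot> v)"
    using assms(2) by (auto simp: finite_dimensional_def)
  then show ?thesis
    unfolding finite_dimensional_def using finsum_subrecord[OF S F(1)] assms(3) by (intro exI[of _ F]) auto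
qed

lemma states_subrecord:
  assumes "S \<subseteq> carrier A" "\<phi> \<in> states A" "unital_cstar_subalgebra A S"
  shows "restrict \<phi> S \<in> states (A\<lparr>carrier := S\<rparr>)"
  using assms(1,2) subalgebraD[OF assms(3)] by (simp add: states_def subset_iff)

end

text \<open>Level \<open>N\<close> is again of the form \<open>AF_trace\<close>, for the sequence that becomes constant at \<open>N\<close>.\<close>

locale AF_trace_level = AF_trace A \<mu> V \<beta> for A :: "'a cstar" (structure) and \<mu> V \<beta> +
  fixes N :: nat
begin

abbreviation B :: "'a cstar" where "B \<equiv> A\<lparr>carrier := V N\<rparr>"
abbreviation \<mu>B :: "'a \<Rightarrow> complex" where "\<mu>B \<equiv> restrict \<mu> (V N)"
abbreviation VB :: "nat \<Rightarrow> 'a set" where "VB n \<equiv> V (min n N)"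

lemma VN_closed:
  "x \<in> V N \<Longrightarrow> y \<in> V N \<Longrightarrow> x \<otimes> y \<in> V N" "x \<in> V N \<Longrightarrow> y \<in> V N \<Longrightarrow> x \<oplus> y \<in> V N"
  "x \<in> V N \<Longrightarrow> y \<in> V N \<Longrightarrow> x \<ominus> y \<in> V N" "x \<in> V N \<Longrightarrow> s \<odot> x \<in> V N" "x \<in> V N \<Longrightarrow> adj A x \<in> V N" "\<one> \<in> V N"
  using subalgebraD[OF V_sub[of N]] by auto

lemma cstar_B: "unital_cstar B" by (rule unital_cstar_subrecord[OF V_sub])

lemma faithful_tracial_state_B: "faithful_tracial_state B \<mu>B"
  using tracial states_subrecord[OF _ \<mu>_state V_sub[of N]] V_le VN_closed
  by (auto simp: faithful_tracial_state_def subset_iff)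

lemma AF_sequence_B: "AF_sequence B VB"
proof -
  interpret B: cstar_record B by (rule cstar_record[OF cstar_B])
  have le: "VB n \<subseteq> V N" for n using V_mono[of "min n N" N] by simp
  have "unital_cstar_subalgebra B (VB n)" "finite_dimensional B (VB n)" for n
  proof -
    note S = subalgebraD[OF V_sub[of "min n N"]]
    show fd: "finite_dimensional B (VB n)"
      by (rule finite_dimensional_subrecord[OF V_sub V_fd le])
    show "unital_cstar_subalgebra B (VB n)"
      by (rule B.unital_cstar_subalgebraI[OF _ fd]) (use S le in auto)
  qed
  moreover have "VB n \<subseteq> VB (Suc n)" for n by (rule V_mono) auto
  moreover have "cstar_topology B closure_of (\<Union>n. VB n) = carrier B"
  proof -
    have "(\<Union>n. VB n) = topspace (cstar_topology B)"
      using le B.topspace_cstar_topology by (auto intro!: exI[of _ N])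
    then show ?thesis using B.topspace_cstar_topology by (metis closure_of_topspace)
  qed
  moreover have "VB 0 = {s \<odot> \<one> | s. True}" using V_0 by simp
  ultimately show ?thesis by (auto simp: AF_sequence_def)
qed

sublocale B: AF_trace B \<mu>B VB \<beta>
  by (intro AF_trace.intro trace_record.intro cstar_record cstar_B trace_record_axioms.intro
      faithful_tracial_state_B AF_trace_axioms.intro AF_sequence_B \<beta>_pos \<beta>_tendsto)

lemma cond_exp_B:
  assumes "a \<in> V N" "m \<le> N" shows "cond_exp B \<mu>B (V m) a = cond_exp A \<mu> (V m) a"
proof -
  have le: "V m \<subseteq> V N" using V_mono assms(2) by blast
  have a: "a \<in> carrier A" using assms V_le by blast
  have "cond_exp B \<mu>B (VB m) a = cond_exp A \<mu> (V m) a"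
  proof (rule B.C.cond_exp_eqI)
    show "cond_exp A \<mu> (V m) a \<in> VB m" using C.cond_exp_mem[OF a] assms(2) by (simp add: min_absorb1)
    fix s assume s: "s \<in> VB m"
    then have s': "s \<in> V m" "s \<in> V N" using assms(2) le by (auto simp: min_absorb1)
    then show "\<mu>B (s \<otimes>\<^bsub>B\<^esub> a) = \<mu>B (s \<otimes>\<^bsub>B\<^esub> cond_exp A \<mu> (V m) a)"
      using C.cond_exp_orth[OF a s'(1)] C.cond_exp_mem[OF a, of m] le assms(1) VN_closed(1) by auto
  qed (use assms in simp)
  then show ?thesis using assms(2) by (simp add: min_absorb1)
qed

lemma dev_B: assumes "a \<in> V N" shows "B.dev n a = dev n a"
proof (cases "n \<le> N")
  case True
  then have "cond_exp A \<mu> (V n) a \<in> V N"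
    by (intro subsetD[OF V_mono C.cond_exp_mem] V_le[OF assms])
  then show ?thesis
    using True cond_exp_B[OF assms True] a_minus_subalgebra[OF V_sub assms]
    by (simp add: B.dev_def dev_def min_absorb1)
next
  case False
  then show ?thesis using dev_V[of N n a] B.dev_V[of N n a] assms by simp
qed

lemma lip_ball_B: "lip_ball B B.L = lip_ball A L \<inter> V N"
proof -
  have "a \<in> lip_ball B B.L \<longleftrightarrow> a \<in> lip_ball A L \<and> a \<in> V N" for a
  proof (cases "a \<in> V N")
    case True
    then have "a \<in> sa B \<longleftrightarrow> a \<in> sa A" using V_le[of a N] by (simp add: sa_def)
    then show ?thesis unfolding B.lip_ball_iff lip_ball_iff dev_B[OF True] using True by simp
  next
    case False
    then have "a \<notin> carrier B" by simp
    then show ?thesis using False B.lip_ball_carrier by blast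
  qed
  then show ?thesis by blast
qed

text \<open>The expectations onto \<open>V N\<close> and \<open>V n\<close> commute, and the former is a contraction.\<close>

lemma expect_lip_ball:
  assumes "a \<in> lip_ball A L"
  shows "cond_exp A \<mu> (V N) a \<in> lip_ball B B.L" "cnorm A (a \<ominus> cond_exp A \<mu> (V N) a) \<le> \<beta> N"
proof -
  let ?b = "cond_exp A \<mu> (V N) a"
  have a: "a \<in> carrier A" "a \<in> sa A" "\<And>n. dev n a \<le> \<beta> n" using assms by (auto simp: lip_ball_iff saD)
  have b: "?b \<in> V N" "?b \<in> carrier A" using C.cond_exp_mem C.cond_exp_carrier a by auto
  have "?b \<in> sa A" using a b C.E.expect_star[of "\<iota> a" N] by (simp add: sa_iff C.emb_cond_exp)
  moreover have "dev n ?b \<le> \<beta> n" for n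
  proof (cases "n \<le> N")
    case True
    have tower: "C.E.expect n (C.E.expect N (\<iota> a)) = C.E.expect n (\<iota> a)"
      "C.E.expect N (C.E.expect n (\<iota> a)) = C.E.expect n (\<iota> a)"
      using expect_tower[OF C.finite_dim_expectation_emb C.finite_dim_expectation_emb image_mono[OF V_mono[OF True]]] a
      by auto
    have "\<iota> ?b - C.E.expect n (\<iota> ?b) = C.E.expect N (\<iota> a - C.E.expect n (\<iota> a))"
      using a by (simp add: C.emb_cond_exp tower C.E.expect_diff C.E.expect_B)
    then have "dev n ?b \<le> dev n a"
      using a b C.E.norm_expect_le[of "\<iota> a - C.E.expect n (\<iota> a)" N]
      by (simp add: dev_emb R.diff_mem C.E.expect_B)
    then show ?thesis using a(3)[of n] by simp
  next
    case False
    then show ?thesis using dev_V[of N n ?b] b \<beta>_pos[of n] by simp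
  qed
  ultimately show "?b \<in> lip_ball B B.L" using b by (simp add: lip_ball_B lip_ball_iff)
  show "cnorm A (a \<ominus> ?b) \<le> \<beta> N" using a(3)[of N] by (simp add: dev_def)
qed

text \<open>States of \<open>B\<close> extend to \<open>A\<close> by composition with the conditional expectation.\<close>

lemma states_B: "(\<lambda>\<phi>. restrict \<phi> (V N)) ` states A = states B"
proof (intro subset_antisym subsetI)
  fix \<psi> assume "\<psi> \<in> (\<lambda>\<phi>. restrict \<phi> (V N)) ` states A"
  then show "\<psi> \<in> states B" using states_subrecord[OF _ _ V_sub] V_le by blast
next
  fix \<psi> assume \<psi>: "\<psi> \<in> states B"
  let ?E = "cond_exp A \<mu> (V N)"
  define \<phi> where "\<phi> = restrict (\<psi> \<circ> ?E) (carrier A)"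
  have CE: "conditional_expectation A (V N) ?E"
    using C.conditional_expectation_expect_elem C.cond_exp_eq by metis
  have E: "?E a \<in> V N" if "a \<in> carrier A" for a using C.cond_exp_mem that by blast
  have "\<phi> \<in> states A"
    unfolding states_def
  proof (intro CollectI conjI ballI allI)
    fix a b s assume a: "a \<in> carrier A" and b: "b \<in> carrier A"
    have "?E (a \<oplus> b) = ?E a \<oplus> ?E b" using CE a b by (simp add: conditional_expectation_def)
    then show "\<phi> (a \<oplus> b) = \<phi> a + \<phi> b"
      using B.state_linear(1)[OF \<psi>, of "?E a" "?E b"] E a b by (simp add: \<phi>_def)
  next
    fix a s assume a: "a \<in> carrier A"
    have "?E (s \<odot> a) = s \<odot> ?E a" using CE a by (simp add: conditional_expectation_def)
    then show "\<phi> (s \<odot> a) = s * \<phi> a" using B.state_smult[OF \<psi>, of "?E a" s] E a by (simp add: \<phi>_def)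
    obtain b where b: "b \<in> V N" "?E (adj A a \<otimes> a) = adj A b \<otimes> b"
      using CE a unfolding conditional_expectation_def by blast
    then have "\<phi> (adj A a \<otimes> a) = \<psi> (adj B b \<otimes>\<^bsub>B\<^esub> b)" using a by (simp add: \<phi>_def)
    then show "\<phi> (adj A a \<otimes> a) \<in> \<real>" "0 \<le> Re (\<phi> (adj A a \<otimes> a))"
      using \<psi> b(1) by (simp_all add: states_def)
  next
    have "?E \<one> = \<one>" using CE VN_closed(6) unfolding conditional_expectation_def by blast
    then show "\<phi> \<one> = 1" using B.state_one[OF \<psi>] by (simp add: \<phi>_def)
  qed (simp add: \<phi>_def)
  moreover have "restrict \<phi> (V N) = \<psi>"
  proof
    fix x
    show "restrict \<phi> (V N) x = \<psi> x"
    proof (cases "x \<in> V N")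
      case True
      then have "?E x = x" using CE unfolding conditional_expectation_def by blast
      then show ?thesis using True V_le by (simp add: \<phi>_def)
    next
      case False
      then show ?thesis using \<psi> by (simp add: states_def extensional_def)
    qed
  qed
  ultimately show "\<psi> \<in> (\<lambda>\<phi>. restrict \<phi> (V N)) ` states A" by blast
qed

end

section \<open>Bridges with unit pivot\<close>

lemma hausdorff_distance_le:
  assumes "\<And>x. x \<in> X \<Longrightarrow> \<exists>y\<in>Y. d x y \<le> r" "\<And>y. y \<in> Y \<Longrightarrow> \<exists>x\<in>X. d x y \<le> r"
  shows "hausdorff_distance d X Y \<le> r"
  unfolding hausdorff_distance_def
proof (rule max.boundedI)
  show "(SUP x\<in>X. INF y\<in>Y. d x y) \<le> r" using assms(1) by (intro SUP_least) (meson INF_lower order_trans)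
  show "(SUP y\<in>Y. INF x\<in>X. d x y) \<le> r" using assms(2) by (intro SUP_least) (meson INF_lower order_trans)
qed

lemma mk_self: "mk B L \<phi> \<phi> = 0"
  unfolding mk_def by (rule antisym[OF SUP_least]) auto

definition unit_bridge :: "'d cstar \<Rightarrow> ('b \<Rightarrow> 'd) \<Rightarrow> ('c \<Rightarrow> 'd) \<Rightarrow> ('d, 'b, 'c) bridge" where
  "unit_bridge D f g = \<lparr>bridge_alg = D, pivot = \<one>\<^bsub>D\<^esub>, left_emb = f, right_emb = g\<rparr>"

lemma level_states_one:
  fixes D :: "'d cstar"
  assumes "unital_cstar D" shows "level_states D \<one>\<^bsub>D\<^esub> = states D"
proof -
  interpret cstar_record D by (rule cstar_record[OF assms])
  have one: "\<one>\<^bsub>D\<^esub> \<ominus>\<^bsub>D\<^esub> \<one>\<^bsub>D\<^esub> = \<zero>\<^bsub>D\<^esub>" by (subst \<iota>_eq_iff[symmetric]) (auto simp: \<iota>_simps)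
  have zero: "\<phi> \<zero>\<^bsub>D\<^esub> = 0" if "\<phi> \<in> states D" for \<phi>
    using state_bounded[OF that, of "\<zero>\<^bsub>D\<^esub>"] by simp
  have "\<zero>\<^bsub>D\<^esub> \<otimes>\<^bsub>D\<^esub> \<zero>\<^bsub>D\<^esub> = \<zero>\<^bsub>D\<^esub>" by (subst \<iota>_eq_iff[symmetric]) (auto simp: \<iota>_simps)
  then show ?thesis by (auto simp: level_states_def one zero Let_def)
qed

text \<open>All states of \<open>D\<close> are level states, so both heights compare the state space with itself, and only the reach remains.\<close>

lemma unit_bridge_length:
  assumes D: "unital_cstar D" and ne: "states D \<noteq> {}"
    and f: "unital_star_mono B D f" and g: "unital_star_mono C D g"
    and states_f: "(\<lambda>\<phi>. restrict (\<phi> \<circ> f) (carrier B)) ` states D = states B"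
    and states_g: "(\<lambda>\<phi>. restrict (\<phi> \<circ> g) (carrier C)) ` states D = states C"
    and lr: "\<And>a. a \<in> lip_ball B LB \<Longrightarrow> \<exists>b\<in>lip_ball C LC. cnorm D (f a \<ominus>\<^bsub>D\<^esub> g b) \<le> r"
    and rl: "\<And>b. b \<in> lip_ball C LC \<Longrightarrow> \<exists>a\<in>lip_ball B LB. cnorm D (f a \<ominus>\<^bsub>D\<^esub> g b) \<le> r"
  shows "is_bridge B C (unit_bridge D f g)" "bridge_length (unit_bridge D f g) (B, LB) (C, LC) \<le> ennreal r"
proof -
  interpret D: cstar_record D by (rule cstar_record[OF D])
  show "is_bridge B C (unit_bridge D f g)"
    using D ne f g by (simp add: is_bridge_def unit_bridge_def level_states_one)
  have f_mem: "f a \<in> carrier D" if "a \<in> lip_ball B LB" for a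
    using f that by (auto simp: unital_star_mono_def ring_hom_def lip_ball_def sa_def)
  have g_mem: "g b \<in> carrier D" if "b \<in> lip_ball C LC" for b
    using g that by (auto simp: unital_star_mono_def ring_hom_def lip_ball_def sa_def)
  have heights: "embedding_height D \<one>\<^bsub>D\<^esub> f (B, LB) \<le> ennreal r" "embedding_height D \<one>\<^bsub>D\<^esub> g (C, LC) \<le> ennreal r"
    unfolding embedding_height_def level_states_one[OF D] prod.case states_f states_g
    by (rule hausdorff_distance_le; use mk_self in \<open>metis zero_le\<close>)+
  have dist: "ennreal (cdist D (f a \<otimes>\<^bsub>D\<^esub> \<one>\<^bsub>D\<^esub>) (\<one>\<^bsub>D\<^esub> \<otimes>\<^bsub>D\<^esub> g b)) = ennreal (cnorm D (f a \<ominus>\<^bsub>D\<^esub> g b))"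
    if "a \<in> lip_ball B LB" "b \<in> lip_ball C LC" for a b
    using f_mem[OF that(1)] g_mem[OF that(2)] by (simp add: cdist_def)
  have "bridge_reach (unit_bridge D f g) (B, LB) (C, LC) \<le> ennreal r"
    unfolding bridge_reach_def prod.case unit_bridge_def bridge.simps
  proof (rule hausdorff_distance_le)
    fix x assume "x \<in> (\<lambda>a. f a \<otimes>\<^bsub>D\<^esub> \<one>\<^bsub>D\<^esub>) ` lip_ball B LB"
    then obtain a where a: "a \<in> lip_ball B LB" "x = f a \<otimes>\<^bsub>D\<^esub> \<one>\<^bsub>D\<^esub>" by auto
    obtain b where b: "b \<in> lip_ball C LC" "cnorm D (f a \<ominus>\<^bsub>D\<^esub> g b) \<le> r" using lr[OF a(1)] by blast
    then show "\<exists>y\<in>(\<lambda>b. \<one>\<^bsub>D\<^esub> \<otimes>\<^bsub>D\<^esub> g b) ` lip_ball C LC. ennreal (cdist D x y) \<le> ennreal r"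
      using dist[OF a(1) b(1)] a(2) by (intro bexI[of _ "\<one>\<^bsub>D\<^esub> \<otimes>\<^bsub>D\<^esub> g b"]) (auto intro: ennreal_leI)
  next
    fix y assume "y \<in> (\<lambda>b. \<one>\<^bsub>D\<^esub> \<otimes>\<^bsub>D\<^esub> g b) ` lip_ball C LC"
    then obtain b where b: "b \<in> lip_ball C LC" "y = \<one>\<^bsub>D\<^esub> \<otimes>\<^bsub>D\<^esub> g b" by auto
    obtain a where a: "a \<in> lip_ball B LB" "cnorm D (f a \<ominus>\<^bsub>D\<^esub> g b) \<le> r" using rl[OF b(1)] by blast
    then show "\<exists>x\<in>(\<lambda>a. f a \<otimes>\<^bsub>D\<^esub> \<one>\<^bsub>D\<^esub>) ` lip_ball B LB. ennreal (cdist D x y) \<le> ennreal r"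
      using dist[OF a(1) b(1)] b(2) by (intro bexI[of _ "f a \<otimes>\<^bsub>D\<^esub> \<one>\<^bsub>D\<^esub>"]) (auto intro: ennreal_leI)
  qed
  then show "bridge_length (unit_bridge D f g) (B, LB) (C, LC) \<le> ennreal r"
    using heights by (simp add: bridge_length_def unit_bridge_def)
qed

lemma quantum_propinquity_le_chain:
  fixes X P R Y :: "'u cstar \<times> ('u \<Rightarrow> ennreal)" and \<gamma>\<^sub>1 \<gamma>\<^sub>2 \<gamma>\<^sub>3 :: "('u, 'u, 'u) bridge"
  assumes "X \<in> QQCMS" "P \<in> QQCMS" "R \<in> QQCMS" "Y \<in> QQCMS"
    and "is_bridge (fst X) (fst P) \<gamma>\<^sub>1" "is_bridge (fst P) (fst R) \<gamma>\<^sub>2" "is_bridge (fst R) (fst Y) \<gamma>\<^sub>3"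
  shows "quantum_propinquity X Y \<le> bridge_length \<gamma>\<^sub>1 X P + bridge_length \<gamma>\<^sub>2 P R + bridge_length \<gamma>\<^sub>3 R Y"
proof -
  define Z where "Z i = (if i = 0 then X else if i = 1 then P else if i = 2 then R else Y)" for i :: nat
  define \<gamma> where "\<gamma> i = (if i = 0 then \<gamma>\<^sub>1 else if i = 1 then \<gamma>\<^sub>2 else \<gamma>\<^sub>3)" for i :: nat
  have sum: "(\<Sum>i<3. bridge_length (\<gamma> i) (Z i) (Z (Suc i))) =
      bridge_length \<gamma>\<^sub>1 X P + bridge_length \<gamma>\<^sub>2 P R + bridge_length \<gamma>\<^sub>3 R Y"
    by (simp add: numeral_3_eq_3 Z_def \<gamma>_def numeral_2_eq_2)
  have "\<forall>i\<le>3. Z i \<in> QQCMS" using assms(1-4) by (auto simp: Z_def)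
  moreover have "\<forall>i<3. is_bridge (fst (Z i)) (fst (Z (Suc i))) (\<gamma> i)"
  proof (intro allI impI)
    fix i :: nat assume "i < 3"
    then consider "i = 0" | "i = 1" | "i = 2" by linarith
    then show "is_bridge (fst (Z i)) (fst (Z (Suc i))) (\<gamma> i)"
      by cases (use assms(5-7) in \<open>simp_all add: Z_def \<gamma>_def\<close>)
  qed
  moreover have "Z 0 = X" "Z 3 = Y" "(1::nat) \<le> 3" by (auto simp: Z_def)
  ultimately show ?thesis
    unfolding quantum_propinquity_def sum[symmetric] by (intro Inf_lower CollectI exI[of _ 3] exI[of _ Z] exI[of _ \<gamma>]) auto
qed

lemma restrict_states_id: "(\<lambda>\<phi>. restrict (\<phi> \<circ> (\<lambda>x. x)) (carrier A)) ` states A = states A"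
proof -
  have "restrict (\<phi> \<circ> (\<lambda>x. x)) (carrier A) = \<phi>" if "\<phi> \<in> states A" for \<phi>
    using that by (simp add: o_def states_def extensional_restrict)
  then show ?thesis by force
qed

lemma unital_star_mono_id: "unital_star_mono A A (\<lambda>x. x)"
  by (auto simp: unital_star_mono_def ring_hom_def)

context AF_trace_level
begin

lemma unital_star_mono_B: "unital_star_mono B A (\<lambda>x. x)"
  using V_le by (auto simp: unital_star_mono_def ring_hom_def)

lemma level_bridge:
  shows "is_bridge A B (unit_bridge A (\<lambda>x. x) (\<lambda>x. x))"
    "bridge_length (unit_bridge A (\<lambda>x. x) (\<lambda>x. x)) (A, L) (B, B.L) \<le> ennreal (\<beta> N)"
    "is_bridge B A (unit_bridge A (\<lambda>x. x) (\<lambda>x. x))"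
    "bridge_length (unit_bridge A (\<lambda>x. x) (\<lambda>x. x)) (B, B.L) (A, L) \<le> ennreal (\<beta> N)"
proof -
  have ne: "states A \<noteq> {}" using \<mu>_state by auto
  have st: "(\<lambda>\<phi>. restrict (\<phi> \<circ> (\<lambda>x. x)) (carrier B)) ` states A = states B"
    using states_B by (simp add: o_def)
  have down: "\<exists>b\<in>lip_ball B B.L. cnorm A (a \<ominus> b) \<le> \<beta> N" if "a \<in> lip_ball A L" for a
    using expect_lip_ball[OF that] by blast
  have down': "\<exists>b\<in>lip_ball B B.L. cnorm A (b \<ominus> a) \<le> \<beta> N" if "a \<in> lip_ball A L" for a
    using expect_lip_ball[OF that] minus_commute_norm[of a "cond_exp A \<mu> (V N) a"] lip_ball_carrier[OF that]
      C.cond_exp_carrier[OF lip_ball_carrier[OF that], of N] by auto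
  have up: "\<exists>a\<in>lip_ball A L. cnorm A (a \<ominus> b) \<le> \<beta> N" "\<exists>a\<in>lip_ball A L. cnorm A (b \<ominus> a) \<le> \<beta> N"
    if "b \<in> lip_ball B B.L" for b
    using that lip_ball_B minus_self_norm[of b] lip_ball_carrier[of b] \<beta>_pos[of N] by (auto intro!: bexI[of _ b])
  show "is_bridge A B (unit_bridge A (\<lambda>x. x) (\<lambda>x. x))"
    "bridge_length (unit_bridge A (\<lambda>x. x) (\<lambda>x. x)) (A, L) (B, B.L) \<le> ennreal (\<beta> N)"
    by (rule unit_bridge_length[OF is_cstar ne unital_star_mono_id unital_star_mono_B restrict_states_id st down up(1)]; assumption)+
  show "is_bridge B A (unit_bridge A (\<lambda>x. x) (\<lambda>x. x))"
    "bridge_length (unit_bridge A (\<lambda>x. x) (\<lambda>x. x)) (B, B.L) (A, L) \<le> ennreal (\<beta> N)"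
    by (rule unit_bridge_length[OF is_cstar ne unital_star_mono_B unital_star_mono_id st restrict_states_id up(2) down']; assumption)+
qed

end

section \<open>Dependence on the trace\<close>

text \<open>Both expectations reproduce their own trace on \<open>S\<close>, so \<open>\<mu> (d\<^sup>* d)\<close> for their difference \<open>d\<close> only involves \<open>\<nu> - \<mu>\<close>.\<close>

lemma expect_perturb:
  assumes M: "finite_dim_expectation B e \<mu> S" and N: "finite_dim_expectation B e \<nu> S"
    and \<tau>: "\<And>x. x \<in> B \<Longrightarrow> cmod (\<nu> x - \<mu> x) \<le> \<tau> * norm x"
    and \<kappa>: "0 < \<kappa>" "\<And>x. x \<in> S \<Longrightarrow> \<kappa> * (norm x)\<^sup>2 \<le> faithful_trace.sqnorm \<mu> x"
    and a: "a \<in> B"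
  shows "norm (finite_dim_expectation.expect \<nu> S a - finite_dim_expectation.expect \<mu> S a) \<le> 2 * \<tau> / \<kappa> * norm a"
proof -
  interpret M: finite_dim_expectation B e \<mu> S by (rule M)
  interpret N: finite_dim_expectation B e \<nu> S by (rule N)
  define d where "d = N.expect a - M.expect a"
  have "d \<in> S" unfolding d_def using a by (intro M.S.diff_mem M.expect_mem N.expect_mem)
  then have d: "d \<in> S" "d \<in> B" "star d \<in> S" "star d \<in> B"
    using M.S_le M.S.star_mem by auto
  have \<tau>0: "0 \<le> \<tau> * norm x" if "x \<in> B" for x using \<tau>[OF that] norm_ge_zero order_trans by blast
  have "\<mu> (star d * d) = \<mu> (star d * N.expect a) - \<mu> (star d * a)"
    using a d M.expect_orth[OF a d(3)] M.expect_B N.expect_B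
    by (subst (2) d_def) (simp add: right_diff_distrib M.functional_diff M.mems)
  also have "\<dots> = (\<nu> (star d * a) - \<mu> (star d * a)) - (\<nu> (star d * N.expect a) - \<mu> (star d * N.expect a))"
    using N.expect_orth[OF a d(3)] by simp
  finally have "cmod (\<mu> (star d * d)) \<le>
      cmod (\<nu> (star d * a) - \<mu> (star d * a)) + cmod (\<nu> (star d * N.expect a) - \<mu> (star d * N.expect a))"
    by (metis norm_triangle_ineq4)
  also have "\<dots> \<le> \<tau> * norm (star d * a) + \<tau> * norm (star d * N.expect a)"
    using a d N.expect_B by (intro add_mono \<tau> M.mems) auto
  finally have *: "cmod (\<mu> (star d * d)) \<le> \<tau> * norm (star d * a) + \<tau> * norm (star d * N.expect a)" .
  have le: "\<tau> * norm (star d * x) \<le> \<tau> * (norm d * norm a)" if "norm x \<le> norm a" for x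
  proof -
    have "norm (star d * x) \<le> norm (star d) * norm x" by (rule norm_mult_ineq)
    also have "\<dots> \<le> norm d * norm a" using that by (simp add: mult_left_mono)
    finally have n: "norm (star d * x) \<le> norm d * norm a" .
    show ?thesis
    proof (cases "0 \<le> \<tau>")
      case False
      then have "a = 0 \<or> \<not> 0 < norm a" using \<tau>0[OF a] by (simp add: zero_le_mult_iff)
      then show ?thesis using that by simp
    qed (use n in \<open>simp add: mult_left_mono\<close>)
  qed
  have "\<kappa> * (norm d)\<^sup>2 \<le> M.sqnorm d" by (rule \<kappa>(2)[OF d(1)])
  also have "\<dots> \<le> cmod (\<mu> (star d * d))" unfolding M.sqnorm_def by (rule complex_Re_le_cmod)
  also have "\<dots> \<le> \<tau> * (norm d * norm a) + \<tau> * (norm d * norm a)"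
    using * le[of a] le[OF N.norm_expect_le[OF a]] by linarith
  finally have "\<kappa> * norm d * norm d \<le> (2 * \<tau> * norm a) * norm d"
    by (simp add: power2_eq_square algebra_simps)
  then have "\<kappa> * norm d \<le> 2 * \<tau> * norm a"
    using \<tau>0[OF a] by (cases "norm d = 0") (auto simp: mult.assoc)
  then show ?thesis using \<kappa>(1) by (simp add: d_def field_simps)
qed

context cstar_record
begin

text \<open>States are contractions, so pointwise convergence on a finite net of the compact unit ball suffices.\<close>

lemma states_converge_uniformly:
  assumes fd: "finite_dimensional A (carrier A)"
    and \<phi>: "\<And>k. \<phi> k \<in> states A" "\<phi>' \<in> states A"
    and lim: "\<And>x. x \<in> carrier A \<Longrightarrow> (\<lambda>k. \<phi> k x) \<longlonglongrightarrow> \<phi>' x" and "0 < \<tau>"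
  shows "\<forall>\<^sub>F k in sequentially. \<forall>x\<in>carrier A. cmod (\<phi> k x - \<phi>' x) \<le> \<tau> * cnorm A x"
proof -
  obtain G where G: "finite G" "G \<subseteq> \<iota> ` carrier A" "span G = \<iota> ` carrier A"
    using finite_dimensional_emb[OF fd] finite_basis_of_subspace[OF _ R.subspace] by (metis order_refl)
  let ?K = "{u \<in> span G. norm u \<le> 1}"
  obtain k where k: "finite k" "k \<subseteq> ?K" "?K \<subseteq> (\<Union>u\<in>k. ball u (\<tau> / 4))"
    using seq_compact_imp_totally_bounded[OF compact_imp_seq_compact[OF compact_bounded_span_finite[OF G(1)]]]
      divide_pos_pos[OF assms(5) zero_less_numeral] by meson
  have "k \<subseteq> \<iota> ` carrier A" using k(2) G(3) by blast
  then obtain T where T: "finite T" "T \<subseteq> carrier A" "k = \<iota> ` T" using k(1) finite_subset_image by metis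
  have "\<forall>\<^sub>F k in sequentially. \<forall>t\<in>T. cmod (\<phi> k t - \<phi>' t) < \<tau> / 2"
  proof (rule eventually_ball_finite[OF T(1)], rule ballI)
    fix t assume "t \<in> T"
    then have "(\<lambda>k. \<phi> k t) \<longlonglongrightarrow> \<phi>' t" using T(2) lim by blast
    then show "\<forall>\<^sub>F k in sequentially. cmod (\<phi> k t - \<phi>' t) < \<tau> / 2"
      using assms(5) unfolding tendsto_iff dist_norm by (metis half_gt_zero)
  qed
  then show ?thesis
  proof (rule eventually_mono)
    fix k assume close: "\<forall>t\<in>T. cmod (\<phi> k t - \<phi>' t) < \<tau> / 2"
    have unit: "cmod (\<phi> k x - \<phi>' x) \<le> \<tau>" if x: "x \<in> carrier A" "cnorm A x \<le> 1" for x
    proof -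
      have "\<iota> x \<in> ?K" using x G(3) by (simp add: \<iota>_norm)
      then obtain t where t: "t \<in> T" "norm (\<iota> x - \<iota> t) < \<tau> / 4"
        using k(3) T(3) by (auto simp: dist_norm norm_minus_commute)
      have tA: "t \<in> carrier A" using t T(2) by auto
      have nrm: "cnorm A (x \<ominus> t) < \<tau> / 4" using t x tA by (simp add: \<iota>_norm[symmetric] \<iota>_simps)
      have "\<phi> k x - \<phi>' x = (\<phi> k (x \<ominus> t) - \<phi>' (x \<ominus> t)) + (\<phi> k t - \<phi>' t)"
        using \<phi> x tA by (simp add: state_linear)
      then have "cmod (\<phi> k x - \<phi>' x) \<le> cmod (\<phi> k (x \<ominus> t) - \<phi>' (x \<ominus> t)) + cmod (\<phi> k t - \<phi>' t)"
        using norm_triangle_ineq by metis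
      also have "cmod (\<phi> k (x \<ominus> t) - \<phi>' (x \<ominus> t)) \<le> cmod (\<phi> k (x \<ominus> t)) + cmod (\<phi>' (x \<ominus> t))"
        by (rule norm_triangle_ineq4)
      finally show ?thesis
        using close t(1) nrm state_bounded[OF \<phi>(1), of "x \<ominus> t" k] state_bounded[OF \<phi>(2), of "x \<ominus> t"] x tA
        by fastforce
    qed
    show "\<forall>x\<in>carrier A. cmod (\<phi> k x - \<phi>' x) \<le> \<tau> * cnorm A x"
    proof
      fix x assume x: "x \<in> carrier A"
      show "cmod (\<phi> k x - \<phi>' x) \<le> \<tau> * cnorm A x"
      proof (cases "cnorm A x = 0")
        case True
        then show ?thesis using state_bounded[OF \<phi>(1) x, of k] state_bounded[OF \<phi>(2) x] by simp
      next
        case False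
        then have pos: "cnorm A x > 0" using cnorm_nonneg[OF x] by simp
        let ?y = "complex_of_real (1 / cnorm A x) \<odot> x"
        have "cmod (\<phi> k ?y - \<phi>' ?y) \<le> \<tau>" using x pos by (intro unit) (auto simp: cnorm_smult norm_divide)
        moreover have "\<phi> k ?y - \<phi>' ?y = complex_of_real (1 / cnorm A x) * (\<phi> k x - \<phi>' x)"
          using \<phi> x by (simp add: state_smult right_diff_distrib)
        ultimately have "cmod (\<phi> k x - \<phi>' x) / cnorm A x \<le> \<tau>" using pos by (simp add: norm_mult norm_divide)
        then show ?thesis using pos by (simp add: field_simps)
      qed
    qed
  qed
qed

end

text \<open>If all deviations from the conditional expectations change by at most \<open>\<delta> \<parallel>a\<parallel>\<close>, an element of one Lip
  ball is shrunk slightly, modulo scalars, to fall into the other one.\<close>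

lemma lip_ball_perturb:
  fixes A :: "'a cstar"
  assumes M: "AF_trace A \<mu> V \<beta>" and N: "AF_trace A \<nu> V \<beta>'"
    and full: "V N = carrier A" and \<beta>_eq: "\<And>n. n \<le> N \<Longrightarrow> \<beta>' n = \<beta> n"
    and \<delta>: "0 \<le> \<delta>" "\<And>n a. a \<in> carrier A \<Longrightarrow> AF_trace.dev A \<mu> V n a \<le> AF_trace.dev A \<nu> V n a + \<delta> * cnorm A a"
    and b: "0 < b" "\<And>n. n \<le> N \<Longrightarrow> b \<le> \<beta> n"
    and a: "a \<in> lip_ball A (AF_lip A V \<nu> \<beta>')"
  shows "\<exists>c\<in>lip_ball A (AF_lip A V \<mu> \<beta>). cnorm A (a \<ominus>\<^bsub>A\<^esub> c) \<le> \<delta> * \<beta> 0 / b * \<beta> 0"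
proof -
  interpret M: AF_trace A \<mu> V \<beta> by (rule M)
  interpret N: AF_trace A \<nu> V \<beta>' by (rule N)
  let ?\<iota> = "emb A"
  define p where "p = cond_exp A \<nu> (V 0) a"
  have aD: "a \<in> carrier A" "a \<in> sa A" "\<And>n. N.dev n a \<le> \<beta>' n" using a by (auto simp: N.lip_ball_iff N.saD)
  have p: "p \<in> V 0" "p \<in> carrier A" using aD N.C.cond_exp_mem N.C.cond_exp_carrier by (auto simp: p_def)
  have p_sa: "star (?\<iota> p) = ?\<iota> p"
    using aD N.C.E.expect_star[of "?\<iota> a" 0] by (simp add: p_def N.sa_iff N.C.emb_cond_exp)
  define \<eta> where "\<eta> = \<delta> * \<beta> 0 / b"
  have \<eta>: "0 \<le> \<eta>" using \<delta>(1) b(1) M.\<beta>_pos[of 0] by (simp add: \<eta>_def)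
  define x where "x = a \<ominus>\<^bsub>A\<^esub> p"
  have x: "x \<in> carrier A" "cnorm A x \<le> \<beta> 0"
    using aD(1) aD(3)[of 0] p \<beta>_eq[of 0] by (auto simp: x_def p_def N.dev_def)
  define c where "c = p \<oplus>\<^bsub>A\<^esub> complex_of_real (1 / (1 + \<eta>)) \<odot>\<^bsub>A\<^esub> x"
  have c: "c \<in> carrier A" using p x by (simp add: c_def)
  have V0: "q \<in> V 0 \<Longrightarrow> M.dev n q = 0 \<and> N.dev n q = 0" for q n using M.dev_V[of 0 n q] N.dev_V[of 0 n q] by simp
  have dev_c: "M.dev n c \<le> \<beta> n" for n
  proof (cases "n \<le> N")
    case True
    have "a \<ominus>\<^bsub>A\<^esub> p = a \<oplus>\<^bsub>A\<^esub> (-1) \<odot>\<^bsub>A\<^esub> p"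
      using aD p by (subst M.\<iota>_eq_iff[symmetric]) (auto simp: M.\<iota>_simps)
    then have "N.dev n x \<le> N.dev n a + N.dev n ((-1) \<odot>\<^bsub>A\<^esub> p)"
      using N.dev_add[of a "(-1) \<odot>\<^bsub>A\<^esub> p" n] aD p by (simp add: x_def)
    then have "N.dev n x \<le> \<beta> n" using V0[OF p(1), of n] aD(3)[of n] p \<beta>_eq[OF True] by (simp add: N.dev_smult)
    then have "M.dev n x \<le> \<beta> n + \<delta> * \<beta> 0"
      using \<delta>(2)[OF x(1), of n] mult_left_mono[OF x(2) \<delta>(1)] by linarith
    also have "\<delta> * \<beta> 0 = \<eta> * b" using b(1) by (simp add: \<eta>_def)
    also have "\<eta> * b \<le> \<eta> * \<beta> n" using \<eta> b(2)[OF True] by (rule mult_left_mono[rotated])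
    finally have "M.dev n x \<le> (1 + \<eta>) * \<beta> n" by (simp add: algebra_simps)
    moreover have "M.dev n c \<le> M.dev n p + M.dev n (complex_of_real (1 / (1 + \<eta>)) \<odot>\<^bsub>A\<^esub> x)"
      unfolding c_def using p x by (intro M.dev_add) auto
    moreover have "M.dev n (complex_of_real (1 / (1 + \<eta>)) \<odot>\<^bsub>A\<^esub> x) = M.dev n x / (1 + \<eta>)"
      using x \<eta> M.dev_smult[of x n "complex_of_real (1 / (1 + \<eta>))"] by (simp add: norm_divide del: of_real_add)
    moreover have "M.dev n x / (1 + \<eta>) \<le> \<beta> n"
      using \<open>M.dev n x \<le> (1 + \<eta>) * \<beta> n\<close> \<eta> by (simp add: divide_le_eq mult.commute)
    ultimately show ?thesis using V0[OF p(1), of n] by linarith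
  next
    case False
    then show ?thesis using M.dev_V[of N n c] c full M.\<beta>_pos[of n] by simp
  qed
  have emb_c: "?\<iota> c = ?\<iota> p + (1 / (1 + \<eta>)) *\<^sub>R ?\<iota> x"
    using p x by (simp only: c_def M.\<iota>_simps M.smult_mem scaleC_of_real)
  have emb_x: "?\<iota> x = ?\<iota> a - ?\<iota> p" using aD p by (simp add: x_def M.\<iota>_simps)
  have "c \<in> sa A" using c p_sa aD(2) by (simp add: M.sa_iff emb_c emb_x)
  then have "c \<in> lip_ball A (AF_lip A V \<mu> \<beta>)" using dev_c by (simp add: M.lip_ball_iff)
  moreover have "cnorm A (a \<ominus>\<^bsub>A\<^esub> c) \<le> \<eta> * \<beta> 0"
  proof -
    have "?\<iota> a - ?\<iota> c = (1 - 1 / (1 + \<eta>)) *\<^sub>R ?\<iota> x"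
      using emb_x by (simp add: emb_c scaleR_left_diff_distrib)
    also have "1 - 1 / (1 + \<eta>) = \<eta> / (1 + \<eta>)" using \<eta> by (simp add: field_simps)
    finally have "cnorm A (a \<ominus>\<^bsub>A\<^esub> c) = \<eta> / (1 + \<eta>) * cnorm A x"
      using aD c x \<eta> by (simp add: M.\<iota>_norm[symmetric] M.\<iota>_simps)
    also have "\<dots> \<le> \<eta> * \<beta> 0"
    proof (rule mult_mono)
      show "\<eta> / (1 + \<eta>) \<le> \<eta>" using \<eta> by (simp add: field_simps)
    qed (use \<eta> x M.cnorm_nonneg in auto)
    finally show ?thesis .
  qed
  ultimately show ?thesis by (auto simp: \<eta>_def)
qed

section \<open>Transport along *-isomorphisms\<close>

lemma restrict_state_mono:
  assumes F: "unital_cstar F" and "unital_star_mono F G \<theta>" "\<phi> \<in> states G"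
  shows "restrict (\<phi> \<circ> \<theta>) (carrier F) \<in> states F"
proof -
  interpret F: unital_cstar F by (rule F)
  have "\<theta> x \<in> carrier G" if "x \<in> carrier F" for x
    using assms(2) that by (auto simp: unital_star_mono_def ring_hom_def)
  then show ?thesis
    using assms(2,3) by (auto simp: unital_star_mono_def ring_hom_def states_def)
qed

locale star_isomorphism =
  fixes F :: "'b cstar" and G :: "'c cstar" and \<theta> :: "'b \<Rightarrow> 'c" and \<theta>' :: "'c \<Rightarrow> 'b"
  assumes F: "unital_cstar F" and G: "unital_cstar G"
    and \<theta>: "unital_star_mono F G \<theta>" and \<theta>': "unital_star_mono G F \<theta>'"
    and inverse: "\<And>x. x \<in> carrier F \<Longrightarrow> \<theta>' (\<theta> x) = x" "\<And>y. y \<in> carrier G \<Longrightarrow> \<theta> (\<theta>' y) = y"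
    and isometric: "\<And>x. x \<in> carrier F \<Longrightarrow> cnorm G (\<theta> x) = cnorm F x"
begin

lemma \<theta>_simps:
  "x \<in> carrier F \<Longrightarrow> \<theta> x \<in> carrier G"
  "x \<in> carrier F \<Longrightarrow> y \<in> carrier F \<Longrightarrow> \<theta> (x \<oplus>\<^bsub>F\<^esub> y) = \<theta> x \<oplus>\<^bsub>G\<^esub> \<theta> y"
  "x \<in> carrier F \<Longrightarrow> y \<in> carrier F \<Longrightarrow> \<theta> (x \<otimes>\<^bsub>F\<^esub> y) = \<theta> x \<otimes>\<^bsub>G\<^esub> \<theta> y"
  "\<theta> \<one>\<^bsub>F\<^esub> = \<one>\<^bsub>G\<^esub>"
  "x \<in> carrier F \<Longrightarrow> \<theta> (s \<odot>\<^bsub>F\<^esub> x) = s \<odot>\<^bsub>G\<^esub> \<theta> x"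
  "x \<in> carrier F \<Longrightarrow> \<theta> (adj F x) = adj G (\<theta> x)"
  using \<theta> by (auto simp: unital_star_mono_def ring_hom_def)

lemma \<theta>'_simps:
  "x \<in> carrier G \<Longrightarrow> \<theta>' x \<in> carrier F"
  "x \<in> carrier G \<Longrightarrow> y \<in> carrier G \<Longrightarrow> \<theta>' (x \<otimes>\<^bsub>G\<^esub> y) = \<theta>' x \<otimes>\<^bsub>F\<^esub> \<theta>' y"
  "x \<in> carrier G \<Longrightarrow> \<theta>' (adj G x) = adj F (\<theta>' x)"
  using \<theta>' by (auto simp: unital_star_mono_def ring_hom_def)

lemma \<theta>_minus: assumes "x \<in> carrier F" "y \<in> carrier F" shows "\<theta> (x \<ominus>\<^bsub>F\<^esub> y) = \<theta> x \<ominus>\<^bsub>G\<^esub> \<theta> y"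
proof -
  interpret F: cstar_record F by (rule cstar_record[OF F])
  interpret G: cstar_record G by (rule cstar_record[OF G])
  have "x \<ominus>\<^bsub>F\<^esub> y = x \<oplus>\<^bsub>F\<^esub> (-1) \<odot>\<^bsub>F\<^esub> y" using assms by (subst F.\<iota>_eq_iff[symmetric]) (auto simp: F.\<iota>_simps)
  moreover have "\<theta> x \<ominus>\<^bsub>G\<^esub> \<theta> y = \<theta> x \<oplus>\<^bsub>G\<^esub> (-1) \<odot>\<^bsub>G\<^esub> \<theta> y"
    using assms \<theta>_simps(1) by (subst G.\<iota>_eq_iff[symmetric]) (auto simp: G.\<iota>_simps)
  ultimately show ?thesis using assms \<theta>_simps F.smult_mem by simp
qed

lemma states_transport: "(\<lambda>\<phi>. restrict (\<phi> \<circ> \<theta>) (carrier F)) ` states G = states F"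
proof (intro subset_antisym subsetI)
  fix \<psi> assume "\<psi> \<in> (\<lambda>\<phi>. restrict (\<phi> \<circ> \<theta>) (carrier F)) ` states G"
  then show "\<psi> \<in> states F" using restrict_state_mono[OF F \<theta>] by blast
next
  fix \<psi> assume \<psi>: "\<psi> \<in> states F"
  have st: "restrict (\<psi> \<circ> \<theta>') (carrier G) \<in> states G" by (rule restrict_state_mono[OF G \<theta>' \<psi>])
  have "restrict (restrict (\<psi> \<circ> \<theta>') (carrier G) \<circ> \<theta>) (carrier F) = \<psi>"
    using \<psi> inverse \<theta>_simps(1) by (auto simp: states_def extensional_def restrict_def fun_eq_iff)
  then show "\<psi> \<in> (\<lambda>\<phi>. restrict (\<phi> \<circ> \<theta>) (carrier F)) ` states G" by (rule image_eqI[OF sym st])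
qed

lemma trace_transport:
  assumes "faithful_tracial_state F \<mu>"
  shows "faithful_tracial_state G (restrict (\<mu> \<circ> \<theta>') (carrier G))"
proof -
  interpret F: cstar_record F by (rule cstar_record[OF F])
  interpret G: cstar_record G by (rule cstar_record[OF G])
  have \<mu>: "\<mu> \<in> states F" using assms by (simp add: faithful_tracial_state_def)
  show ?thesis
    unfolding faithful_tracial_state_def
  proof (intro conjI ballI impI)
    show "restrict (\<mu> \<circ> \<theta>') (carrier G) \<in> states G" by (rule restrict_state_mono[OF G \<theta>' \<mu>])
  next
    fix a b assume "a \<in> carrier G" "b \<in> carrier G"
    then show "restrict (\<mu> \<circ> \<theta>') (carrier G) (a \<otimes>\<^bsub>G\<^esub> b) = restrict (\<mu> \<circ> \<theta>') (carrier G) (b \<otimes>\<^bsub>G\<^esub> a)"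
      using assms \<theta>'_simps by (simp add: faithful_tracial_state_def)
  next
    fix a assume a: "a \<in> carrier G" "restrict (\<mu> \<circ> \<theta>') (carrier G) (adj G a \<otimes>\<^bsub>G\<^esub> a) = 0"
    then have "\<mu> (adj F (\<theta>' a) \<otimes>\<^bsub>F\<^esub> \<theta>' a) = 0" using \<theta>'_simps by simp
    then have "\<theta>' a = \<zero>\<^bsub>F\<^esub>" using assms a(1) \<theta>'_simps(1) by (simp add: faithful_tracial_state_def)
    then have "cnorm G a = 0" using inverse(2)[OF a(1)] isometric[of "\<zero>\<^bsub>F\<^esub>"] by simp
    then show "a = \<zero>\<^bsub>G\<^esub>" using a(1) G.cnorm_eq_0 by simp
  qed
qed

text \<open>Expectations are determined by the trace and the subalgebra, hence transported by a trace-preserving isomorphism, and \<open>\<theta>\<close> is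
  isometric.\<close>

lemma lip_ball_transport:
  assumes T: "AF_trace F \<mu> V \<beta>" and W: "AF_sequence G W" "\<And>n. W n = \<theta> ` V n"
  shows "AF_trace G (restrict (\<mu> \<circ> \<theta>') (carrier G)) W \<beta>"
    and "lip_ball G (AF_lip G W (restrict (\<mu> \<circ> \<theta>') (carrier G)) \<beta>) = \<theta> ` lip_ball F (AF_lip F V \<mu> \<beta>)"
proof -
  let ?\<nu> = "restrict (\<mu> \<circ> \<theta>') (carrier G)"
  interpret F: AF_trace F \<mu> V \<beta> by (rule T)
  show AFG: "AF_trace G ?\<nu> W \<beta>"
    by (intro AF_trace.intro trace_record.intro cstar_record G trace_record_axioms.intro
        trace_transport[OF F.tracial] AF_trace_axioms.intro W(1) F.\<beta>_pos F.\<beta>_tendsto)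
  then interpret G: AF_trace G ?\<nu> W \<beta> .
  have dev: "G.dev n (\<theta> x) = F.dev n x" if x: "x \<in> carrier F" for x n
  proof -
    let ?p = "cond_exp F \<mu> (V n) x"
    have p: "?p \<in> V n" "?p \<in> carrier F" using x F.C.cond_exp_mem F.C.cond_exp_carrier by auto
    have "cond_exp G ?\<nu> (W n) (\<theta> x) = \<theta> ?p"
    proof (rule G.C.cond_exp_eqI)
      fix s assume "s \<in> W n"
      then obtain t where t: "t \<in> V n" "s = \<theta> t" using W(2) by auto
      then have tF: "t \<in> carrier F" using F.V_le by blast
      have "?\<nu> (s \<otimes>\<^bsub>G\<^esub> \<theta> y) = \<mu> (t \<otimes>\<^bsub>F\<^esub> y)" if "y \<in> carrier F" for y
        using t(2) tF that inverse(1) by (simp add: \<theta>_simps flip: \<theta>_simps(3))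
      then show "?\<nu> (s \<otimes>\<^bsub>G\<^esub> \<theta> x) = ?\<nu> (s \<otimes>\<^bsub>G\<^esub> \<theta> ?p)" using F.C.cond_exp_orth[OF x t(1)] x p by simp
    qed (use x p W(2) \<theta>_simps in auto)
    then have "G.dev n (\<theta> x) = cnorm G (\<theta> (x \<ominus>\<^bsub>F\<^esub> ?p))" using x p by (simp add: G.dev_def \<theta>_minus)
    then show ?thesis using isometric[of "x \<ominus>\<^bsub>F\<^esub> ?p"] x p by (simp add: F.dev_def)
  qed
  have sa: "\<theta> x \<in> sa G \<longleftrightarrow> x \<in> sa F" if "x \<in> carrier F" for x
  proof -
    have "\<theta> (adj F x) = \<theta> x \<longleftrightarrow> adj F x = x" using that inverse(1)[of x] inverse(1)[of "adj F x"] F.adj_mem by metis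
    then show ?thesis using that \<theta>_simps(1,6) by (simp add: sa_def)
  qed
  show "lip_ball G (AF_lip G W ?\<nu> \<beta>) = \<theta> ` lip_ball F (AF_lip F V \<mu> \<beta>)"
  proof (intro subset_antisym subsetI)
    fix y assume y: "y \<in> lip_ball G G.L"
    then have yG: "y \<in> carrier G" by (rule G.lip_ball_carrier)
    then have "\<theta>' y \<in> carrier F" "\<theta> (\<theta>' y) = y" using \<theta>'_simps inverse by auto
    then have "\<theta>' y \<in> lip_ball F F.L"
      using y dev[of "\<theta>' y"] sa[of "\<theta>' y"] by (simp add: G.lip_ball_iff F.lip_ball_iff)
    then show "y \<in> \<theta> ` lip_ball F F.L" using \<open>\<theta> (\<theta>' y) = y\<close> by (metis imageI)
  next
    fix y assume "y \<in> \<theta> ` lip_ball F F.L"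
    then obtain x where x: "x \<in> lip_ball F F.L" "y = \<theta> x" by auto
    then have "x \<in> carrier F" using F.lip_ball_carrier by blast
    then show "y \<in> lip_ball G G.L" using x dev[of x] sa[of x] by (simp add: G.lip_ball_iff F.lip_ball_iff)
  qed
qed

end

section \<open>Convergence of the quotients\<close>

context AF_ideal
begin

lemma quotient_sequence_eq: "quotient_sequence A U I n = proj ` U n"
proof -
  have "proj (u \<oplus> i) = proj u" if "u \<in> U n" "i \<in> I" for u i
  proof -
    have ui: "u \<in> carrier A" "i \<in> carrier A" using that U_le I_le by blast+
    then have "(u \<oplus> i) \<ominus> u = i" by (subst \<iota>_eq_iff[symmetric]) (auto simp: \<iota>_simps)
    then show ?thesis using that ui by (subst proj_eq_iff) auto
  qed
  moreover have "u \<oplus> \<zero> = u" if "u \<in> U n" for u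
  proof -
    have "u \<in> carrier A" using that U_le by blast
    then show ?thesis by (subst \<iota>_eq_iff[symmetric]) (auto simp: \<iota>_simps)
  qed
  ultimately show ?thesis
    unfolding quotient_sequence_def set_add_def' using I_closed(1)
    by (auto simp: image_iff)
qed

lemma proj_finsum:
  assumes "finite F" "F \<subseteq> carrier A"
  shows "emb Q (proj (\<Oplus>v\<in>F. s v \<odot> v)) = (\<Sum>v\<in>F. s v *\<^sub>C emb Q (proj v))"
  using assms
proof (induction F rule: finite_induct)
  case empty
  have "abelian_monoid A" using abelian_group_carrier by (simp add: abelian_group_def)
  then show ?case by (simp add: abelian_monoid.finsum_empty proj_zero emb_zero[OF unital_cstar_Q])
next
  case (insert v F)
  have am: "abelian_monoid A" using abelian_group_carrier by (simp add: abelian_group_def)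
  have eq: "(\<Oplus>v\<in>insert v F. s v \<odot> v) = s v \<odot> v \<oplus> (\<Oplus>v\<in>F. s v \<odot> v)"
    using insert by (intro abelian_monoid.finsum_insert[OF am]) auto
  have "(\<Oplus>v\<in>F. s v \<odot> v) \<in> carrier A" using insert by (intro finsum_smult_closed) auto
  then show ?case
    using insert unfolding eq
    by (simp add: proj_add emb_add[OF unital_cstar_Q] emb_smult[OF unital_cstar_Q] proj_smult
        unital_cstar.smult_mem[OF unital_cstar_Q])
qed

lemma finite_dimensional_proj: "finite_dimensional Q (proj ` U n)"
proof -
  interpret Q: cstar_record Q by (rule cstar_record[OF unital_cstar_Q])
  obtain F where F: "finite F" "F \<subseteq> U n" "\<And>x. x \<in> U n \<Longrightarrow> \<exists>s. x = (\<Oplus>v\<in>F. s v \<odot> v)"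
    using U_fd[of n] unfolding finite_dimensional_def by blast
  have FA: "F \<subseteq> carrier A" using F(2) U_le by blast
  have "\<exists>t. X = (\<Oplus>\<^bsub>Q\<^esub>w\<in>proj ` F. t w \<odot>\<^bsub>Q\<^esub> w)" if X: "X \<in> proj ` U n" for X
  proof -
    obtain x where x: "x \<in> U n" "X = proj x" using X by auto
    obtain s where s: "x = (\<Oplus>v\<in>F. s v \<odot> v)" using F(3)[OF x(1)] by (elim exE)
    \<comment> \<open>\<open>proj\<close> may identify elements of \<open>F\<close>; their coefficients add up\<close>
    define t where "t w = (\<Sum>v\<in>{v\<in>F. proj v = w}. s v)" for w
    have "emb Q X = (\<Sum>v\<in>F. s v *\<^sub>C emb Q (proj v))" unfolding x(2) s by (rule proj_finsum[OF F(1) FA])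
    also have "\<dots> = (\<Sum>w\<in>proj ` F. \<Sum>v\<in>{v\<in>F. proj v = w}. s v *\<^sub>C emb Q (proj v))" by (rule sum.image_gen[OF F(1)])
    also have "\<dots> = (\<Sum>w\<in>proj ` F. t w *\<^sub>C emb Q w)" by (simp add: t_def scaleC_sum_left)
    also have "\<dots> = emb Q (\<Oplus>\<^bsub>Q\<^esub>w\<in>proj ` F. t w \<odot>\<^bsub>Q\<^esub> w)"
      using F(1) FA by (intro Q.emb_finsum[symmetric]) auto
    finally have "X = (\<Oplus>\<^bsub>Q\<^esub>w\<in>proj ` F. t w \<odot>\<^bsub>Q\<^esub> w)"
      using F(1) FA x U_le Q.finsum_smult_closed[of "proj ` F" t] by (subst (asm) Q.\<iota>_eq_iff) auto
    then show ?thesis by blast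
  qed
  then show ?thesis unfolding finite_dimensional_def using F(1,2) by (intro exI[of _ "proj ` F"]) auto
qed

lemma AF_sequence_Q: "AF_sequence Q (quotient_sequence A U I)"
proof -
  interpret Q: cstar_record Q by (rule cstar_record[OF unital_cstar_Q])
  have sub: "unital_cstar_subalgebra Q (proj ` U n)" for n
  proof (rule Q.unital_cstar_subalgebraI[OF _ finite_dimensional_proj])
    note S = subalgebraD[OF U_sub[of n]]
    show "proj ` U n \<subseteq> carrier Q" using S(1) by auto
    show "\<one>\<^bsub>Q\<^esub> \<in> proj ` U n" using S(3) proj_one by (metis imageI)
    fix X Y s assume "X \<in> proj ` U n"
    then obtain x where x: "x \<in> U n" "X = proj x" "x \<in> carrier A" using S(1) by auto
    show "s \<odot>\<^bsub>Q\<^esub> X \<in> proj ` U n" "adj Q X \<in> proj ` U n"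
      using x S(8,9)[of x] by (auto simp flip: proj_smult proj_adj)
    assume "Y \<in> proj ` U n"
    then obtain y where y: "y \<in> U n" "Y = proj y" "y \<in> carrier A" using S(1) by auto
    show "X \<oplus>\<^bsub>Q\<^esub> Y \<in> proj ` U n" "X \<otimes>\<^bsub>Q\<^esub> Y \<in> proj ` U n"
      using x y S(5,6)[of x y] by (auto simp flip: proj_add proj_mult)
  qed
  have "X \<in> cstar_topology Q closure_of (\<Union>n. proj ` U n)" if X: "X \<in> carrier Q" for X
  proof -
    obtain x where x: "x \<in> carrier A" "X = proj x" using X by (auto simp: carrier_Q)
    have "\<exists>y\<in>emb Q ` (\<Union>n. proj ` U n). dist y (emb Q X) < \<epsilon>" if "\<epsilon> > 0" for \<epsilon>
    proof -
      have "\<iota> x \<in> closure (\<Union>n. \<iota> ` U n)" using emb_U_dense x(1) by blast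
      then obtain n u where u: "u \<in> U n" "dist (\<iota> u) (\<iota> x) < \<epsilon>"
        using \<open>\<epsilon> > 0\<close> unfolding closure_approachable by blast
      have uA: "u \<in> carrier A" using u U_le by blast
      have "dist (emb Q (proj u)) (emb Q X) = infdist (\<iota> u - \<iota> x) (\<iota> ` I)"
        using x uA Q.cdist_eq_dist[of "proj u" X] by (simp add: cdist_proj)
      also have "\<dots> \<le> dist (\<iota> u) (\<iota> x)" unfolding dist_norm by (rule I.quot_norm_le_norm)
      finally show ?thesis using u by (intro bexI[of _ "emb Q (proj u)"]) auto
    qed
    then show ?thesis
      using X U_le by (subst Q.closure_of_iff) (auto simp: closure_approachable)
  qed
  moreover have "cstar_topology Q closure_of (\<Union>n. proj ` U n) \<subseteq> carrier Q"
    using closure_of_subset_topspace Q.topspace_cstar_topology by metis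
  ultimately have dense: "cstar_topology Q closure_of (\<Union>n. proj ` U n) = carrier Q" by blast
  have "proj ` U 0 = range (\<lambda>s. proj (s \<odot> \<one>))" by (auto simp: U_0)
  then have zero: "proj ` U 0 = {s \<odot>\<^bsub>Q\<^esub> \<one>\<^bsub>Q\<^esub> | s. True}"
    by (simp add: proj_smult proj_one full_SetCompr_eq)
  then show ?thesis
    unfolding AF_sequence_def quotient_sequence_eq
    by (intro conjI allI sub finite_dimensional_proj dense image_mono U_Suc zero)
qed

end

text \<open>The canonical map between the images of \<open>S\<close> in two quotients; it is well defined as soon as
  both ideals meet \<open>S\<close> in the same set.\<close>

definition quotient_transfer :: "'a cstar \<Rightarrow> 'a set \<Rightarrow> 'a set \<Rightarrow> 'a set \<Rightarrow> 'a set \<Rightarrow> 'a set" where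
  "quotient_transfer A S I J X = quotient_proj A J (SOME x. x \<in> S \<and> quotient_proj A I x = X)"

locale two_AF_ideals = I: AF_ideal A I U + J: AF_ideal A J U
  for A :: "'a cstar" (structure) and I J and U :: "nat \<Rightarrow> 'a set" +
  fixes N :: nat
  assumes Int_eq: "I \<inter> U N = J \<inter> U N"
begin

abbreviation \<theta> :: "'a set \<Rightarrow> 'a set" where "\<theta> \<equiv> quotient_transfer A (U N) I J"

lemma \<theta>_proj: assumes x: "x \<in> U N" shows "\<theta> (I.proj x) = J.proj x"
proof -
  define y where "y = (SOME y. y \<in> U N \<and> I.proj y = I.proj x)"
  have "y \<in> U N \<and> I.proj y = I.proj x" unfolding y_def by (rule someI[of _ x]) (use x in simp)
  then have y: "y \<in> U N" "I.proj y = I.proj x" by auto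
  have in_A: "x \<in> carrier A" "y \<in> carrier A" using x y I.U_le by auto
  have "y \<ominus> x \<in> I \<inter> U N"
    using y x I.proj_eq_iff[OF in_A(2,1)] I.subalgebraD(7)[OF I.U_sub] by auto
  then have "y \<ominus> x \<in> J" using Int_eq by blast
  then have "J.proj y = J.proj x" using J.proj_eq_iff[OF in_A(2,1)] by simp
  then show ?thesis by (simp add: quotient_transfer_def y_def)
qed

abbreviation F :: "'a set cstar" where "F \<equiv> I.Q\<lparr>carrier := I.proj ` U N\<rparr>"
abbreviation G :: "'a set cstar" where "G \<equiv> J.Q\<lparr>carrier := J.proj ` U N\<rparr>"

lemma unital_cstar_F: "unital_cstar F"
proof -
  interpret Q: cstar_record I.Q by (rule cstar_record[OF I.unital_cstar_Q])
  have "unital_cstar_subalgebra I.Q (I.proj ` U N)"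
    using I.AF_sequence_Q by (simp add: AF_sequence_def I.quotient_sequence_eq)
  then show ?thesis by (rule Q.unital_cstar_subrecord)
qed

lemma unital_star_mono_\<theta>: "unital_star_mono F G \<theta>"
  unfolding unital_star_mono_def
proof (intro conjI)
  note S = I.subalgebraD[OF I.U_sub[of N]]
  have mem: "x \<in> carrier A" if "x \<in> U N" for x using that S(1) by blast
  have pair: "P X Y" if "X \<in> carrier F" "Y \<in> carrier F" "\<And>x y. x \<in> U N \<Longrightarrow> y \<in> U N \<Longrightarrow> P (I.proj x) (I.proj y)"
    for P X Y using that by auto
  show "\<theta> \<in> ring_hom F G"
  proof (rule ring_hom_memI)
    fix X Y assume XY: "X \<in> carrier F" "Y \<in> carrier F"
    show "\<theta> (X \<otimes>\<^bsub>F\<^esub> Y) = \<theta> X \<otimes>\<^bsub>G\<^esub> \<theta> Y" "\<theta> (X \<oplus>\<^bsub>F\<^esub> Y) = \<theta> X \<oplus>\<^bsub>G\<^esub> \<theta> Y"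
      by (rule pair[OF XY]; simp add: mem S \<theta>_proj J.proj_mult J.proj_add flip: I.proj_mult I.proj_add)+
  next
    fix X assume "X \<in> carrier F"
    then show "\<theta> X \<in> carrier G" by (auto simp: \<theta>_proj)
  next
    show "\<theta> \<one>\<^bsub>F\<^esub> = \<one>\<^bsub>G\<^esub>" using \<theta>_proj[OF S(3)] by (simp add: I.proj_one J.proj_one)
  qed
  show "inj_on \<theta> (carrier F)"
  proof (rule inj_onI)
    fix X Y assume "X \<in> carrier F" "Y \<in> carrier F" and eq: "\<theta> X = \<theta> Y"
    then obtain x y where xy: "x \<in> U N" "X = I.proj x" "y \<in> U N" "Y = I.proj y" by auto
    then have "x \<ominus> y \<in> J \<inter> U N"
      using eq J.proj_eq_iff[of x y] mem S(7) by (simp add: \<theta>_proj)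
    then have "x \<ominus> y \<in> I" using Int_eq by blast
    then show "X = Y" using xy I.proj_eq_iff[of x y] mem by simp
  qed
  show "\<forall>s. \<forall>X\<in>carrier F. \<theta> (s \<odot>\<^bsub>F\<^esub> X) = s \<odot>\<^bsub>G\<^esub> \<theta> X"
    by (auto simp: mem S \<theta>_proj J.proj_smult simp flip: I.proj_smult)
  show "\<forall>X\<in>carrier F. \<theta> (adj F X) = adj G (\<theta> X)"
    by (auto simp: mem S \<theta>_proj J.proj_adj simp flip: I.proj_adj)
qed

lemma isometric_\<theta>: assumes "X \<in> carrier F" shows "cnorm G (\<theta> X) = cnorm F X"
proof -
  obtain x where x: "x \<in> U N" "X = I.proj x" using assms by auto
  then have xA: "x \<in> carrier A" using I.U_le by blast
  obtain H where H: "finite H" "I.\<iota> ` U N \<subseteq> span H" using I.finite_dimensional_emb[OF I.U_fd I.U_le] by blast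
  have "I.\<iota> ` U N \<inter> I.\<iota> ` I = I.\<iota> ` (I \<inter> U N)"
    by (subst inj_on_image_Int[OF I.inj_emb, symmetric]) (use I.U_le I.I_le in \<open>auto simp: Int_commute\<close>)
  moreover have "I.\<iota> ` U N \<inter> I.\<iota> ` J = I.\<iota> ` (J \<inter> U N)"
    by (subst inj_on_image_Int[OF I.inj_emb, symmetric]) (use I.U_le J.I_le in \<open>auto simp: Int_commute\<close>)
  ultimately have "infdist (I.\<iota> x) (I.\<iota> ` I) = infdist (I.\<iota> x) (I.\<iota> ` J)"
    using Int_eq x(1)
    by (intro quot_norm_eq_of_Int_eq[OF I.closed_ideal_emb J.closed_ideal_emb I.cstar_subalgebra_emb[OF I.U_sub]
          image_mono[OF I.U_le] H]) auto
  then show ?thesis using x xA by (simp add: \<theta>_proj I.cnorm_proj J.cnorm_proj)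
qed

end

lemma star_isomorphism_quotient_transfer:
  assumes "two_AF_ideals A I J U N"
  shows "star_isomorphism (cstar_quotient A I\<lparr>carrier := quotient_proj A I ` U N\<rparr>)
    (cstar_quotient A J\<lparr>carrier := quotient_proj A J ` U N\<rparr>)
    (quotient_transfer A (U N) I J) (quotient_transfer A (U N) J I)"
proof -
  interpret IJ: two_AF_ideals A I J U N by (rule assms)
  have "two_AF_ideals A J I U N"
    using IJ.I.AF_ideal_axioms IJ.J.AF_ideal_axioms IJ.Int_eq
    by (simp add: two_AF_ideals_def two_AF_ideals_axioms_def)
  then interpret JI: two_AF_ideals A J I U N .
  show ?thesis
  proof (rule star_isomorphism.intro)
    fix X assume "X \<in> carrier IJ.F"
    then obtain x where "x \<in> U N" "X = IJ.I.proj x" by auto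
    then show "JI.\<theta> (IJ.\<theta> X) = X" by (simp add: IJ.\<theta>_proj JI.\<theta>_proj)
  next
    fix X assume "X \<in> carrier IJ.G"
    then obtain x where "x \<in> U N" "X = IJ.J.proj x" by auto
    then show "IJ.\<theta> (JI.\<theta> X) = X" by (simp add: IJ.\<theta>_proj JI.\<theta>_proj)
  qed (fact IJ.unital_cstar_F JI.unital_cstar_F IJ.unital_star_mono_\<theta> JI.unital_star_mono_\<theta> IJ.isometric_\<theta>)+
qed

text \<open>The convergence hypotheses enter through two consequences: the ideals eventually have the same intersection with each
  \<open>U N\<close>, and the traces converge pointwise on \<open>U N\<close>.\<close>

locale convergent_quotients =
  fixes A :: "'a cstar" (structure) and U :: "nat \<Rightarrow> 'a set" and I :: "enat \<Rightarrow> 'a set"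
    and \<mu> :: "enat \<Rightarrow> 'a set \<Rightarrow> complex" and c :: "nat \<Rightarrow> nat"
    and \<beta> :: "enat \<Rightarrow> nat \<Rightarrow> real" and bd :: "nat \<Rightarrow> real"
  assumes A: "unital_cstar A" and AF: "AF_sequence A U"
    and I: "\<And>k. I k \<in> closed_ideals A"
    and \<mu>: "\<And>k. faithful_tracial_state (cstar_quotient A (I k)) (\<mu> k)"
    and fusing: "\<And>N k. c N \<le> k \<Longrightarrow> I (enat k) \<inter> U N = I \<infinity> \<inter> U N"
    and \<mu>_tendsto: "\<And>N x. x \<in> U N \<Longrightarrow>
      (\<lambda>j. \<mu> (enat (c N + j)) (quotient_proj A (I (enat (c N + j))) x)) \<longlonglongrightarrow> \<mu> \<infinity> (quotient_proj A (I \<infinity>) x)"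
    and \<beta>_pos: "\<And>k n. 0 < \<beta> k n"
    and \<beta>_eq: "\<And>N k n. c N \<le> k \<Longrightarrow> n \<le> N \<Longrightarrow> \<beta> (enat k) n = \<beta> \<infinity> n"
    and bd_tendsto: "bd \<longlonglongrightarrow> 0" and \<beta>_le: "\<And>k n. \<beta> k n \<le> bd n"
begin

abbreviation Qk :: "enat \<Rightarrow> 'a set cstar" where "Qk k \<equiv> cstar_quotient A (I k)"
abbreviation Vk :: "enat \<Rightarrow> nat \<Rightarrow> 'a set set" where "Vk k \<equiv> quotient_sequence A U (I k)"

lemma AF_ideal_k: "AF_ideal A (I k) U"
  by (intro AF_ideal.intro cstar_ideal.intro cstar_record A cstar_ideal_axioms.intro I AF_ideal_axioms.intro AF)

lemma Vk_eq: "Vk k n = quotient_proj A (I k) ` U n"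
  using AF_ideal.quotient_sequence_eq[OF AF_ideal_k] .

lemma AF_trace_k: "AF_trace (Qk k) (\<mu> k) (Vk k) (\<beta> k)"
proof -
  have "\<beta> k \<longlonglongrightarrow> 0"
    by (rule tendsto_sandwich[OF _ _ tendsto_const bd_tendsto]) (auto simp: \<beta>_le \<beta>_pos less_imp_le)
  then show ?thesis
    by (intro AF_trace.intro trace_record.intro cstar_record trace_record_axioms.intro \<mu> AF_trace_axioms.intro
        AF_ideal.unital_cstar_Q[OF AF_ideal_k] AF_ideal.AF_sequence_Q[OF AF_ideal_k] \<beta>_pos)
qed

lemma AF_trace_level_k: "AF_trace_level (Qk k) (\<mu> k) (Vk k) (\<beta> k)"
  by (intro AF_trace_level.intro AF_trace_k)

abbreviation Bk :: "nat \<Rightarrow> enat \<Rightarrow> 'a set cstar" where "Bk N k \<equiv> Qk k\<lparr>carrier := Vk k N\<rparr>"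
abbreviation LB :: "nat \<Rightarrow> enat \<Rightarrow> 'a set \<Rightarrow> ennreal" where
  "LB N k \<equiv> AF_lip (Bk N k) (\<lambda>n. Vk k (min n N)) (restrict (\<mu> k) (Vk k N)) (\<beta> k)"

lemma U_mono: assumes "m \<le> n" shows "U m \<subseteq> U n"
proof (rule lift_Suc_mono_le[OF _ assms])
  show "U k \<subseteq> U (Suc k)" for k using AF by (simp add: AF_sequence_def)
qed

lemma level_isomorphism:
  assumes "c N \<le> k"
  shows "star_isomorphism (Bk N (enat k)) (Bk N \<infinity>)
      (quotient_transfer A (U N) (I (enat k)) (I \<infinity>)) (quotient_transfer A (U N) (I \<infinity>) (I (enat k)))"
    and "\<And>x. x \<in> U N \<Longrightarrow> quotient_transfer A (U N) (I (enat k)) (I \<infinity>) (quotient_proj A (I (enat k)) x) = quotient_proj A (I \<infinity>) x"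
    and "\<And>x. x \<in> U N \<Longrightarrow> quotient_transfer A (U N) (I \<infinity>) (I (enat k)) (quotient_proj A (I \<infinity>) x) = quotient_proj A (I (enat k)) x"
proof -
  have IJ: "two_AF_ideals A (I (enat k)) (I \<infinity>) U N" "two_AF_ideals A (I \<infinity>) (I (enat k)) U N"
    using fusing[OF assms] by (auto intro!: two_AF_ideals.intro AF_ideal_k two_AF_ideals_axioms.intro)
  show "star_isomorphism (Bk N (enat k)) (Bk N \<infinity>)
      (quotient_transfer A (U N) (I (enat k)) (I \<infinity>)) (quotient_transfer A (U N) (I \<infinity>) (I (enat k)))"
    unfolding Vk_eq by (rule star_isomorphism_quotient_transfer[OF IJ(1)])
  show "\<And>x. x \<in> U N \<Longrightarrow> quotient_transfer A (U N) (I (enat k)) (I \<infinity>) (quotient_proj A (I (enat k)) x) = quotient_proj A (I \<infinity>) x"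
    "\<And>x. x \<in> U N \<Longrightarrow> quotient_transfer A (U N) (I \<infinity>) (I (enat k)) (quotient_proj A (I \<infinity>) x) = quotient_proj A (I (enat k)) x"
    by (rule two_AF_ideals.\<theta>_proj[OF IJ(1)] two_AF_ideals.\<theta>_proj[OF IJ(2)], assumption)+
qed

text \<open>All algebras \<open>Bk N k\<close> with \<open>c N \<le> k\<close> are copies of \<open>Bk N \<infinity>\<close>, which serves as the bridge algebra; the
  transported traces converge, and with them the Lip balls.\<close>

lemma eventually_level_bridge:
  assumes r: "0 < r"
  shows "\<forall>\<^sub>F k in sequentially. \<exists>\<gamma> :: ('a set, 'a set, 'a set) bridge.
    is_bridge (Bk N (enat k)) (Bk N \<infinity>) \<gamma> \<and>
    bridge_length \<gamma> (Bk N (enat k), LB N (enat k)) (Bk N \<infinity>, LB N \<infinity>) \<le> ennreal r"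
proof -
  interpret M: AF_trace_level "Qk \<infinity>" "\<mu> \<infinity>" "Vk \<infinity>" "\<beta> \<infinity>" N by (rule AF_trace_level_k)
  let ?G = "Bk N \<infinity>" and ?V = "\<lambda>n. Vk \<infinity> (min n N)" and ?m = "restrict (\<mu> \<infinity>) (Vk \<infinity> N)"
  let ?\<theta> = "\<lambda>k. quotient_transfer A (U N) (I (enat k)) (I \<infinity>)"
  let ?\<theta>' = "\<lambda>k. quotient_transfer A (U N) (I \<infinity>) (I (enat k))"
  let ?\<nu> = "\<lambda>k. restrict (restrict (\<mu> (enat k)) (Vk (enat k) N) \<circ> ?\<theta>' k) (carrier ?G)"
  define b where "b = Min (\<beta> \<infinity> ` {..N})"
  have b: "0 < b" "\<And>n. n \<le> N \<Longrightarrow> b \<le> \<beta> \<infinity> n" using \<beta>_pos by (auto simp: b_def Min_le)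
  obtain H where H: "finite H" "H \<subseteq> M.B.\<iota> ` ?V N" "span H = M.B.\<iota> ` ?V N" by (rule M.B.C.E.finite_basis)
  have H_carrier: "span H = M.B.\<iota> ` carrier ?G" using H(3) by simp
  obtain \<kappa> where \<kappa>: "\<kappa> > 0" "\<And>u. u \<in> M.B.\<iota> ` carrier ?G \<Longrightarrow> \<kappa> * (norm u)\<^sup>2 \<le> M.B.T.sqnorm u"
    using M.B.T.sqnorm_coercive[OF H(1)] H_carrier by auto
  \<comment> \<open>chosen such that \<open>lip_ball_perturb\<close> yields exactly \<open>r\<close>, and \<open>expect_perturb\<close> yields \<open>\<delta>\<close>\<close>
  define \<delta> where "\<delta> = r * b / (\<beta> \<infinity> 0 * \<beta> \<infinity> 0)"
  define \<tau> where "\<tau> = \<delta> * \<kappa> / 2"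
  have \<delta>: "\<delta> > 0" "\<tau> > 0" using r b(1) \<kappa>(1) \<beta>_pos by (auto simp: \<delta>_def \<tau>_def)
  have \<delta>_eq: "2 * \<tau> / \<kappa> = \<delta>" "\<delta> * \<beta> \<infinity> 0 / b * \<beta> \<infinity> 0 = r"
    using \<kappa>(1) b(1) \<beta>_pos[of \<infinity> 0] by (auto simp: \<tau>_def \<delta>_def)
  have iso: "star_isomorphism (Bk N (enat k)) ?G (?\<theta> k) (?\<theta>' k)" if "c N \<le> k" for k
    by (rule level_isomorphism(1)[OF that])
  have level: "AF_trace (Bk N (enat k)) (restrict (\<mu> (enat k)) (Vk (enat k) N)) (\<lambda>n. Vk (enat k) (min n N)) (\<beta> (enat k))" for k
  proof -
    interpret K: AF_trace_level "Qk (enat k)" "\<mu> (enat k)" "Vk (enat k)" "\<beta> (enat k)" N by (rule AF_trace_level_k)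
    show ?thesis by (rule K.B.AF_trace_axioms)
  qed
  have V_transfer: "?V n = ?\<theta> k ` Vk (enat k) (min n N)" if "c N \<le> k" for n k
  proof -
    have "x \<in> U N" if "x \<in> U (min n N)" for x using that U_mono[of "min n N" N] by auto
    then show ?thesis unfolding Vk_eq image_image
      by (intro image_cong refl) (simp add: level_isomorphism(2)[OF \<open>c N \<le> k\<close>])
  qed
  note transport = star_isomorphism.lip_ball_transport[OF iso level M.AF_sequence_B V_transfer]
  have \<nu>_state: "?\<nu> k \<in> states ?G" if "c N \<le> k" for k
    using trace_record.\<mu>_state[OF AF_trace.axioms(1)[OF transport(1)[OF that that]]] .
  have "\<forall>\<^sub>F j in sequentially. \<forall>x\<in>carrier ?G. cmod (?\<nu> (c N + j) x - ?m x) \<le> \<tau> * cnorm ?G x"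
  proof (rule M.B.states_converge_uniformly[OF _ _ M.B.\<mu>_state _ \<delta>(2)])
    show "finite_dimensional ?G (carrier ?G)" using M.B.V_fd[of N] by simp
    show "?\<nu> (c N + j) \<in> states ?G" for j by (rule \<nu>_state) simp
    fix y assume y: "y \<in> carrier ?G"
    then obtain x where x: "x \<in> U N" "y = quotient_proj A (I \<infinity>) x" by (auto simp: Vk_eq)
    have "?\<nu> (c N + j) y = \<mu> (enat (c N + j)) (quotient_proj A (I (enat (c N + j))) x)" for j
      using y level_isomorphism(3)[of N "c N + j" x] x by (auto simp: Vk_eq)
    then show "(\<lambda>j. ?\<nu> (c N + j) y) \<longlonglongrightarrow> ?m y" using \<mu>_tendsto[OF x(1)] y x by simp
  qed
  then obtain J where J: "\<And>j x. J \<le> j \<Longrightarrow> x \<in> carrier ?G \<Longrightarrow> cmod (?\<nu> (c N + j) x - ?m x) \<le> \<tau> * cnorm ?G x"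
    unfolding eventually_sequentially by blast
  have "is_bridge (Bk N (enat k)) ?G (unit_bridge ?G (?\<theta> k) (\<lambda>x. x)) \<and>
      bridge_length (unit_bridge ?G (?\<theta> k) (\<lambda>x. x)) (Bk N (enat k), LB N (enat k)) (?G, LB N \<infinity>) \<le> ennreal r"
    if k: "c N + J \<le> k" for k
  proof -
    have ck: "c N \<le> k" using k by simp
    have close: "cmod (?\<nu> k x - ?m x) \<le> \<tau> * cnorm ?G x" if "x \<in> carrier ?G" for x
      using J[of "k - c N" x] that k by simp
    interpret S: star_isomorphism "Bk N (enat k)" ?G "?\<theta> k" "?\<theta>' k" by (rule iso[OF ck])
    interpret N: AF_trace ?G "?\<nu> k" ?V "\<beta> (enat k)" by (rule transport(1)[OF ck ck])
    have expect_diff: "norm (N.C.E.expect n (M.B.\<iota> a) - M.B.C.E.expect n (M.B.\<iota> a)) \<le> \<delta> * cnorm ?G a"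
      if a: "a \<in> carrier ?G" for n a
    proof -
      have "norm (N.C.E.expect n (M.B.\<iota> a) - M.B.C.E.expect n (M.B.\<iota> a)) \<le> 2 * \<tau> / \<kappa> * norm (M.B.\<iota> a)"
      proof (rule expect_perturb[OF M.B.C.finite_dim_expectation_emb N.C.finite_dim_expectation_emb _ \<kappa>(1)])
        fix u assume "u \<in> M.B.\<iota> ` carrier ?G"
        then obtain x where x: "x \<in> carrier ?G" "u = M.B.\<iota> x" by blast
        show "cmod (M.B.pull (?\<nu> k) u - M.B.pull ?m u) \<le> \<tau> * norm u"
          unfolding x(2) M.B.pull_emb[OF x(1)] M.B.\<iota>_norm[OF x(1)] by (rule close[OF x(1)])
      next
        fix u assume "u \<in> M.B.\<iota> ` ?V n"
        then have "u \<in> M.B.\<iota> ` carrier ?G" using M.B.V_le by blast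
        then show "\<kappa> * (norm u)\<^sup>2 \<le> M.B.T.sqnorm u" by (rule \<kappa>(2))
      qed (use a in blast)
      then show ?thesis using a by (simp add: \<delta>_eq M.B.\<iota>_norm)
    qed
    have dev1: "M.B.dev n a \<le> N.dev n a + \<delta> * cnorm ?G a" if a: "a \<in> carrier ?G" for n a
      using expect_diff[OF a, of n] M.B.dev_emb[OF a, of n] N.dev_emb[OF a, of n]
        norm_triangle_ineq[of "M.B.\<iota> a - N.C.E.expect n (M.B.\<iota> a)" "N.C.E.expect n (M.B.\<iota> a) - M.B.C.E.expect n (M.B.\<iota> a)"]
      by simp
    have dev2: "N.dev n a \<le> M.B.dev n a + \<delta> * cnorm ?G a" if a: "a \<in> carrier ?G" for n a
      using expect_diff[OF a, of n] M.B.dev_emb[OF a, of n] N.dev_emb[OF a, of n]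
        norm_triangle_ineq[of "M.B.\<iota> a - M.B.C.E.expect n (M.B.\<iota> a)" "M.B.C.E.expect n (M.B.\<iota> a) - N.C.E.expect n (M.B.\<iota> a)"]
        norm_minus_commute[of "M.B.C.E.expect n (M.B.\<iota> a)" "N.C.E.expect n (M.B.\<iota> a)"]
      by simp
    have full: "?V N = carrier ?G" by simp
    have \<beta>k: "\<beta> (enat k) n = \<beta> \<infinity> n" if "n \<le> N" for n by (rule \<beta>_eq[OF ck that])
    have down: "\<exists>d\<in>lip_ball ?G (LB N \<infinity>). cnorm ?G (a \<ominus>\<^bsub>?G\<^esub> d) \<le> r"
      if "a \<in> lip_ball ?G (AF_lip ?G ?V (?\<nu> k) (\<beta> (enat k)))" for a
      using lip_ball_perturb[OF M.B.AF_trace_axioms N.AF_trace_axioms full \<beta>k less_imp_le[OF \<delta>(1)] dev1 b that]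
      unfolding \<delta>_eq(2) .
    have b': "b \<le> \<beta> (enat k) n" if "n \<le> N" for n using b(2)[OF that] \<beta>k[OF that] by simp
    have up: "\<exists>d\<in>lip_ball ?G (AF_lip ?G ?V (?\<nu> k) (\<beta> (enat k))). cnorm ?G (a \<ominus>\<^bsub>?G\<^esub> d) \<le> r"
      if "a \<in> lip_ball ?G (LB N \<infinity>)" for a
      using lip_ball_perturb[OF N.AF_trace_axioms M.B.AF_trace_axioms full \<beta>k[symmetric] less_imp_le[OF \<delta>(1)] dev2 b(1) b' that]
      unfolding \<beta>k[OF le0] \<delta>_eq(2) .
    have ball: "lip_ball ?G (AF_lip ?G ?V (?\<nu> k) (\<beta> (enat k))) = ?\<theta> k ` lip_ball (Bk N (enat k)) (LB N (enat k))"
      by (rule transport(2)[OF ck ck])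
    have lr: "\<exists>d\<in>lip_ball ?G (LB N \<infinity>). cnorm ?G (?\<theta> k a \<ominus>\<^bsub>?G\<^esub> d) \<le> r"
      if "a \<in> lip_ball (Bk N (enat k)) (LB N (enat k))" for a
      using down[of "?\<theta> k a"] that ball by blast
    have rl: "\<exists>a\<in>lip_ball (Bk N (enat k)) (LB N (enat k)). cnorm ?G (?\<theta> k a \<ominus>\<^bsub>?G\<^esub> d) \<le> r"
      if d: "d \<in> lip_ball ?G (LB N \<infinity>)" for d
    proof -
      obtain y where y: "y \<in> lip_ball ?G (AF_lip ?G ?V (?\<nu> k) (\<beta> (enat k)))" "cnorm ?G (d \<ominus>\<^bsub>?G\<^esub> y) \<le> r"
        using up[OF d] by blast
      have "cnorm ?G (y \<ominus>\<^bsub>?G\<^esub> d) \<le> r"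
        using y(2) M.B.minus_commute_norm[OF M.B.lip_ball_carrier[OF d] N.lip_ball_carrier[OF y(1)]] by simp
      then show ?thesis using y(1) unfolding ball by blast
    qed
    have ne: "states ?G \<noteq> {}" using M.B.\<mu>_state by blast
    show ?thesis
      using unit_bridge_length[OF M.cstar_B ne S.\<theta> unital_star_mono_id S.states_transport restrict_states_id lr rl] by blast
  qed
  then show ?thesis unfolding eventually_sequentially by blast
qed

theorem quantum_propinquity_tendsto:
  "(\<lambda>n. quantum_propinquity (Qk (enat n), AF_lip (Qk (enat n)) (Vk (enat n)) (\<mu> (enat n)) (\<beta> (enat n)))
      (Qk \<infinity>, AF_lip (Qk \<infinity>) (Vk \<infinity>) (\<mu> \<infinity>) (\<beta> \<infinity>))) \<longlonglongrightarrow> 0"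
    (is "(\<lambda>n. quantum_propinquity (?X n) ?Y) \<longlonglongrightarrow> 0")
proof (rule order_tendstoI)
  fix t :: ennreal assume "0 < t"
  then obtain s where s: "0 < s" "s < t" using dense by blast
  then have "s < top_class.top" using less_le_trans[OF s(2) top_greatest] by simp
  then obtain \<epsilon> where \<epsilon>: "s = ennreal \<epsilon>" "0 < \<epsilon>" using s(1) by (cases s) auto
  obtain N where N: "bd N < \<epsilon> / 3"
    using order_tendstoD(2)[OF bd_tendsto, of "\<epsilon> / 3"] \<epsilon>(2) by (auto simp: eventually_sequentially)
  from eventually_level_bridge[of "\<epsilon> / 3" N] \<epsilon>(2)
  have "\<forall>\<^sub>F k in sequentially. \<exists>\<gamma> :: ('a set, 'a set, 'a set) bridge.
      is_bridge (Bk N (enat k)) (Bk N \<infinity>) \<gamma> \<and>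
      bridge_length \<gamma> (Bk N (enat k), LB N (enat k)) (Bk N \<infinity>, LB N \<infinity>) \<le> ennreal (\<epsilon> / 3)" by simp
  then show "\<forall>\<^sub>F n in sequentially. quantum_propinquity (?X n) ?Y < t"
  proof (rule eventually_mono)
    fix k assume "\<exists>\<gamma> :: ('a set, 'a set, 'a set) bridge.
      is_bridge (Bk N (enat k)) (Bk N \<infinity>) \<gamma> \<and>
      bridge_length \<gamma> (Bk N (enat k), LB N (enat k)) (Bk N \<infinity>, LB N \<infinity>) \<le> ennreal (\<epsilon> / 3)"
    then obtain \<gamma> :: "('a set, 'a set, 'a set) bridge" where
      \<gamma>: "is_bridge (Bk N (enat k)) (Bk N \<infinity>) \<gamma>"
        "bridge_length \<gamma> (Bk N (enat k), LB N (enat k)) (Bk N \<infinity>, LB N \<infinity>) \<le> ennreal (\<epsilon> / 3)" by blast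
    interpret K: AF_trace_level "Qk (enat k)" "\<mu> (enat k)" "Vk (enat k)" "\<beta> (enat k)" N by (rule AF_trace_level_k)
    interpret M: AF_trace_level "Qk \<infinity>" "\<mu> \<infinity>" "Vk \<infinity>" "\<beta> \<infinity>" N by (rule AF_trace_level_k)
    let ?idK = "unit_bridge (Qk (enat k)) (\<lambda>x. x) (\<lambda>x. x)" and ?idM = "unit_bridge (Qk \<infinity>) (\<lambda>x. x) (\<lambda>x. x)"
    have "quantum_propinquity (?X k) ?Y \<le>
        bridge_length ?idK (?X k) (Bk N (enat k), LB N (enat k)) +
        bridge_length \<gamma> (Bk N (enat k), LB N (enat k)) (Bk N \<infinity>, LB N \<infinity>) +
        bridge_length ?idM (Bk N \<infinity>, LB N \<infinity>) ?Y"
      by (rule quantum_propinquity_le_chain)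
        (use K.QQCMS_AF K.B.QQCMS_AF M.B.QQCMS_AF M.QQCMS_AF K.level_bridge(1) \<gamma>(1) M.level_bridge(3) in simp_all)
    also have "\<dots> \<le> ennreal (\<beta> (enat k) N) + ennreal (\<epsilon> / 3) + ennreal (\<beta> \<infinity> N)"
      by (intro add_mono K.level_bridge(2) \<gamma>(2) M.level_bridge(4))
    also have "\<dots> \<le> ennreal (\<epsilon> / 3) + ennreal (\<epsilon> / 3) + ennreal (\<epsilon> / 3)"
      using N \<beta>_le[of "enat k" N] \<beta>_le[of \<infinity> N] by (intro add_mono ennreal_leI) auto
    also have "\<dots> = ennreal \<epsilon>" using \<epsilon>(2) by (simp flip: ennreal_plus)
    also have "\<dots> < t" using s(2) \<epsilon>(1) by simp
    finally show "quantum_propinquity (?X k) ?Y < t" .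
  qed
qed simp

end

theorem theorem4p2:
  fixes A :: "'a cstar" and U :: "nat \<Rightarrow> 'a set" and I :: "enat \<Rightarrow> 'a set"
    and \<mu> :: "enat \<Rightarrow> 'a set \<Rightarrow> complex" and c :: "nat \<Rightarrow> nat"
    and \<beta> :: "enat \<Rightarrow> nat \<Rightarrow> real"
  assumes "unital_cstar A" and "AF_sequence A U"
    and "\<And>k. I k \<in> closed_ideals A - {carrier A}"
    and "\<And>k. faithful_tracial_state (cstar_quotient A (I k)) (\<mu> k)"
    and "((\<lambda>n. ideal_metric U (I (enat n)) (I \<infinity>)) \<longlonglongrightarrow> 0)
         \<or> limitin (fell_ideal_topology A) (\<lambda>n. I (enat n)) (I \<infinity>) sequentially"
    and "fusing_sequence U I c"
    and "\<And>N. limitin (weak_star_topology (A\<lparr>carrier := U N\<rparr>))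
               (\<lambda>j. restrict (\<mu> (enat (c N + j)) \<circ> quotient_proj A (I (enat (c N + j)))) (U N))
               (restrict (\<mu> \<infinity> \<circ> quotient_proj A (I \<infinity>)) (U N)) sequentially"
    and "\<And>k n. 0 < \<beta> k n"
    and "\<And>N k n. \<lbrakk>c N \<le> k; n \<le> N\<rbrakk> \<Longrightarrow> \<beta> (enat k) n = \<beta> \<infinity> n"
    and "\<exists>B :: nat \<Rightarrow> real. (\<forall>l. 0 < B l) \<and> B \<longlonglongrightarrow> 0 \<and> (\<forall>m l. \<beta> m l \<le> B l)"
  shows "(\<lambda>n. quantum_propinquity
            (cstar_quotient A (I (enat n)),
             AF_lip (cstar_quotient A (I (enat n))) (quotient_sequence A U (I (enat n)))
               (\<mu> (enat n)) (\<beta> (enat n)))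
            (cstar_quotient A (I \<infinity>),
             AF_lip (cstar_quotient A (I \<infinity>)) (quotient_sequence A U (I \<infinity>))
               (\<mu> \<infinity>) (\<beta> \<infinity>)))
         \<longlonglongrightarrow> 0"
proof -
  obtain bd :: "nat \<Rightarrow> real" where bd: "bd \<longlonglongrightarrow> 0" "\<And>m l. \<beta> m l \<le> bd l" using assms(10) by blast
  have "convergent_quotients A U I \<mu> c \<beta> bd"
  proof (rule convergent_quotients.intro)
    fix N k assume "c N \<le> k"
    then show "I (enat k) \<inter> U N = I \<infinity> \<inter> U N" using assms(6) by (simp add: fusing_sequence_def)
  next
    fix N x assume x: "x \<in> U N"
    have "limitin (product_topology (\<lambda>_. euclidean) (U N))
        (\<lambda>j. restrict (\<mu> (enat (c N + j)) \<circ> quotient_proj A (I (enat (c N + j)))) (U N))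
        (restrict (\<mu> \<infinity> \<circ> quotient_proj A (I \<infinity>)) (U N)) sequentially"
      using assms(7)[of N] by (simp add: weak_star_topology_def limitin_subtopology)
    then show "(\<lambda>j. \<mu> (enat (c N + j)) (quotient_proj A (I (enat (c N + j))) x))
        \<longlonglongrightarrow> \<mu> \<infinity> (quotient_proj A (I \<infinity>) x)"
      using x unfolding limitin_componentwise by auto
  qed (use assms bd in auto)
  then show ?thesis by (rule convergent_quotients.quantum_propinquity_tendsto)
qed

end
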